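(* Assume that: (A.1)$'$ the matrix $A$ is finitely irreducible; (A.2) $X_M$ has a periodic point for $\sigma$; (A.3) $\varphi:X\to\mathbb{R}$ is summable and $[\varphi]_{k+1}<\infty$ for some fixed integer $k\ge1$. Put $\lambda=\exp(P(\varphi|_{X_M}))$. If $X_A$ is not a finite single orbit, then the essential spectral radius of $\mathcal{L}_M:F^k_b(X)\to F^k_b(X)$ is equal to $\lambda\theta$.
   Context: Let $S$ be a countable set, $A=(A(ij))_{i,j\in S}$ a zero-one matrix, and $X=X_A=\{\omega=\omega_0\omega_1\cdots\in\prod_{n\ge0}S: A(\omega_i\omega_{i+1})=1 \text{ for all } i\ge 0\}$ with shift $(\sigma\omega)_n=\omega_{n+1}$. For $w\in S^n$, $[w]=\{\omega\in X:\omega_0\cdots\omega_{n-1}=w\}$. Fix $\theta\in(0,1)$ and the metric $d_\theta(\omega,\upsilon)=\theta^{\min\{n\ge0:\omega_n\ne\upsilon_n\}}$ for $\omega\ne\upsilon$, $d_\theta(\omega,\omega)=0$. For a function $f$ on $X$, $\mathrm{var}_n f=\sup\{|f(\omega)-f(\upsilon)|:\omega_i=\upsilon_i,\ 0\le i\le n-1\}$ and $[f]_k=\sup_{n\ge k}\mathrm{var}_nf/\theta^n$. $F^k_b(X)$ is the Banach space of bounded continuous $f:X\to\mathbb{C}$ with $[f]_k<\infty$, with norm $\|f\|_k=\|f\|_\infty+[f]_k$. $S_0\subset S$ is nonempty and $M=(M(ij))_{i,j\in S_0}$ is a zero-one matrix with $M(ij)\le A(ij)$; put $M(ij)=0$ if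 $i\notin S_0$ or $j\notin S_0$. $X_M=\{\omega\in\prod_{n\ge0}S_0: M(\omega_n\omega_{n+1})=1\ \forall n\ge0\}\subset X$. $A$ is finitely irreducible if there is a finite set $F\subset\bigcup_{n\ge1}S^n$ such that for all $a,b\in S$ there is $w\in F$ for which the concatenated word $awb$ is $A$-admissible (all consecutive letters $ij$ satisfy $A(ij)=1$). A function $\varphi:X\to\mathbb{R}$ is summable if $\sum_{s\in S:[s]\ne\emptyset}\exp(\sup_{[s]}\varphi)<\infty$. With $S_n\varphi=\sum_{i=0}^{n-1}\varphi\circ\sigma^i$, $P(\varphi|_{X_M})=\lim_{n\to\infty}\frac1n\log\sum_{w\in S_0^n:[w]\cap X_M\neq\emptyset}\exp(\sup_{[w]\cap X_M}S_n\varphi)$. The operator $\mathcal{L}_M=\mathcal{L}_{M,\varphi}$ is $\mathcal{L}_Mf(\omega)=\sum_{a\in S:M(a\omega_0)=1}e^{\varphi(a\cdot\omega)}f(a\cdot\omega)$, where $a\cdot\omega=a\omega_0\omega_1\cdots$; it is bounded on $F_b^k(X)$. The essential spectral radius is the infimum of $r\ge 0$ such that every spectral value of modulus $>r$ is an isolated eigenvalue of finite algebraic multiplicity. "$X_A$ is a finite single orbit" means $X_A=\{\omega,\sigma\omega,\dots,\sigma^{q-1}\omega\}$ for some $\omega$ and $q\geq 1$. *)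

theory Defs
  imports "HOL-Complex_Analysis.Complex_Analysis"
begin

section \<open>Topological Markov shifts\<close>

text \<open>
  The countable alphabet \<open>S\<close> is the whole of a type of class \<open>countable\<close> (possibly finite);
  sequences over it are functions on \<open>nat\<close>, and finite words are lists.
\<close>

definition zero_one_matrix :: "('s \<Rightarrow> 's \<Rightarrow> nat) \<Rightarrow> bool" where
  "zero_one_matrix A \<longleftrightarrow> (\<forall>i j. A i j = 0 \<or> A i j = 1)"

definition path_space :: "'s set \<Rightarrow> ('s \<Rightarrow> 's \<Rightarrow> nat) \<Rightarrow> (nat \<Rightarrow> 's) set" where
  "path_space E A = {\<omega>. (\<forall>n. \<omega> n \<in> E) \<and> (\<forall>n. A (\<omega> n) (\<omega> (Suc n)) = 1)}"

abbreviation full_path_space :: "('s \<Rightarrow> 's \<Rightarrow> nat) \<Rightarrow> (nat \<Rightarrow> 's) set" where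
  "full_path_space A \<equiv> path_space UNIV A"

definition lshift :: "(nat \<Rightarrow> 's) \<Rightarrow> nat \<Rightarrow> 's" where
  "lshift \<omega> = (\<lambda>n. \<omega> (Suc n))"

definition prepend :: "'s \<Rightarrow> (nat \<Rightarrow> 's) \<Rightarrow> nat \<Rightarrow> 's" where
  "prepend a \<omega> = case_nat a \<omega>"

definition cylinder :: "(nat \<Rightarrow> 's) set \<Rightarrow> 's list \<Rightarrow> (nat \<Rightarrow> 's) set" where
  "cylinder X w = {\<omega> \<in> X. \<forall>i<length w. \<omega> i = w ! i}"

definition admissible :: "('s \<Rightarrow> 's \<Rightarrow> nat) \<Rightarrow> 's list \<Rightarrow> bool" where
  "admissible A w \<longleftrightarrow> successively (\<lambda>i j. A i j = 1) w"

definition finitely_irreducible :: "('s \<Rightarrow> 's \<Rightarrow> nat) \<Rightarrow> bool" where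
  "finitely_irreducible A \<longleftrightarrow>
     (\<exists>F. finite F \<and> [] \<notin> F \<and> (\<forall>a b. \<exists>w\<in>F. admissible A (a # w @ [b])))"

definition has_periodic_point :: "(nat \<Rightarrow> 's) set \<Rightarrow> bool" where
  "has_periodic_point X \<longleftrightarrow> (\<exists>\<omega>\<in>X. \<exists>p\<ge>1. (lshift ^^ p) \<omega> = \<omega>)"

definition finite_single_orbit :: "(nat \<Rightarrow> 's) set \<Rightarrow> bool" where
  "finite_single_orbit X \<longleftrightarrow> (\<exists>\<omega>. \<exists>q\<ge>1. X = (\<lambda>i. (lshift ^^ i) \<omega>) ` {..<q})"

definition d_theta :: "real \<Rightarrow> (nat \<Rightarrow> 's) \<Rightarrow> (nat \<Rightarrow> 's) \<Rightarrow> real" where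
  "d_theta \<theta> \<omega> \<upsilon> = (if \<omega> = \<upsilon> then 0 else \<theta> ^ (LEAST n. \<omega> n \<noteq> \<upsilon> n))"

lemma Metric_space_d_theta:
  assumes "0 < \<theta>" "\<theta> < 1"
  shows "Metric_space X (d_theta \<theta>)"
proof
  fix x y z :: "nat \<Rightarrow> 'a"
  show "0 \<le> d_theta \<theta> x y" using assms by (simp add: d_theta_def)
  show "d_theta \<theta> x y = d_theta \<theta> y x" 
    unfolding d_theta_def by (simp add: eq_commute)
  show "(d_theta \<theta> x y = 0) = (x = y)" using assms by (simp add: d_theta_def)
  show "d_theta \<theta> x z \<le> d_theta \<theta> x y + d_theta \<theta> y z"
  proof (cases "x = y \<or> y = z \<or> x = z")
    case True
    then show ?thesis using assms by (auto simp: d_theta_def)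
  next
    case False
    let ?n = "LEAST n. x n \<noteq> z n"
    have "\<exists>n. x n \<noteq> z n" using False by auto
    then have n: "x ?n \<noteq> z ?n" by (rule LeastI_ex)
    have "(LEAST n. x n \<noteq> y n) \<le> ?n \<or> (LEAST n. y n \<noteq> z n) \<le> ?n"
    proof (cases "x ?n = y ?n")
      case True
      then have "y ?n \<noteq> z ?n" using n by simp
      then show ?thesis by (intro disjI2 Least_le)
    next
      case False
      then show ?thesis by (intro disjI1 Least_le)
    qed
    then have "\<theta> ^ ?n \<le> \<theta> ^ (LEAST n. x n \<noteq> y n) \<or> \<theta> ^ ?n \<le> \<theta> ^ (LEAST n. y n \<noteq> z n)"
      using assms by (auto intro: power_decreasing)
    moreover have "0 \<le> \<theta> ^ (LEAST n. x n \<noteq> y n)" "0 \<le> \<theta> ^ (LEAST n. y n \<noteq> z n)"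
      using assms by auto
    ultimately show ?thesis using False by (auto simp: d_theta_def)
  qed
qed

section \<open>Variations and function spaces\<close>

definition var_n :: "(nat \<Rightarrow> 's) set \<Rightarrow> nat \<Rightarrow> ((nat \<Rightarrow> 's) \<Rightarrow> 'b::real_normed_vector) \<Rightarrow> ennreal" where
  "var_n X n f =
     (SUP (\<omega>, \<upsilon>) \<in> {(\<omega>, \<upsilon>). \<omega> \<in> X \<and> \<upsilon> \<in> X \<and> (\<forall>i<n. \<omega> i = \<upsilon> i)}. ennreal (norm (f \<omega> - f \<upsilon>)))"

definition lip_seminorm ::
    "(nat \<Rightarrow> 's) set \<Rightarrow> real \<Rightarrow> nat \<Rightarrow> ((nat \<Rightarrow> 's) \<Rightarrow> 'b::real_normed_vector) \<Rightarrow> ennreal" where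
  "lip_seminorm X \<theta> k f = (SUP n\<in>{k..}. var_n X n f / ennreal (\<theta> ^ n))"

text \<open>
  A function on \<open>X\<close> is represented by the total function that vanishes off \<open>X\<close>, so that functions
  on \<open>X\<close> form a linear space and equality on \<open>X\<close> is equality.
\<close>

definition Fb :: "(nat \<Rightarrow> 's) set \<Rightarrow> real \<Rightarrow> nat \<Rightarrow> ((nat \<Rightarrow> 's) \<Rightarrow> complex) set" where
  "Fb X \<theta> k = {f. (\<forall>\<omega>. \<omega> \<notin> X \<longrightarrow> f \<omega> = 0) \<and> bounded (f ` X) \<and>
     continuous_map (Metric_space.mtopology X (d_theta \<theta>)) euclidean f \<and>
     lip_seminorm X \<theta> k f < \<infinity>}"

definition Fb_norm :: "(nat \<Rightarrow> 's) set \<Rightarrow> real \<Rightarrow> nat \<Rightarrow> ((nat \<Rightarrow> 's) \<Rightarrow> complex) \<Rightarrow> real" where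
  "Fb_norm X \<theta> k f = (SUP \<omega>\<in>X. norm (f \<omega>)) + enn2real (lip_seminorm X \<theta> k f)"

section \<open>Potentials, pressure and the transfer operator\<close>

text \<open>
  As \<open>Sup\<close> on \<open>real\<close> is only meaningful for bounded sets, finiteness of the suprema
  (implicit in the convergence of the series) is stated separately.
\<close>

definition summable_potential :: "(nat \<Rightarrow> 's) set \<Rightarrow> ((nat \<Rightarrow> 's) \<Rightarrow> real) \<Rightarrow> bool" where
  "summable_potential X \<phi> \<longleftrightarrow>
     (\<forall>s. bdd_above (\<phi> ` cylinder X [s])) \<and>
     (\<lambda>s. exp (SUP \<omega>\<in>cylinder X [s]. \<phi> \<omega>)) summable_on {s. cylinder X [s] \<noteq> {}}"

definition birkhoff_sum :: "((nat \<Rightarrow> 's) \<Rightarrow> real) \<Rightarrow> nat \<Rightarrow> (nat \<Rightarrow> 's) \<Rightarrow> real" where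
  "birkhoff_sum \<phi> n \<omega> = (\<Sum>i<n. \<phi> ((lshift ^^ i) \<omega>))"

definition pressure ::
    "(nat \<Rightarrow> 's) set \<Rightarrow> 's set \<Rightarrow> (nat \<Rightarrow> 's) set \<Rightarrow> ((nat \<Rightarrow> 's) \<Rightarrow> real) \<Rightarrow> real" where
  "pressure X S0 XM \<phi> =
     lim (\<lambda>n. 1 / real n *
       ln (\<Sum>\<^sub>\<infinity>w\<in>{w. length w = n \<and> set w \<subseteq> S0 \<and> cylinder X w \<inter> XM \<noteq> {}}.
             exp (SUP \<omega>\<in>cylinder X w \<inter> XM. birkhoff_sum \<phi> n \<omega>)))"

definition transfer_op :: "(nat \<Rightarrow> 's) set \<Rightarrow> ('s \<Rightarrow> 's \<Rightarrow> nat) \<Rightarrow> ((nat \<Rightarrow> 's) \<Rightarrow> real) \<Rightarrow>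
    ((nat \<Rightarrow> 's) \<Rightarrow> complex) \<Rightarrow> (nat \<Rightarrow> 's) \<Rightarrow> complex" where
  "transfer_op X M \<phi> f \<omega> =
     (if \<omega> \<in> X
      then \<Sum>\<^sub>\<infinity>a\<in>{a. M a (\<omega> 0) = 1}. complex_of_real (exp (\<phi> (prepend a \<omega>))) * f (prepend a \<omega>)
      else 0)"

section \<open>Spectral theory on a normed space of complex functions\<close>

text \<open>
  \<open>V\<close> is a linear space of complex functions with norm \<open>N\<close>, and \<open>T\<close> a linear operator on \<open>V\<close>.
\<close>

definition pencil :: "(('x \<Rightarrow> complex) \<Rightarrow> 'x \<Rightarrow> complex) \<Rightarrow> complex \<Rightarrow> ('x \<Rightarrow> complex) \<Rightarrow> 'x \<Rightarrow> complex" where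
  "pencil T z f = (\<lambda>x. z * f x - T f x)"

definition resolvent :: "('x \<Rightarrow> complex) set \<Rightarrow> (('x \<Rightarrow> complex) \<Rightarrow> 'x \<Rightarrow> complex) \<Rightarrow>
    complex \<Rightarrow> ('x \<Rightarrow> complex) \<Rightarrow> 'x \<Rightarrow> complex" where
  "resolvent V T z = inv_into V (pencil T z)"

definition spectrum :: "('x \<Rightarrow> complex) set \<Rightarrow> (('x \<Rightarrow> complex) \<Rightarrow> real) \<Rightarrow>
    (('x \<Rightarrow> complex) \<Rightarrow> 'x \<Rightarrow> complex) \<Rightarrow> complex set" where
  "spectrum V N T =
     {z. \<not> (bij_betw (pencil T z) V V \<and> (\<exists>C. \<forall>f\<in>V. N (resolvent V T z f) \<le> C * N f))}"

definition eigenvalue :: "('x \<Rightarrow> complex) set \<Rightarrow> (('x \<Rightarrow> complex) \<Rightarrow> 'x \<Rightarrow> complex) \<Rightarrow> complex \<Rightarrow> bool" where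
  "eigenvalue V T z \<longleftrightarrow> (\<exists>f\<in>V. f \<noteq> (\<lambda>x. 0) \<and> T f = (\<lambda>x. z * f x))"

definition finite_dimensional :: "('x \<Rightarrow> complex) set \<Rightarrow> bool" where
  "finite_dimensional W \<longleftrightarrow>
     (\<exists>B. finite B \<and> (\<forall>f\<in>W. \<exists>c. f = (\<lambda>x. \<Sum>b\<in>B. c b * b x)))"

text \<open>
  The Riesz projection, that is, the integral of the resolvent over the circle of radius \<open>r\<close>
  around \<open>z\<close> divided by \<open>2 \<pi> \<i>\<close>. The operator-valued integral is evaluated pointwise, which is
  legitimate in spaces where point evaluations are continuous, such as \<open>Fb\<close>.
\<close>

definition riesz_projection :: "('x \<Rightarrow> complex) set \<Rightarrow> (('x \<Rightarrow> complex) \<Rightarrow> 'x \<Rightarrow> complex) \<Rightarrow>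
    complex \<Rightarrow> real \<Rightarrow> ('x \<Rightarrow> complex) \<Rightarrow> 'x \<Rightarrow> complex" where
  "riesz_projection V T z r f x =
     1 / (2 * of_real pi * \<i>) * contour_integral (circlepath z r) (\<lambda>\<zeta>. resolvent V T \<zeta> f x)"

text \<open>
  The algebraic multiplicity of an isolated spectral value is the dimension of the range of its
  Riesz projection. (The dimension of the union of the kernels of \<open>(z - T)\<^sup>n\<close> can be smaller.)
  It does not depend on the choice of the radius.
\<close>

definition finite_algebraic_multiplicity :: "('x \<Rightarrow> complex) set \<Rightarrow> (('x \<Rightarrow> complex) \<Rightarrow> real) \<Rightarrow>
    (('x \<Rightarrow> complex) \<Rightarrow> 'x \<Rightarrow> complex) \<Rightarrow> complex \<Rightarrow> bool" where
  "finite_algebraic_multiplicity V N T z \<longleftrightarrow>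
     (\<exists>r>0. spectrum V N T \<inter> cball z r = {z} \<and> finite_dimensional (riesz_projection V T z r ` V))"

definition essential_spectral_radius :: "('x \<Rightarrow> complex) set \<Rightarrow> (('x \<Rightarrow> complex) \<Rightarrow> real) \<Rightarrow>
    (('x \<Rightarrow> complex) \<Rightarrow> 'x \<Rightarrow> complex) \<Rightarrow> real" where
  "essential_spectral_radius V N T =
     Inf {r. 0 \<le> r \<and> (\<forall>z \<in> spectrum V N T. norm z > r \<longrightarrow>
            z isolated_in spectrum V N T \<and> eigenvalue V T z \<and> finite_algebraic_multiplicity V N T z)}"

end

theory Submission
  imports Defs "Jordan_Normal_Form.Determinant"
begin

text \<open>
  Let \<open>L\<close> be the transfer operator and \<open>\<Lambda>\<close> the exponential of the pressure of the subsystem.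

  \<^bold>\<open>Upper bound.\<close> Replacing \<open>f\<close> by its value at one point of each cylinder of length \<open>n\<close> changes
  \<open>L ^ n f\<close> by at most a constant times \<open>\<theta> ^ n\<close> times the total weight of the words of length \<open>n\<close>, and
  truncating to finitely many cylinders leaves an operator of finite rank. So \<open>L ^ n\<close> is a finite rank
  operator up to an error of norm \<open>(\<Lambda> \<theta> + \<epsilon>) ^ n\<close>. Outside the disc of radius \<open>\<Lambda> \<theta> + \<epsilon>\<close> the resolvent is
  therefore given by Cramer's rule with a holomorphic determinant, whose zeros are isolated.
  The words of length \<open>n\<close> include some that do not extend to a point of the subsystem, and the
  subsystem need not be irreducible; still the growth rate of their total weight is \<open>\<Lambda>\<close>. Indeed all but
  finitely many blocks of length \<open>k\<close> have small total weight, and cutting a word at the first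
  and the last occurrence of each of the remaining blocks bounds the sum over all words by sums over loops;
  loops give periodic points of the subsystem.

  \<^bold>\<open>Lower bound.\<close> By the same argument, for \<open>\<eta> < \<Lambda>\<close> there is a block with arbitrarily long loops of
  total weight more than \<open>\<eta> ^ n\<close>. They define a right inverse \<open>U\<close> of \<open>L ^ n\<close> on the functions supported in the
  cylinder of the block, of spectral radius at most \<open>1 / (\<eta> \<theta>) ^ n\<close>. As the Markov shift is not a single
  finite orbit, some function \<open>g \<noteq> 0\<close> with this support has \<open>L ^ n g = 0\<close>, and \<open>f = g + z ^ n U f\<close> then solves
  \<open>L ^ n f = z ^ n f\<close> if \<open>\<bar>z\<bar> < \<eta> \<theta>\<close>. Hence the spectrum meets every circle of radius less than
  \<open>\<Lambda> \<theta>\<close>, and so has non-isolated points of modulus arbitrarily close to \<open>\<Lambda> \<theta>\<close>.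
\<close>

section \<open>Holomorphic systems of linear equations\<close>

text \<open>Blocks of length \<open>k\<close> play the part of letters: the hypothesis on \<phi>
  makes the Birkhoff sums \<open>S n\<close> of two points comparable once they agree on
  \<open>n + k\<close> letters. Hence cylinder weights look \<open>k\<close> letters ahead, and a
  loop at a block \<open>u\<close> is a word \<open>l\<close> such that \<open>l @ u\<close> begins
  with \<open>u\<close>.

  In the upper bound the determinant must not vanish identically. At a large argument a zero would
  produce an eigenvector of \<open>T ^^ n\<close> whose eigenvalue exceeds the norm of
  \<open>T ^^ n\<close>.

  In the lower bound one \<open>n\<close> is fixed and \<open>U\<close> is iterated, so a constant
  in front of \<open>1 / (\<eta> * \<theta>) ^ n\<close> would be raised to every power. It is
  absorbed by giving the supremum norm a large weight; the space of functions stays the same, so the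
  eigenfunction found in the new norm is also one for the original operator. An eigenfunction of
  \<open>L ^^ n\<close> for \<open>z ^ n\<close> yields a spectral value of \<open>L\<close> that is
  known only up to an \<open>n\<close>-th root of unity, which is why whole circles, rather than
  single points, are shown to meet the spectrum.\<close>

lemma holomorphic_cramer:
  fixes a :: "nat \<Rightarrow> nat \<Rightarrow> complex \<Rightarrow> complex"
  assumes hol: "\<And>i j. i < m \<Longrightarrow> j < m \<Longrightarrow> a i j holomorphic_on S"
  obtains D b where
    "D holomorphic_on S"
    "\<And>i j. i < m \<Longrightarrow> j < m \<Longrightarrow> b i j holomorphic_on S"
    "\<And>z i k. i < m \<Longrightarrow> k < m \<Longrightarrow> (\<Sum>j<m. a i j z * b j k z) = (if i = k then D z else 0)"
    "\<And>z i k. i < m \<Longrightarrow> k < m \<Longrightarrow> (\<Sum>j<m. b i j z * a j k z) = (if i = k then D z else 0)"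
    "\<And>z. D z = 0 \<Longrightarrow> \<exists>c. (\<exists>i<m. c i \<noteq> 0) \<and> (\<forall>i<m. (\<Sum>j<m. a i j z * c j) = 0)"
proof -
  have det_hol: "(\<lambda>z. det (mat r r (\<lambda>(i, j). g i j z))) holomorphic_on S"
    if "\<And>i j. i < r \<Longrightarrow> j < r \<Longrightarrow> g i j holomorphic_on S"
    for r and g :: "nat \<Rightarrow> nat \<Rightarrow> complex \<Rightarrow> complex"
  proof -
    have "det (mat r r (\<lambda>(i, j). g i j z))
        = (\<Sum>p\<in>{p. p permutes {0..<r}}. signof p * (\<Prod>i\<in>{0..<r}. g i (p i) z))" for z
    proof -
      have "(\<Prod>i = 0..<r. mat r r (\<lambda>(i, j). g i j z) $$ (i, p i)) = (\<Prod>i\<in>{0..<r}. g i (p i) z)"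
        if "p permutes {0..<r}" for p
        using permutes_in_image[OF that] by (intro prod.cong) auto
      then show ?thesis by (simp add: det_def'[of _ r])
    qed
    moreover have "p i < r" if "p permutes {0..<r}" "i < r" for p i
      using permutes_in_image[OF that(1), of i] that(2) by simp
    ultimately show ?thesis
      by (simp only:) (intro holomorphic_intros that; simp)
  qed
  define Mz where "Mz z = mat m m (\<lambda>(i, j). a i j z)" for z
  have Mz: "Mz z \<in> carrier_mat m m" for z by (simp add: Mz_def)
  have cof: "(\<lambda>z. cofactor (Mz z) j i) holomorphic_on S" if "i < m" "j < m" for i j
  proof -
    \<comment> \<open>Deleting a row and a column only renumbers the entries, so the minor is again
      a determinant of holomorphic functions.\<close>
    have eq: "mat_delete (Mz z) j i = mat (m - 1) (m - 1)
        (\<lambda>(p, q). a (if p < j then p else Suc p) (if q < i then q else Suc q) z)" for z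
      using that by (auto simp: mat_delete_def Mz_def intro!: eq_matI)
    have "(\<lambda>z. det (mat_delete (Mz z) j i)) holomorphic_on S"
      unfolding eq
      by (rule det_hol[where g = "\<lambda>p q. a (if p < j then p else Suc p) (if q < i then q else Suc q)"])
        (auto intro!: hol)
    then show ?thesis unfolding cofactor_def by (intro holomorphic_intros)
  qed
  have adj: "adj_mat (Mz z) \<in> carrier_mat m m" "Mz z * adj_mat (Mz z) = det (Mz z) \<cdot>\<^sub>m 1\<^sub>m m"
    "adj_mat (Mz z) * Mz z = det (Mz z) \<cdot>\<^sub>m 1\<^sub>m m" for z
    using adj_mat[OF Mz] by auto
  show ?thesis
  \<comment> \<open>The witnesses are the determinant and the adjugate. Both are polynomials in the
    entries, so nothing is divided and the two identities persist at the zeros of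
    \<open>D\<close>.\<close>
  proof (rule that[of "\<lambda>z. det (Mz z)" "\<lambda>i j z. cofactor (Mz z) j i"])
    show "(\<lambda>z. det (Mz z)) holomorphic_on S"
      unfolding Mz_def by (rule det_hol) (rule hol)
    show "(\<lambda>z. cofactor (Mz z) j i) holomorphic_on S" if "i < m" "j < m" for i j
      using cof that by blast
    show "(\<Sum>j<m. a i j z * cofactor (Mz z) k j) = (if i = k then det (Mz z) else 0)"
      if "i < m" "k < m" for z i k
    proof -
      have "(Mz z * adj_mat (Mz z)) $$ (i, k) = (\<Sum>j<m. a i j z * cofactor (Mz z) k j)"
        using that by (simp add: adj_mat_def Mz_def scalar_prod_def lessThan_atLeast0)
      then show ?thesis using that unfolding adj(2) by auto
    qed
    show "(\<Sum>j<m. cofactor (Mz z) j i * a j k z) = (if i = k then det (Mz z) else 0)"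
      if "i < m" "k < m" for z i k
    proof -
      have "(adj_mat (Mz z) * Mz z) $$ (i, k) = (\<Sum>j<m. cofactor (Mz z) j i * a j k z)"
        using that by (simp add: adj_mat_def Mz_def scalar_prod_def lessThan_atLeast0)
      then show ?thesis using that unfolding adj(3) by auto
    qed
    show "\<exists>c. (\<exists>i<m. c i \<noteq> 0) \<and> (\<forall>i<m. (\<Sum>j<m. a i j z * c j) = 0)" if d0: "det (Mz z) = 0" for z
    proof -
      obtain v where v: "v \<in> carrier_vec m" "v \<noteq> 0\<^sub>v m" "Mz z *\<^sub>v v = 0\<^sub>v m"
        using d0 det_0_iff_vec_prod_zero_field[OF Mz] by auto
      have "\<exists>i<m. vec_index v i \<noteq> 0"
      proof (rule ccontr)
        assume "\<not> ?thesis"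
        then have "v = 0\<^sub>v m" using v(1) by (intro eq_vecI) auto
        with v(2) show False by simp
      qed
      moreover have "(\<Sum>j<m. a i j z * vec_index v j) = 0" if "i < m" for i
      proof -
        have "vec_index (Mz z *\<^sub>v v) i = (\<Sum>j<m. a i j z * vec_index v j)"
          using that v(1) by (simp add: Mz_def scalar_prod_def lessThan_atLeast0)
        then show ?thesis using v(3) that by simp
      qed
      ultimately show ?thesis by (intro exI[of _ "vec_index v"]) auto
    qed
  qed
qed

section \<open>Normed spaces of complex functions\<close>

text \<open>Completeness takes the form of \<open>suminf_mem\<close> and \<open>N_suminf\<close>: a
  series with summable norms is summed pointwise, and the sum stays in \<open>V\<close>.
  \<open>N_eval\<close> makes point evaluations bounded, so operator identities can be checked at
  points; it also gives the definiteness of \<open>N\<close>.\<close>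

locale fun_space =
  fixes V :: "('x \<Rightarrow> complex) set" and N :: "('x \<Rightarrow> complex) \<Rightarrow> real"
  assumes zero_mem: "(\<lambda>x. 0) \<in> V"
    and add_mem: "\<And>f g. f \<in> V \<Longrightarrow> g \<in> V \<Longrightarrow> (\<lambda>x. f x + g x) \<in> V"
    and scale_mem: "\<And>c f. f \<in> V \<Longrightarrow> (\<lambda>x. c * f x) \<in> V"
    and N_add: "\<And>f g. f \<in> V \<Longrightarrow> g \<in> V \<Longrightarrow> N (\<lambda>x. f x + g x) \<le> N f + N g"
    and N_scale_le: "\<And>c f. f \<in> V \<Longrightarrow> N (\<lambda>x. c * f x) \<le> cmod c * N f"
    and N_eval: "\<And>f x. f \<in> V \<Longrightarrow> cmod (f x) \<le> N f"
    and suminf_mem: "\<And>F. (\<And>j. F j \<in> V) \<Longrightarrow> summable (\<lambda>j. N (F j)) \<Longrightarrow> (\<lambda>x. \<Sum>j. F j x) \<in> V"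
    and N_suminf: "\<And>F. (\<And>j. F j \<in> V) \<Longrightarrow> summable (\<lambda>j. N (F j)) \<Longrightarrow> N (\<lambda>x. \<Sum>j. F j x) \<le> (\<Sum>j. N (F j))"
begin

lemma N_nonneg: "f \<in> V \<Longrightarrow> 0 \<le> N f"
  using N_eval[of f undefined] norm_ge_zero order_trans by blast

lemma N_zero [simp]: "N (\<lambda>x. 0) = 0"
  using N_scale_le[OF zero_mem, of 0] N_nonneg[OF zero_mem] by simp

lemma N_eq_0D: "f \<in> V \<Longrightarrow> N f \<le> 0 \<Longrightarrow> f = (\<lambda>x. 0)"
  using N_eval[of f] by (intro ext) (metis norm_le_zero_iff order_trans)

lemma N_scale: 
  assumes "f \<in> V" 
  shows "N (\<lambda>x. c * f x) = cmod c * N f"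
proof (cases "c = 0")
  case False
  have "N f = N (\<lambda>x. inverse c * (c * f x))" using False by (simp add: mult.assoc[symmetric])
  also have "\<dots> \<le> cmod (inverse c) * N (\<lambda>x. c * f x)"
    by (rule N_scale_le) (rule scale_mem[OF assms])
  finally have "cmod c * N f \<le> N (\<lambda>x. c * f x)"
    using False by (simp add: norm_inverse norm_divide field_simps)
  then show ?thesis using N_scale_le[OF assms, of c] by simp
qed simp

lemma diff_mem: "f \<in> V \<Longrightarrow> g \<in> V \<Longrightarrow> (\<lambda>x. f x - g x) \<in> V"
  using add_mem[of f "\<lambda>x. -1 * g x"] scale_mem[of g "-1"] by simp

lemma N_diff: "f \<in> V \<Longrightarrow> g \<in> V \<Longrightarrow> N (\<lambda>x. f x - g x) \<le> N f + N g"
  using N_add[of f "\<lambda>x. -1 * g x"] scale_mem[of g "-1"] N_scale[of g "-1"] by simp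

lemma sum_mem: "(\<And>i. i \<in> I \<Longrightarrow> u i \<in> V) \<Longrightarrow> (\<lambda>x. \<Sum>i\<in>I. u i x) \<in> V"
  by (induction I rule: infinite_finite_induct) (auto simp: zero_mem intro: add_mem)

lemma lincomb_mem: "(\<And>i. i \<in> I \<Longrightarrow> u i \<in> V) \<Longrightarrow> (\<lambda>x. \<Sum>i\<in>I. c i * u i x) \<in> V"
  by (intro sum_mem scale_mem)

lemma N_sum_le:
  "(\<And>i. i \<in> I \<Longrightarrow> u i \<in> V) \<Longrightarrow> N (\<lambda>x. \<Sum>i\<in>I. u i x) \<le> (\<Sum>i\<in>I. N (u i))"
proof (induction I rule: infinite_finite_induct)
  case (insert i I)
  have "N (\<lambda>x. u i x + (\<Sum>i\<in>I. u i x)) \<le> N (u i) + N (\<lambda>x. \<Sum>i\<in>I. u i x)"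
    using insert by (intro N_add sum_mem) auto
  also have "\<dots> \<le> N (u i) + (\<Sum>i\<in>I. N (u i))"
    using insert by (intro add_left_mono) auto
  finally show ?case using insert by simp
qed auto

section \<open>Bounded functionals and bounded operators\<close>

definition bfun :: "(('x \<Rightarrow> complex) \<Rightarrow> complex) \<Rightarrow> bool" where
  "bfun l \<longleftrightarrow> (\<forall>f\<in>V. \<forall>g\<in>V. l (\<lambda>x. f x + g x) = l f + l g) \<and>
     (\<forall>c. \<forall>f\<in>V. l (\<lambda>x. c * f x) = c * l f) \<and> (\<exists>C. \<forall>f\<in>V. cmod (l f) \<le> C * N f)"

definition bop :: "(('x \<Rightarrow> complex) \<Rightarrow> 'x \<Rightarrow> complex) \<Rightarrow> bool" where
  "bop T \<longleftrightarrow> (\<forall>f\<in>V. T f \<in> V) \<and> (\<forall>f\<in>V. \<forall>g\<in>V. T (\<lambda>x. f x + g x) = (\<lambda>x. T f x + T g x)) \<and>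
     (\<forall>c. \<forall>f\<in>V. T (\<lambda>x. c * f x) = (\<lambda>x. c * T f x)) \<and> (\<exists>C. \<forall>f\<in>V. N (T f) \<le> C * N f)"

lemma bfunD:
  assumes "bfun l" "f \<in> V"
  shows "g \<in> V \<Longrightarrow> l (\<lambda>x. f x + g x) = l f + l g" "l (\<lambda>x. c * f x) = c * l f"
  using assms by (auto simp: bfun_def)

lemma bopD:
  assumes "bop T" "f \<in> V"
  shows "T f \<in> V" "g \<in> V \<Longrightarrow> T (\<lambda>x. f x + g x) = (\<lambda>x. T f x + T g x)"
    "T (\<lambda>x. c * f x) = (\<lambda>x. c * T f x)"
  using assms by (auto simp: bop_def)

lemma bfun_bound:
  assumes "bfun l"
  obtains C where "0 \<le> C" "\<And>f. f \<in> V \<Longrightarrow> cmod (l f) \<le> C * N f"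
proof -
  obtain C where C: "\<And>f. f \<in> V \<Longrightarrow> cmod (l f) \<le> C * N f" using assms unfolding bfun_def by blast
  have "cmod (l f) \<le> max C 0 * N f" if "f \<in> V" for f
    using C[OF that] mult_right_mono[of C "max C 0" "N f"] N_nonneg[OF that] by linarith
  then show ?thesis using that[of "max C 0"] by simp
qed

lemma bop_bound:
  assumes "bop T"
  obtains C where "0 \<le> C" "\<And>f. f \<in> V \<Longrightarrow> N (T f) \<le> C * N f"
proof -
  obtain C where C: "\<And>f. f \<in> V \<Longrightarrow> N (T f) \<le> C * N f" using assms unfolding bop_def by blast
  have "N (T f) \<le> max C 0 * N f" if "f \<in> V" for f
    using C[OF that] mult_right_mono[of C "max C 0" "N f"] N_nonneg[OF that] by linarith
  then show ?thesis using that[of "max C 0"] by simp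
qed

lemma bop_zero: "bop T \<Longrightarrow> T (\<lambda>x. 0) = (\<lambda>x. 0)"
  using bopD(3)[of T "\<lambda>x. 0" 0] zero_mem by simp

lemma bfun_zero: "bfun l \<Longrightarrow> l (\<lambda>x. 0) = 0"
  using bfunD(2)[of l "\<lambda>x. 0" 0] zero_mem by simp

lemma bop_diff:
  assumes "bop T" "f \<in> V" "g \<in> V"
  shows "T (\<lambda>x. f x - g x) = (\<lambda>x. T f x - T g x)"
  using bopD(2)[OF assms(1,2), of "\<lambda>x. -1 * g x"] bopD(3)[OF assms(1,3), of "-1"] scale_mem[OF assms(3), of "-1"]
  by simp

lemma bfun_lincomb:
  assumes "bfun l" "\<And>i. i \<in> I \<Longrightarrow> u i \<in> V"
  shows "l (\<lambda>x. \<Sum>i\<in>I. c i * u i x) = (\<Sum>i\<in>I. c i * l (u i))"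
  using assms(2)
proof (induction I rule: infinite_finite_induct)
  case (insert i I)
  have "l (\<lambda>x. c i * u i x + (\<Sum>i\<in>I. c i * u i x)) = l (\<lambda>x. c i * u i x) + l (\<lambda>x. \<Sum>i\<in>I. c i * u i x)"
    using insert by (intro bfunD(1)[OF assms(1)] scale_mem lincomb_mem) auto
  then show ?case using insert bfunD(2)[OF assms(1), of "u i"] by simp
qed (auto simp: bfun_zero[OF assms(1)])

lemma bfun_eval: "bfun (\<lambda>f. f x)"
  unfolding bfun_def using N_eval by (auto intro!: exI[of _ 1])

lemma bfun_comp: 
  assumes "bfun l" "bop T" 
  shows "bfun (\<lambda>f. l (T f))"
proof -
  obtain C where C: "0 \<le> C" "\<And>f. f \<in> V \<Longrightarrow> cmod (l f) \<le> C * N f" using bfun_bound[OF assms(1)] by blast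
  obtain D where D: "0 \<le> D" "\<And>f. f \<in> V \<Longrightarrow> N (T f) \<le> D * N f" using bop_bound[OF assms(2)] by blast
  have "cmod (l (T f)) \<le> (C * D) * N f" if "f \<in> V" for f
    using order_trans[OF C(2)[of "T f"] mult_left_mono[OF D(2)[OF that] C(1)]] bopD(1)[OF assms(2) that]
    by (simp add: mult.assoc)
  then show ?thesis unfolding bfun_def
    by (intro conjI exI[of _ "C * D"]) (auto simp: bopD[OF assms(2)] bfunD[OF assms(1)])
qed

lemma bop_comp: 
  assumes "bop S" "bop T" 
  shows "bop (\<lambda>f. S (T f))"
proof -
  obtain C where C: "0 \<le> C" "\<And>f. f \<in> V \<Longrightarrow> N (S f) \<le> C * N f" using bop_bound[OF assms(1)] by blast
  obtain D where D: "0 \<le> D" "\<And>f. f \<in> V \<Longrightarrow> N (T f) \<le> D * N f" using bop_bound[OF assms(2)] by blast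
  have "N (S (T f)) \<le> (C * D) * N f" if "f \<in> V" for f
    using order_trans[OF C(2)[of "T f"] mult_left_mono[OF D(2)[OF that] C(1)]] bopD(1)[OF assms(2) that]
    by (simp add: mult.assoc)
  then show ?thesis unfolding bop_def
    by (intro conjI exI[of _ "C * D"]) (auto simp: bopD[OF assms(2)] bopD[OF assms(1)])
qed

lemma bop_id: "bop (\<lambda>f. f)"
  unfolding bop_def by (auto intro!: exI[of _ 1])

lemma bop_funpow: "bop T \<Longrightarrow> bop (T ^^ n)"
proof (induction n)
  case 0 then show ?case using bop_id by (simp add: id_def)
next
  case (Suc n)
  then show ?case using bop_comp[OF \<open>bop T\<close>, of "T ^^ n"] by (simp add: o_def)
qed

lemma bop_scale: 
  assumes "bop T" 
  shows "bop (\<lambda>f x. c * T f x)"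
proof -
  obtain D where D: "0 \<le> D" "\<And>f. f \<in> V \<Longrightarrow> N (T f) \<le> D * N f" using bop_bound[OF assms] by blast
  have "N (\<lambda>x. c * T f x) \<le> (cmod c * D) * N f" if "f \<in> V" for f
    using mult_left_mono[OF D(2)[OF that], of "cmod c"] N_scale[OF bopD(1)[OF assms that], of c]
    by (simp add: mult.assoc)
  then show ?thesis unfolding bop_def
    using bopD[OF assms] by (intro conjI exI[of _ "cmod c * D"]) (auto intro!: scale_mem simp: algebra_simps)
qed

lemma bop_add: 
  assumes "bop S" "bop T" 
  shows "bop (\<lambda>f x. S f x + T f x)"
proof -
  obtain C where C: "0 \<le> C" "\<And>f. f \<in> V \<Longrightarrow> N (S f) \<le> C * N f" using bop_bound[OF assms(1)] by blast
  obtain D where D: "0 \<le> D" "\<And>f. f \<in> V \<Longrightarrow> N (T f) \<le> D * N f" using bop_bound[OF assms(2)] by blast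
  have "N (\<lambda>x. S f x + T f x) \<le> (C + D) * N f" if "f \<in> V" for f
    using N_add[OF bopD(1)[OF assms(1) that] bopD(1)[OF assms(2) that]] C(2)[OF that] D(2)[OF that]
    by (simp add: algebra_simps)
  then show ?thesis unfolding bop_def
    using bopD[OF assms(1)] bopD[OF assms(2)] by (intro conjI exI[of _ "C + D"]) (auto intro!: add_mem simp: algebra_simps)
qed

lemma bop_sum: "(\<And>i. i \<in> I \<Longrightarrow> bop (T i)) \<Longrightarrow> bop (\<lambda>f x. \<Sum>i\<in>I. T i f x)"
proof (induction I rule: infinite_finite_induct)
  case (insert i I)
  then show ?case using bop_add[of "T i" "\<lambda>f x. \<Sum>i\<in>I. T i f x"] by simp
qed (auto simp: bop_def zero_mem intro!: exI[of _ 0])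

lemma bop_rank_one: 
  assumes "bfun l" "u \<in> V" 
  shows "bop (\<lambda>f x. l f * u x)"
proof -
  obtain C where C: "0 \<le> C" "\<And>f. f \<in> V \<Longrightarrow> cmod (l f) \<le> C * N f" using bfun_bound[OF assms(1)] by blast
  have "N (\<lambda>x. l f * u x) \<le> (C * N u) * N f" if "f \<in> V" for f
    using mult_right_mono[OF C(2)[OF that] N_nonneg[OF assms(2)]] N_scale[OF assms(2), of "l f"]
    by (simp add: ac_simps)
  then show ?thesis unfolding bop_def
    using bfunD[OF assms(1)] by (intro conjI exI[of _ "C * N u"]) (auto intro!: scale_mem[OF assms(2)] simp: algebra_simps)
qed

text \<open>The value of \<open>l\<close> on a tail is at most a constant times the tail of the
  series of norms, which tends to 0; the finite part is handled by linearity.\<close>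

lemma bfun_suminf:
  assumes l: "bfun l" and F: "\<And>j. F j \<in> V" and sm: "summable (\<lambda>j. N (F j))"
  shows "(\<lambda>j. l (F j)) sums l (\<lambda>x. \<Sum>j. F j x)"
proof -
  obtain C where C: "0 \<le> C" "\<And>f. f \<in> V \<Longrightarrow> cmod (l f) \<le> C * N f" using bfun_bound[OF l] by blast
  have sx: "summable (\<lambda>j. F j x)" for x
    by (rule summable_norm_cancel, rule summable_comparison_test[OF _ sm]) (auto intro: N_eval F)
  have tail_sm: "summable (\<lambda>j. N (F (j + m)))" for m using summable_ignore_initial_segment[OF sm] .
  define tl where "tl m = (\<lambda>x. \<Sum>j. F (j + m) x)" for m
  have tl: "tl m \<in> V" "N (tl m) \<le> (\<Sum>j. N (F (j + m)))" for m
    unfolding tl_def by (intro suminf_mem N_suminf F tail_sm)+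
  have eq: "(\<Sum>j<m. l (F j)) = l (\<lambda>x. \<Sum>j. F j x) - l (tl m)" for m
  proof -
    have "(\<lambda>x. \<Sum>j. F j x) = (\<lambda>x. (\<Sum>j<m. 1 * F j x) + tl m x)"
      unfolding tl_def using suminf_split_initial_segment[OF sx, of _ m] by (auto simp: add.commute)
    then have "l (\<lambda>x. \<Sum>j. F j x) = l (\<lambda>x. \<Sum>j<m. 1 * F j x) + l (tl m)"
      by (simp only:) (intro bfunD(1)[OF l] lincomb_mem F tl(1))
    also have "l (\<lambda>x. \<Sum>j<m. 1 * F j x) = (\<Sum>j<m. 1 * l (F j))"
      by (rule bfun_lincomb[OF l F])
    finally show ?thesis by simp
  qed
  have "(\<lambda>m. l (tl m)) \<longlonglongrightarrow> 0"
  proof (rule Lim_null_comparison)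
    show "\<forall>\<^sub>F m in sequentially. norm (l (tl m)) \<le> C * (\<Sum>j. N (F (j + m)))"
      by (intro always_eventually allI order_trans[OF C(2)[OF tl(1)] mult_left_mono[OF tl(2) C(1)]])
    show "(\<lambda>m. C * (\<Sum>j. N (F (j + m)))) \<longlonglongrightarrow> 0"
      by (intro tendsto_mult_right_zero suminf_exist_split2[OF sm])
  qed
  then have "(\<lambda>m. l (\<lambda>x. \<Sum>j. F j x) - l (tl m)) \<longlonglongrightarrow> l (\<lambda>x. \<Sum>j. F j x) - 0"
    by (intro tendsto_diff tendsto_const)
  then show ?thesis unfolding sums_def eq by simp
qed

section \<open>Neumann series of an operator with norm bound \<rho>\<close>

definition neumann :: "(('x \<Rightarrow> complex) \<Rightarrow> 'x \<Rightarrow> complex) \<Rightarrow> complex \<Rightarrow> ('x \<Rightarrow> complex) \<Rightarrow> 'x \<Rightarrow> complex" where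
  "neumann R w f = (\<lambda>x. \<Sum>j. (R ^^ j) f x / w ^ Suc j)"

context
  fixes R :: "('x \<Rightarrow> complex) \<Rightarrow> 'x \<Rightarrow> complex" and \<rho> :: real
  assumes R: "bop R" and R_le: "\<And>f. f \<in> V \<Longrightarrow> N (R f) \<le> \<rho> * N f" and \<rho>: "0 < \<rho>"
begin

lemma funpow_le: "f \<in> V \<Longrightarrow> N ((R ^^ j) f) \<le> \<rho> ^ j * N f"
proof (induction j)
  case (Suc j)
  have "N (R ((R ^^ j) f)) \<le> \<rho> * N ((R ^^ j) f)"
    using bopD(1)[OF bop_funpow[OF R] Suc.prems] by (rule R_le)
  also have "\<dots> \<le> \<rho> * (\<rho> ^ j * N f)" using \<rho> Suc by (intro mult_left_mono) auto
  finally show ?case by (simp add: mult.assoc)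
qed simp

lemma neumann_terms:
  assumes "f \<in> V" "\<rho> < cmod w"
  shows "(\<lambda>x. (R ^^ j) f x / w ^ Suc j) \<in> V" 
    "N (\<lambda>x. (R ^^ j) f x / w ^ Suc j) \<le> N f / cmod w * (\<rho> / cmod w) ^ j"
    "summable (\<lambda>j. N (\<lambda>x. (R ^^ j) f x / w ^ Suc j))"
    "(\<Sum>j. N (\<lambda>x. (R ^^ j) f x / w ^ Suc j)) \<le> N f / (cmod w - \<rho>)"
proof -
  have w: "w \<noteq> 0" "cmod w > 0" using assms \<rho> by auto
  have mem: "(R ^^ j) f \<in> V" for j by (rule bopD(1)[OF bop_funpow[OF R] assms(1)])
  have eq: "(\<lambda>x. (R ^^ j) f x / w ^ Suc j) = (\<lambda>x. inverse (w ^ Suc j) * (R ^^ j) f x)" for j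
    by (simp add: field_simps)
  show 1: "(\<lambda>x. (R ^^ j) f x / w ^ Suc j) \<in> V" for j unfolding eq by (rule scale_mem[OF mem])
  show 2: "N (\<lambda>x. (R ^^ j) f x / w ^ Suc j) \<le> N f / cmod w * (\<rho> / cmod w) ^ j" for j
    unfolding eq N_scale[OF mem] using funpow_le[OF assms(1), of j] w
    by (simp add: norm_inverse norm_divide norm_mult norm_power power_divide field_simps)
  have q: "norm (\<rho> / cmod w) < 1" using assms \<rho> w by simp
  have g: "(\<lambda>j. N f / cmod w * (\<rho> / cmod w) ^ j) sums (N f / cmod w * (1 / (1 - \<rho> / cmod w)))"
    by (intro sums_mult geometric_sums q)
  show 3: "summable (\<lambda>j. N (\<lambda>x. (R ^^ j) f x / w ^ Suc j))"
    by (rule summable_comparison_test[OF _ sums_summable[OF g]])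
      (use 2 N_nonneg[OF 1] in \<open>auto intro!: exI[of _ 0]\<close>)
  have "(\<Sum>j. N (\<lambda>x. (R ^^ j) f x / w ^ Suc j)) \<le> N f / cmod w * (1 / (1 - \<rho> / cmod w))"
    unfolding sums_unique[OF g] by (rule suminf_le[OF 2 3 sums_summable[OF g]])
  also have "\<dots> = N f / (cmod w - \<rho>)" using w assms by (simp add: field_simps)
  finally show "(\<Sum>j. N (\<lambda>x. (R ^^ j) f x / w ^ Suc j)) \<le> N f / (cmod w - \<rho>)" .
qed

lemma neumann_mem: 
  assumes "f \<in> V" "\<rho> < cmod w" 
  shows "neumann R w f \<in> V" "N (neumann R w f) \<le> N f / (cmod w - \<rho>)"
  using suminf_mem[OF neumann_terms(1,3)[OF assms]] N_suminf[OF neumann_terms(1,3)[OF assms]] 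
    neumann_terms(4)[OF assms] unfolding neumann_def by auto

text \<open>Multiplication by \<open>w\<close> turns the series into a power series in
  \<open>1 / w\<close>, the form from which both the resolvent equation and holomorphy are read
  off.\<close>

lemma bfun_neumann:
  assumes "bfun l" "f \<in> V" "\<rho> < cmod w"
  shows "(\<lambda>j. l ((R ^^ j) f) * (1 / w) ^ j) sums (w * l (neumann R w f))"
proof -
  have w: "w \<noteq> 0" using assms \<rho> by auto
  have mem: "(R ^^ j) f \<in> V" for j by (rule bopD(1)[OF bop_funpow[OF R] assms(2)])
  have "(\<lambda>j. l (\<lambda>x. (R ^^ j) f x / w ^ Suc j)) sums l (neumann R w f)"
    unfolding neumann_def using bfun_suminf[OF assms(1) neumann_terms(1,3)[OF assms(2,3)]] .
  moreover have "l (\<lambda>x. (R ^^ j) f x / w ^ Suc j) = inverse (w ^ Suc j) * l ((R ^^ j) f)" for j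
    using bfunD(2)[OF assms(1) mem, of "inverse (w ^ Suc j)" j] by (simp add: field_simps)
  ultimately have "(\<lambda>j. w * (inverse (w ^ Suc j) * l ((R ^^ j) f))) sums (w * l (neumann R w f))"
    by (intro sums_mult) simp
  moreover have "w * (inverse (w ^ Suc j) * l ((R ^^ j) f)) = l ((R ^^ j) f) * (1 / w) ^ j" for j
    using w by (simp add: field_simps)
  ultimately show ?thesis by (simp only:)
qed

text \<open>As power series in \<open>1 / w\<close> the two terms differ by an index shift; what
  remains is the term of index 0.\<close>

lemma neumann_right:
  assumes "f \<in> V" "\<rho> < cmod w"
  shows "w * neumann R w f x - R (neumann R w f) x = f x"
proof -
  have w: "w \<noteq> 0" using assms \<rho> by auto
  have 1: "(\<lambda>j. (R ^^ j) f x * (1 / w) ^ j) sums (w * neumann R w f x)"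
    using bfun_neumann[OF bfun_eval assms] .
  have 2: "(\<lambda>j. R ((R ^^ j) f) x * (1 / w) ^ j) sums (w * R (neumann R w f) x)"
    using bfun_neumann[OF bfun_comp[OF bfun_eval R] assms] .
  have "(\<lambda>j. 1 / w * (R ((R ^^ j) f) x * (1 / w) ^ j)) sums (1 / w * (w * R (neumann R w f) x))"
    by (intro sums_mult 2)
  then have "(\<lambda>j. (R ^^ Suc j) f x * (1 / w) ^ Suc j) sums R (neumann R w f) x"
    using w by (simp add: ac_simps)
  then have "(\<lambda>j. (R ^^ j) f x * (1 / w) ^ j) sums (R (neumann R w f) x + f x)"
    by (subst (asm) sums_Suc_iff) simp
  then show ?thesis using sums_unique2[OF 1] by simp
qed

text \<open>The difference of two solutions would be an eigenvector of \<open>R\<close> for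
  \<open>w\<close>, but \<open>cmod w\<close> exceeds the norm bound of \<open>R\<close>.\<close>

lemma neumann_unique:
  assumes "f \<in> V" "g \<in> V" "\<rho> < cmod w" and eq: "\<And>x. w * g x - R g x = f x"
  shows "g = neumann R w f"
proof -
  let ?d = "\<lambda>x. g x - neumann R w f x"
  have d: "?d \<in> V" using diff_mem[OF assms(2) neumann_mem(1)[OF assms(1,3)]] .
  have "R ?d = (\<lambda>x. w * ?d x)"
    unfolding bop_diff[OF R assms(2) neumann_mem(1)[OF assms(1,3)]]
    using neumann_right[OF assms(1,3)] eq by (auto simp: algebra_simps fun_eq_iff)
  then have "cmod w * N ?d \<le> \<rho> * N ?d" using R_le[OF d] N_scale[OF d, of w] by simp
  then have "(cmod w - \<rho>) * N ?d \<le> 0" by (simp add: algebra_simps)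
  then have "N ?d \<le> 0" using assms(3) by (auto simp: mult_le_0_iff)
  then have "?d = (\<lambda>x. 0)" by (rule N_eq_0D[OF d])
  then show ?thesis by (auto simp: fun_eq_iff)
qed

text \<open>Linearity is drawn from \<open>neumann_unique\<close>: sums and multiples of solutions
  solve the corresponding equations.\<close>

lemma bop_neumann:
  assumes w: "\<rho> < cmod w"
  shows "bop (neumann R w)"
  unfolding bop_def
proof (intro conjI ballI allI exI[of _ "1 / (cmod w - \<rho>)"])
  fix f g assume fg: "f \<in> V" "g \<in> V"
  note mem = neumann_mem(1)[OF fg(1) w] neumann_mem(1)[OF fg(2) w]
  show "neumann R w (\<lambda>x. f x + g x) = (\<lambda>x. neumann R w f x + neumann R w g x)"
  proof (rule neumann_unique[OF add_mem[OF fg] add_mem[OF mem] w, symmetric])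
    fix x
    show "w * (neumann R w f x + neumann R w g x) - R (\<lambda>x. neumann R w f x + neumann R w g x) x = f x + g x"
      unfolding bopD(2)[OF R mem]
      using neumann_right[OF fg(1) w, of x] neumann_right[OF fg(2) w, of x] by (simp add: algebra_simps)
  qed
next
  fix c f assume f: "f \<in> V"
  note mem = neumann_mem(1)[OF f w]
  show "neumann R w (\<lambda>x. c * f x) = (\<lambda>x. c * neumann R w f x)"
  proof (rule neumann_unique[OF scale_mem[OF f] scale_mem[OF mem] w, symmetric])
    fix x
    show "w * (c * neumann R w f x) - R (\<lambda>x. c * neumann R w f x) x = c * f x"
      unfolding bopD(3)[OF R mem] neumann_right[OF f w, of x, symmetric] by (simp add: algebra_simps)
  qed
qed (use neumann_mem w in auto)

text \<open>The power series in \<open>y = 1 / w\<close> converges on the disc of radius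
  \<open>1 / \<rho>\<close>, and inversion carries the region \<open>\<rho> < cmod w\<close> into
  that disc.\<close>

lemma neumann_holomorphic:
  assumes "bfun l" "f \<in> V"
  shows "(\<lambda>w. l (neumann R w f)) holomorphic_on {w. \<rho> < cmod w}"
proof -
  define F where "F = (\<lambda>y. \<Sum>j. l ((R ^^ j) f) * (y - 0) ^ j)"
  have sums: "(\<lambda>j. l ((R ^^ j) f) * (y - 0) ^ j) sums F y" if "y \<in> ball 0 (1 / \<rho>)" for y
  \<comment> \<open>The point 0 is not a value of \<open>1 / w\<close>, so convergence there is
    noted separately.\<close>
  proof (cases "y = 0")
    case True
    then show ?thesis unfolding F_def
      by (intro summable_sums summable_finite[of "{0}"]) auto
  next
    case False
    then have "\<rho> < cmod (1 / y)" using that \<rho> by (simp add: norm_divide field_simps)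
    then have "summable (\<lambda>j. l ((R ^^ j) f) * y ^ j)"
      using bfun_neumann[OF assms, of "1 / y"] sums_summable by fastforce
    then show ?thesis unfolding F_def by (intro summable_sums) simp
  qed
  have "F holomorphic_on ball 0 (1 / \<rho>)" using sums by (rule power_series_holomorphic)
  then have "F \<circ> (\<lambda>w. 1 / w) holomorphic_on {w. \<rho> < cmod w}"
    using \<rho> by (intro holomorphic_on_compose holomorphic_intros)
      (auto elim!: holomorphic_on_subset simp: norm_divide divide_simps)
  then have "(\<lambda>w. F (1 / w) / w) holomorphic_on {w. \<rho> < cmod w}"
    using \<rho> by (intro holomorphic_intros) (auto simp: o_def)
  moreover have "l (neumann R w f) = F (1 / w) / w" if "w \<in> {w. \<rho> < cmod w}" for w
    using that \<rho> sums_unique[OF bfun_neumann[OF assms, of w]]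
    by (auto simp: F_def simp flip: sums_unique[OF bfun_neumann[OF assms, of w]])
  ultimately show ?thesis by (rule holomorphic_transform[OF _ sym])
qed

end

end

section \<open>Spanning families, integrals around poles, convergent subsequences\<close>

lemma finite_dimensionalI:
  assumes "finite I" "\<And>f. f \<in> W \<Longrightarrow> \<exists>c. f = (\<lambda>x. \<Sum>i\<in>I. c i * b i x)"
  shows "finite_dimensional W"
  unfolding finite_dimensional_def
proof (intro exI[of _ "b ` I"] conjI ballI)
  show "finite (b ` I)" using assms(1) by simp
  fix f assume "f \<in> W"
  then obtain c where c: "f = (\<lambda>x. \<Sum>i\<in>I. c i * b i x)" using assms(2) by blast
  \<comment> \<open>The family \<open>b\<close> may repeat a function; the coefficients of equal
    members are added.\<close>
  have "f = (\<lambda>x. \<Sum>g\<in>b ` I. (\<Sum>i\<in>{i\<in>I. b i = g}. c i) * g x)"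
    unfolding c by (rule ext, subst sum.image_gen[OF assms(1), of _ b])
      (auto simp: sum_distrib_right intro!: sum.cong)
  then show "\<exists>c. f = (\<lambda>x. \<Sum>g\<in>b ` I. c g * g x)"
    by (rule exI[of _ "\<lambda>g. \<Sum>i | i \<in> I \<and> b i = g. c i"])
qed

text \<open>Each step splits off the value at \<open>z\<close>: the quotient
  \<open>(g w - g z) / (w - z)\<close> extends holomorphically over \<open>z\<close>.\<close>

lemma holomorphic_taylor_remainder:
  assumes "h holomorphic_on ball z r" 
  shows "\<exists>c g. g holomorphic_on ball z r \<and>
    (\<forall>w\<in>ball z r. h w = (\<Sum>l<m. c l * (w - z) ^ l) + (w - z) ^ m * g w)"
proof (induction m)
  case 0
  then show ?case using assms by (intro exI[of _ "\<lambda>_. 0"] exI[of _ h]) auto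
next
  case (Suc m)
  then obtain c g where g: "g holomorphic_on ball z r"
    and eq: "\<And>w. w \<in> ball z r \<Longrightarrow> h w = (\<Sum>l<m. c l * (w - z) ^ l) + (w - z) ^ m * g w" by blast
  define g' where "g' w = (if w = z then deriv g z else (g w - g z) / (w - z))" for w
  have g': "g' holomorphic_on ball z r"
    unfolding g'_def by (rule pole_lemma_open[OF g]) auto
  have geq: "g w = g z + (w - z) * g' w" for w by (simp add: g'_def)
  have "h w = (\<Sum>l<Suc m. (c(m := g z)) l * (w - z) ^ l) + (w - z) ^ Suc m * g' w"
    if "w \<in> ball z r" for w
  proof -
    have "h w = (\<Sum>l<m. c l * (w - z) ^ l) + (w - z) ^ m * (g z + (w - z) * g' w)"
      using eq[OF that] geq[of w] by simp
    then show ?thesis by (simp add: algebra_simps)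
  qed
  then show ?case using g' by blast
qed

text \<open>The order of the quantifiers is the point: with \<open>z\<close>, \<open>m\<close> and
  \<open>q\<close> fixed, \<open>c\<close> depends on \<open>h\<close> alone and the integrals on
  \<open>a\<close> alone. The numbers \<open>c l\<close> are Taylor coefficients of
  \<open>h\<close>; the remainder of order \<open>m\<close> cancels the pole and integrates to 0 by
  Cauchy's theorem.\<close>

lemma circle_integral_pole_span:
  assumes s: "0 < s" "s < r" and q: "q holomorphic_on ball z r" "\<And>w. w \<in> ball z r \<Longrightarrow> q w \<noteq> 0"
    and h: "h holomorphic_on ball z r"
  shows "\<exists>c. \<forall>a. a holomorphic_on ball z r \<longrightarrow>
    ((\<lambda>w. a w * h w / ((w - z) ^ m * q w)) has_contour_integral
      (\<Sum>l<m. c l * contour_integral (circlepath z s) (\<lambda>w. a w * (w - z) ^ l / ((w - z) ^ m * q w))))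
      (circlepath z s)"
proof -
  obtain c g where g: "g holomorphic_on ball z r"
    and eq: "\<And>w. w \<in> ball z r \<Longrightarrow> h w = (\<Sum>l<m. c l * (w - z) ^ l) + (w - z) ^ m * g w"
    using holomorphic_taylor_remainder[OF h] by blast
  have sph: "sphere z s \<subseteq> ball z r - {z}" using s by auto
  show ?thesis
  proof (intro exI[of _ c] allI impI)
    fix a assume a: "a holomorphic_on ball z r"
    have "(\<lambda>w. a w * (w - z) ^ l / ((w - z) ^ m * q w)) holomorphic_on ball z r - {z}" for l
      by (intro holomorphic_intros holomorphic_on_subset[OF a] holomorphic_on_subset[OF q(1)]) (auto simp: q(2))
    then have "continuous_on (sphere z s) (\<lambda>w. a w * (w - z) ^ l / ((w - z) ^ m * q w))" for l
      using holomorphic_on_imp_continuous_on continuous_on_subset[OF _ sph] by blast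
    then have int: "((\<lambda>w. a w * (w - z) ^ l / ((w - z) ^ m * q w)) has_contour_integral
        contour_integral (circlepath z s) (\<lambda>w. a w * (w - z) ^ l / ((w - z) ^ m * q w))) (circlepath z s)" for l
      using s by (intro has_contour_integral_integral contour_integrable_continuous_circlepath)
        (auto simp: path_image_circlepath)
    have "((\<lambda>w. a w * g w / q w) has_contour_integral 0) (circlepath z s)"
    proof (rule Cauchy_theorem_disc_simple)
      show "(\<lambda>w. a w * g w / q w) holomorphic_on ball z r"
        by (intro holomorphic_intros a g q)
    qed (use s in auto)
    then have "((\<lambda>w. (\<Sum>l<m. c l * (a w * (w - z) ^ l / ((w - z) ^ m * q w))) + a w * g w / q w)
        has_contour_integral
        (\<Sum>l<m. c l * contour_integral (circlepath z s) (\<lambda>w. a w * (w - z) ^ l / ((w - z) ^ m * q w))) + 0)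
        (circlepath z s)"
      by (intro has_contour_integral_add has_contour_integral_sum has_contour_integral_lmul int) auto
    moreover have "(\<Sum>l<m. c l * (a w * (w - z) ^ l / ((w - z) ^ m * q w))) + a w * g w / q w
        = a w * h w / ((w - z) ^ m * q w)" if "w \<in> path_image (circlepath z s)" for w
    proof -
      have w: "w \<in> ball z r" "w \<noteq> z" "q w \<noteq> 0" using that s sph q(2) by (auto simp: path_image_circlepath)
      have "a w * h w / ((w - z) ^ m * q w)
          = (\<Sum>l<m. c l * (w - z) ^ l) * (a w / ((w - z) ^ m * q w)) + a w * g w / q w"
        using w by (simp add: eq[OF w(1)] field_simps)
      also have "(\<Sum>l<m. c l * (w - z) ^ l) * (a w / ((w - z) ^ m * q w))
          = (\<Sum>l<m. c l * (a w * (w - z) ^ l / ((w - z) ^ m * q w)))"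
        by (simp add: sum_distrib_left sum_distrib_right sum_divide_distrib ac_simps)
      finally show ?thesis by simp
    qed
    ultimately show "((\<lambda>w. a w * h w / ((w - z) ^ m * q w)) has_contour_integral
      (\<Sum>l<m. c l * contour_integral (circlepath z s) (\<lambda>w. a w * (w - z) ^ l / ((w - z) ^ m * q w))))
      (circlepath z s)"
      by (subst (asm) add_0_right) (rule has_contour_integral_eq)
  qed
qed

text \<open>Bolzano-Weierstrass in dimension \<open>m\<close>, by extracting from one coordinate
  after another.\<close>

lemma bounded_family_convergent_subsequence:
  fixes X :: "nat \<Rightarrow> nat \<Rightarrow> complex"
  assumes "\<And>i. i < m \<Longrightarrow> bounded (range (X i))"
  shows "\<exists>r c. strict_mono (r :: nat \<Rightarrow> nat) \<and> (\<forall>i<m. (\<lambda>j. X i (r j)) \<longlonglongrightarrow> c i)"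
  using assms
proof (induction m)
  case 0
  show ?case by (intro exI[of _ id]) (auto simp: strict_mono_def)
next
  case (Suc m)
  then obtain r c where r: "strict_mono (r :: nat \<Rightarrow> nat)" "\<And>i. i < m \<Longrightarrow> (\<lambda>j. X i (r j)) \<longlonglongrightarrow> c i"
    by fastforce
  have "bounded (range (\<lambda>j. X m (r j)))"
    using Suc.prems[of m] by (rule bounded_subset) auto
  then obtain l r' where r': "strict_mono (r' :: nat \<Rightarrow> nat)" "((\<lambda>j. X m (r j)) \<circ> r') \<longlonglongrightarrow> l"
    using bounded_imp_convergent_subsequence by blast
  have "(\<lambda>j. X i ((r \<circ> r') j)) \<longlonglongrightarrow> (c(m := l)) i" if "i < Suc m" for i
  proof (cases "i = m")
    case True then show ?thesis using r'(2) by (simp add: o_def)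
  next
    case False
    then show ?thesis using that LIMSEQ_subseq_LIMSEQ[OF r(2) r'(1), of i] by (simp add: o_def)
  qed
  then show ?case using strict_mono_o[OF r(1) r'(1)] by blast
qed

section \<open>Powers of an operator, resolvent and spectrum\<close>

context fun_space
begin

lemma bop_lincomb:
  assumes "bop T" "\<And>i. i \<in> I \<Longrightarrow> u i \<in> V"
  shows "T (\<lambda>x. \<Sum>i\<in>I. c i * u i x) = (\<lambda>x. \<Sum>i\<in>I. c i * T (u i) x)"
  by (rule ext) (rule bfun_lincomb[OF bfun_comp[OF bfun_eval assms(1)] assms(2)])

lemma pencil_bop: "bop T \<Longrightarrow> bop (pencil T z)"
  unfolding pencil_def using bop_add[OF bop_scale[OF bop_id, of z] bop_scale[of T "-1"]] by simp

text \<open>The quotient of \<open>\<zeta> ^ n - T ^ n\<close> by \<open>\<zeta> - T\<close>; it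
  transfers eigenvectors and resolvents from \<open>T ^^ n\<close> to \<open>T\<close>.\<close>

definition geom :: "(('x \<Rightarrow> complex) \<Rightarrow> 'x \<Rightarrow> complex) \<Rightarrow> nat \<Rightarrow> complex \<Rightarrow> ('x \<Rightarrow> complex) \<Rightarrow> 'x \<Rightarrow> complex" where
  "geom T n \<zeta> f = (\<lambda>x. \<Sum>i<n. \<zeta> ^ (n - Suc i) * (T ^^ i) f x)"

lemma geom_bop: "bop T \<Longrightarrow> bop (geom T n \<zeta>)"
  unfolding geom_def by (intro bop_sum bop_scale bop_funpow)

text \<open>The sum telescopes. The first order of the factors serves for eigenvectors and
  surjectivity, the second for injectivity.\<close>

lemma pencil_geom:
  assumes T: "bop T" and f: "f \<in> V"
  shows "pencil T \<zeta> (geom T n \<zeta> f) = pencil (T ^^ n) (\<zeta> ^ n) f" 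
    "geom T n \<zeta> (pencil T \<zeta> f) = pencil (T ^^ n) (\<zeta> ^ n) f"
proof -
  have pow: "\<zeta> ^ (n - i) = \<zeta> * \<zeta> ^ (n - Suc i)" if "i < n" for i
    using that by (metis Suc_diff_Suc power_Suc)
  have telescope: "(\<Sum>i<n. \<zeta> ^ (n - i) * b i - \<zeta> ^ (n - Suc i) * b (Suc i)) = \<zeta> ^ n * b 0 - b n"
    for b :: "nat \<Rightarrow> complex"
    using sum_lessThan_telescope'[of "\<lambda>i. \<zeta> ^ (n - i) * b i" n] by simp
  have mem: "(T ^^ i) f \<in> V" for i by (rule bopD(1)[OF bop_funpow[OF T] f])
  have TP: "T (geom T n \<zeta> f) = (\<lambda>x. \<Sum>i<n. \<zeta> ^ (n - Suc i) * (T ^^ Suc i) f x)"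
    unfolding geom_def using bop_lincomb[OF T, of "{..<n}" "\<lambda>i. (T ^^ i) f"] mem by simp
  show 1: "pencil T \<zeta> (geom T n \<zeta> f) = pencil (T ^^ n) (\<zeta> ^ n) f"
  proof
    fix x
    have "pencil T \<zeta> (geom T n \<zeta> f) x = (\<Sum>i<n. \<zeta> ^ (n - i) * (T ^^ i) f x - \<zeta> ^ (n - Suc i) * (T ^^ Suc i) f x)"
      unfolding pencil_def TP unfolding geom_def sum_distrib_left sum_subtractf[symmetric]
      by (intro sum.cong refl) (simp add: pow)
    then show "pencil T \<zeta> (geom T n \<zeta> f) x = pencil (T ^^ n) (\<zeta> ^ n) f x"
      using telescope[of "\<lambda>i. (T ^^ i) f x"] by (simp add: pencil_def)
  qed
  have tp: "(T ^^ i) (pencil T \<zeta> f) x = \<zeta> * (T ^^ i) f x - (T ^^ Suc i) f x" for i x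
    unfolding pencil_def bop_diff[OF bop_funpow[OF T] scale_mem[OF f] bopD(1)[OF T f]]
      bopD(3)[OF bop_funpow[OF T] f] by (simp add: funpow_swap1)
  then have "geom T n \<zeta> (pencil T \<zeta> f) = pencil T \<zeta> (geom T n \<zeta> f)"
    unfolding pencil_def[of T \<zeta> "geom T n \<zeta> f"] TP unfolding geom_def tp
    by (simp add: sum_subtractf sum_distrib_left algebra_simps)
  then show "geom T n \<zeta> (pencil T \<zeta> f) = pencil (T ^^ n) (\<zeta> ^ n) f" using 1 by simp
qed

lemma spectrumI_kernel:
  assumes "f \<in> V" "f \<noteq> (\<lambda>x. 0)" "bop T" "pencil T z f = (\<lambda>x. 0)"
  shows "z \<in> spectrum V N T"
proof -
  have "pencil T z (\<lambda>x. 0) = (\<lambda>x. 0)" by (rule bop_zero[OF pencil_bop[OF assms(3)]])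
  then have "\<not> inj_on (pencil T z) V" using assms zero_mem by (metis inj_onD)
  then show ?thesis by (simp add: spectrum_def bij_betw_def)
qed

text \<open>If \<open>T ^ n f = z ^ n f\<close>, then \<open>f\<close> is the average of the eigenvectors \<open>\<Sum>i<n. \<zeta> ^ (n - i) T ^ i f\<close>
  where \<open>\<zeta>\<close> ranges over the numbers with \<open>\<zeta> ^ n = z ^ n\<close>.\<close>

lemma spectrum_root:
  assumes T: "bop T" and f: "f \<in> V" "f \<noteq> (\<lambda>x. 0)" and n: "0 < n" and z: "z \<noteq> 0"
    and eig: "(T ^^ n) f = (\<lambda>x. z ^ n * f x)"
  shows "\<exists>\<zeta>\<in>spectrum V N T. cmod \<zeta> = cmod z"
proof -
  define w where "w j = exp (2 * of_real pi * \<i> * of_nat j / of_nat n)" for j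
  have wn: "w j ^ n = 1" for j unfolding w_def using n by (intro complex_root_unity) simp
  have wm: "w j ^ m = w m ^ j" for j m unfolding w_def by (simp add: exp_of_nat_mult[symmetric] ac_simps)
  have w1: "w m \<noteq> 1" if "0 < m" "m < n" for m
    using complex_root_unity_eq[of n m 0] that unfolding w_def by simp
  have cw: "cmod (w j) = 1" for j unfolding w_def by (simp add: norm_exp_eq_Re)
  define Z where "Z j = z * w j" for j
  \<comment> \<open>The additional factor \<open>Z j\<close> raises the exponent to
    \<open>n - i\<close>, so that summing over the roots of unity kills every \<open>i\<close>
    except 0.\<close>
  have sumZ: "(\<Sum>j<n. Z j * Z j ^ (n - Suc i)) = (if i = 0 then of_nat n * z ^ n else 0)" if i: "i < n" for i
  proof -
    have e: "Z j * Z j ^ (n - Suc i) = z ^ (n - i) * w (n - i) ^ j" for j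
    proof -
      have "Z j * Z j ^ (n - Suc i) = Z j ^ (n - i)" using i by (metis Suc_diff_Suc power_Suc)
      then show ?thesis by (simp add: Z_def power_mult_distrib wm)
    qed
    show ?thesis
    proof (cases "i = 0")
      case True
      have "w n = 1" using wm[of 1 n] wn[of 1] by simp
      then show ?thesis unfolding e using True by simp
    next
      case False
      have "w (n - i) \<noteq> 1" using False i by (intro w1) auto
      then have "(\<Sum>j<n. w (n - i) ^ j) = 0" using wn by (simp add: geometric_sum)
      then show ?thesis unfolding e sum_distrib_left[symmetric] using False by simp
    qed
  qed
  have "\<exists>j<n. geom T n (Z j) f \<noteq> (\<lambda>x. 0)"
  proof (rule ccontr)
    assume "\<not> ?thesis"
    then have 0: "(\<Sum>i<n. Z j ^ (n - Suc i) * (T ^^ i) f x) = 0" if "j < n" for j x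
      using that unfolding geom_def by meson
    have "of_nat n * z ^ n * f x = 0" for x
    proof -
      have "0 = (\<Sum>j<n. Z j * (\<Sum>i<n. Z j ^ (n - Suc i) * (T ^^ i) f x))" using 0 by simp
      also have "\<dots> = (\<Sum>i<n. (\<Sum>j<n. Z j * Z j ^ (n - Suc i)) * (T ^^ i) f x)"
        unfolding sum_distrib_left sum_distrib_right by (subst sum.swap) (simp add: mult.assoc)
      also have "\<dots> = (\<Sum>i<n. if i = 0 then of_nat n * z ^ n * f x else 0)"
        by (intro sum.cong refl) (simp add: sumZ)
      also have "\<dots> = of_nat n * z ^ n * f x" using n by simp
      finally show ?thesis by simp
    qed
    then have "f = (\<lambda>x. 0)" using n z by (simp add: fun_eq_iff)
    then show False using f(2) by simp
  qed
  then obtain j where j: "geom T n (Z j) f \<noteq> (\<lambda>x. 0)" by blast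
  have "pencil (T ^^ n) (Z j ^ n) f = (\<lambda>x. 0)"
    unfolding pencil_def eig by (simp add: Z_def power_mult_distrib wn)
  then have "pencil T (Z j) (geom T n (Z j) f) = (\<lambda>x. 0)"
    unfolding pencil_geom(1)[OF T f(1)] .
  then have "Z j \<in> spectrum V N T"
    using spectrumI_kernel[OF bopD(1)[OF geom_bop[OF T] f(1)] j T] by blast
  moreover have "cmod (Z j) = cmod z" by (simp add: Z_def norm_mult cw)
  ultimately show ?thesis by blast
qed

text \<open>A right inverse of an injective map is its inverse, so the boundedness of
  \<open>S\<close> is that of the resolvent.\<close>

lemma not_in_spectrumI:
  assumes S: "bop S" and T: "bop T" and right: "\<forall>f\<in>V. pencil T z (S f) = f" 
    and inj: "\<forall>f\<in>V. pencil T z f = (\<lambda>x. 0) \<longrightarrow> f = (\<lambda>x. 0)"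
  shows "z \<notin> spectrum V N T" "f \<in> V \<Longrightarrow> resolvent V T z f = S f"
proof -
  have P: "bop (pencil T z)" by (rule pencil_bop[OF T])
  have inj': "inj_on (pencil T z) V"
  proof (rule inj_onI)
    fix f g assume fg: "f \<in> V" "g \<in> V" "pencil T z f = pencil T z g"
    then have "pencil T z (\<lambda>x. f x - g x) = (\<lambda>x. 0)" by (simp add: bop_diff[OF P])
    then have "(\<lambda>x. f x - g x) = (\<lambda>x. 0)" using inj diff_mem[OF fg(1,2)] by blast
    then show "f = g" by (auto simp: fun_eq_iff)
  qed
  have "pencil T z ` V = V"
  proof
    show "pencil T z ` V \<subseteq> V" using bopD(1)[OF P] by auto
    show "V \<subseteq> pencil T z ` V"
    proof
      fix f assume "f \<in> V"
      then show "f \<in> pencil T z ` V"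
        using imageI[OF bopD(1)[OF S, of f], of "pencil T z"] right by simp
    qed
  qed
  then have bij: "bij_betw (pencil T z) V V" using inj' by (simp add: bij_betw_def)
  show res: "resolvent V T z f = S f" if "f \<in> V" for f
    unfolding resolvent_def by (rule inv_into_f_eq[OF inj']) (use bopD(1)[OF S] right that in auto)
  obtain C where "\<forall>f\<in>V. N (S f) \<le> C * N f" using S unfolding bop_def by (elim conjE exE)
  then have "\<forall>f\<in>V. N (resolvent V T z f) \<le> C * N f" using res by simp
  then show "z \<notin> spectrum V N T" using bij unfolding spectrum_def by auto
qed

lemma
  assumes "z \<notin> spectrum V N T" "f \<in> V"
  shows resolvent_mem: "resolvent V T z f \<in> V"
    and pencil_resolvent: "pencil T z (resolvent V T z f) = f"
    and resolvent_pencil: "resolvent V T z (pencil T z f) = f"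
  using assms unfolding resolvent_def spectrum_def
  by (auto simp: bij_betw_def inv_into_into f_inv_into_f inv_into_f_f)

lemma resolvent_bound:
  assumes "z \<notin> spectrum V N T" 
  shows "\<exists>C\<ge>0. \<forall>f\<in>V. N (resolvent V T z f) \<le> C * N f"
proof -
  have "\<exists>C. \<forall>f\<in>V. N (resolvent V T z f) \<le> C * N f"
    using assms by (simp add: spectrum_def)
  then obtain C where C: "\<forall>f\<in>V. N (resolvent V T z f) \<le> C * N f" ..
  have "N (resolvent V T z f) \<le> max C 0 * N f" if "f \<in> V" for f
    using bspec[OF C that] mult_right_mono[of C "max C 0" "N f"] N_nonneg[OF that] by linarith
  then show ?thesis by (intro exI[of _ "max C 0"]) auto
qed

lemma resolvent_bop:
  assumes "bop T" "z \<notin> spectrum V N T"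
  shows "bop (resolvent V T z)"
proof -
  obtain C where C: "0 \<le> C" "\<forall>f\<in>V. N (resolvent V T z f) \<le> C * N f"
    using resolvent_bound[OF assms(2)] by (elim exE conjE)
  note res = resolvent_mem[OF assms(2)] pencil_resolvent[OF assms(2)] resolvent_pencil[OF assms(2)]
  have P: "bop (pencil T z)" by (rule pencil_bop[OF assms(1)])
  show ?thesis
    unfolding bop_def
  proof (intro conjI ballI allI exI[of _ C])
    fix f g assume fg: "f \<in> V" "g \<in> V"
    have "pencil T z (\<lambda>x. resolvent V T z f x + resolvent V T z g x) = (\<lambda>x. f x + g x)"
      using fg res(1,2) by (simp add: bopD(2)[OF P])
    then show "resolvent V T z (\<lambda>x. f x + g x) = (\<lambda>x. resolvent V T z f x + resolvent V T z g x)"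
      using res(3)[OF add_mem[OF res(1)[OF fg(1)] res(1)[OF fg(2)]]] by simp
  next
    fix c f assume f: "f \<in> V"
    have "pencil T z (\<lambda>x. c * resolvent V T z f x) = (\<lambda>x. c * f x)"
      using f res(1,2) by (simp add: bopD(3)[OF P])
    then show "resolvent V T z (\<lambda>x. c * f x) = (\<lambda>x. c * resolvent V T z f x)"
      using res(3)[OF scale_mem[OF res(1)[OF f]], of c] by simp
  qed (use C(2) res(1) in auto)
qed

text \<open>With \<open>Q\<close> the resolvent at \<open>z\<close>, the pencil at \<zeta> is the
  pencil at \<open>z\<close> followed by \<open>1 - (z - \<zeta>) Q\<close>. The latter is inverted
  by a Neumann series at \<open>w = 1\<close>.\<close>

lemma not_in_spectrum_near:
  assumes T: "bop T" and z: "z \<notin> spectrum V N T" and "0 < C" "dist \<zeta> z * C < 1"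
    and C: "\<And>f. f \<in> V \<Longrightarrow> N (resolvent V T z f) \<le> C * N f"
  shows "\<zeta> \<notin> spectrum V N T"
proof -
  define Q where "Q = resolvent V T z"
  have Q: "bop Q" unfolding Q_def by (rule resolvent_bop[OF T z])
  have PQ: "pencil T z (Q f) = f" "Q (pencil T z f) = f" if "f \<in> V" for f
    unfolding Q_def using that pencil_resolvent[OF z] resolvent_pencil[OF z] by auto
  define R where "R = (\<lambda>f x. (z - \<zeta>) * Q f x)"
  have R: "bop R" unfolding R_def by (rule bop_scale[OF Q])
  \<comment> \<open>A norm bound below 1 that is positive even if \<open>\<zeta> = z\<close>, as the
    Neumann series requires.\<close>
  define q where "q = (dist \<zeta> z * C + 1) / 2"
  have half: "0 < (t + 1) / 2" "(t + 1) / 2 < 1" "t \<le> (t + 1) / 2" if "0 \<le> t" "t < 1" for t :: real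
    using that by auto
  have "0 \<le> dist \<zeta> z * C" using assms(3) by simp
  then have q: "0 < q" "q < 1" "dist \<zeta> z * C \<le> q" 
    unfolding q_def using assms(4) by (rule half)+
  have Rle: "N (R f) \<le> q * N f" if "f \<in> V" for f
  proof -
    have "N (R f) = dist \<zeta> z * N (Q f)"
      unfolding R_def by (simp add: N_scale[OF bopD(1)[OF Q that]] dist_norm norm_minus_commute)
    also have "\<dots> \<le> dist \<zeta> z * (C * N f)" unfolding Q_def by (intro mult_left_mono C that) auto
    also have "\<dots> \<le> q * N f" using mult_right_mono[OF q(3) N_nonneg[OF that]] by (simp add: mult.assoc)
    finally show ?thesis .
  qed
  note nm = neumann_mem[OF R Rle q(1), of _ 1] and nr = neumann_right[OF R Rle q(1), of _ 1]
    and nu = neumann_unique[OF R Rle q(1), of _ _ 1]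
  have q1: "q < cmod 1" using q by simp
  have pz: "pencil T \<zeta> g = (\<lambda>x. pencil T z g x - (z - \<zeta>) * g x)" for g
    by (auto simp: pencil_def algebra_simps)
  have "bop (neumann R 1)" using bop_neumann[OF R Rle q(1), of 1] q1 by blast
  from bop_comp[OF Q this] show ?thesis
  proof (rule not_in_spectrumI(1)[OF _ T]; intro ballI impI)
    fix f assume f: "f \<in> V"
    show "pencil T \<zeta> (Q (neumann R 1 f)) = f"
    proof
      fix x
      have n: "neumann R 1 f \<in> V" using nm(1)[OF _ f q1] .
      have "pencil T \<zeta> (Q (neumann R 1 f)) x = 1 * neumann R 1 f x - R (neumann R 1 f) x"
        unfolding pz PQ(1)[OF n] by (simp add: R_def)
      then show "pencil T \<zeta> (Q (neumann R 1 f)) x = f x" using nr[OF _ f q1] by simp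
    qed
  next
    fix f assume f: "f \<in> V" "pencil T \<zeta> f = (\<lambda>x. 0)"
    define g where "g = pencil T z f"
    have g: "g \<in> V" unfolding g_def by (rule bopD(1)[OF pencil_bop[OF T] f(1)])
    have eq: "1 * g x - R g x = 0" for x
      using f(2) PQ(2)[OF f(1)] unfolding R_def g_def pz by (auto simp: fun_eq_iff)
    have "g = neumann R 1 (\<lambda>x. 0)" by (rule nu[OF _ zero_mem g q1 eq])
    then have "g = (\<lambda>x. 0)"
      using nu[OF _ zero_mem zero_mem q1] bop_zero[OF R] by simp
    then show "f = (\<lambda>x. 0)" using PQ(2)[OF f(1)] bop_zero[OF Q] unfolding g_def by simp
  qed
qed

lemma closed_spectrum:
  assumes T: "bop T"
  shows "closed (spectrum V N T)"
proof -
  have "\<exists>e>0. ball z e \<subseteq> - spectrum V N T" if z: "z \<notin> spectrum V N T" for z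
  proof -
    obtain C where C: "0 \<le> C" "\<forall>f\<in>V. N (resolvent V T z f) \<le> C * N f"
      using resolvent_bound[OF z] by (elim exE conjE)
    have C1: "N (resolvent V T z f) \<le> (C + 1) * N f" if "f \<in> V" for f
      using bspec[OF C(2) that] N_nonneg[OF that] by (simp add: algebra_simps)
    have "\<zeta> \<notin> spectrum V N T" if "\<zeta> \<in> ball z (1 / (C + 1))" for \<zeta>
      by (rule not_in_spectrum_near[OF T z _ _ C1]) (use that C(1) in \<open>auto simp: field_simps dist_commute\<close>)
    then show ?thesis using C(1) by (intro exI[of _ "1 / (C + 1)"]) auto
  qed
  then have "open (- spectrum V N T)" unfolding open_contains_ball by auto
  then show ?thesis by (simp add: closed_def)
qed

end

section \<open>Quasi-compact operators\<close>

text \<open>The remainder is measured by the power \<open>\<rho> ^ n\<close>, so that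
  \<open>cmod \<zeta> > \<rho>\<close> puts \<open>\<zeta> ^ n\<close> beyond the norm bound of the
  remainder.\<close>

locale quasi_compact_op = fun_space V N
  for V :: "('x \<Rightarrow> complex) set" and N :: "('x \<Rightarrow> complex) \<Rightarrow> real" +
  fixes T :: "('x \<Rightarrow> complex) \<Rightarrow> 'x \<Rightarrow> complex" and n m :: nat and \<rho> :: real
    and l :: "nat \<Rightarrow> ('x \<Rightarrow> complex) \<Rightarrow> complex" and u :: "nat \<Rightarrow> 'x \<Rightarrow> complex"
  assumes T: "bop T" and n: "0 < n" and \<rho>: "0 < \<rho>"
    and l: "\<And>i. i < m \<Longrightarrow> bfun (l i)" and u: "\<And>i. i < m \<Longrightarrow> u i \<in> V"
    and remainder: "\<And>f. f \<in> V \<Longrightarrow> N (\<lambda>x. (T ^^ n) f x - (\<Sum>i<m. l i f * u i x)) \<le> \<rho> ^ n * N f"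
begin

definition R :: "('x \<Rightarrow> complex) \<Rightarrow> 'x \<Rightarrow> complex" where
  "R f = (\<lambda>x. (T ^^ n) f x - (\<Sum>i<m. l i f * u i x))"

definition B :: "complex \<Rightarrow> ('x \<Rightarrow> complex) \<Rightarrow> 'x \<Rightarrow> complex" where
  "B \<zeta> = neumann R (\<zeta> ^ n)"

definition P :: "complex \<Rightarrow> ('x \<Rightarrow> complex) \<Rightarrow> 'x \<Rightarrow> complex" where
  "P = geom T n"

text \<open>A solution \<open>h\<close> of \<open>\<zeta> ^ n h - T ^ n h = f\<close> is determined
  by the finitely many numbers \<open>l i h\<close>. Applying \<open>l i\<close> to the equation
  solved for \<open>h\<close> gives a linear system for them; this is its matrix.\<close>

definition a :: "nat \<Rightarrow> nat \<Rightarrow> complex \<Rightarrow> complex" where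
  "a i j \<zeta> = (if i = j then 1 else 0) - l i (B \<zeta> (u j))"

abbreviation \<Omega> :: "complex set" where "\<Omega> \<equiv> {\<zeta>. \<rho> < cmod \<zeta>}"

lemma R: "bop R"
proof -
  have "bop (\<lambda>f x. \<Sum>i<m. l i f * u i x)" by (intro bop_sum bop_rank_one l u) auto
  from bop_add[OF bop_funpow[OF T, of n] bop_scale[OF this, of "-1"]]
  show ?thesis unfolding R_def by simp
qed

lemma R_le: "f \<in> V \<Longrightarrow> N (R f) \<le> \<rho> ^ n * N f"
  unfolding R_def by (rule remainder)

lemma \<rho>n: "0 < \<rho> ^ n" using \<rho> by simp

lemma \<Omega>D: "\<zeta> \<in> \<Omega> \<Longrightarrow> \<rho> ^ n < cmod (\<zeta> ^ n)"
  using n \<rho> by (auto simp: norm_power intro!: power_strict_mono)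

lemma
  assumes "f \<in> V" "\<zeta> \<in> \<Omega>"
  shows B_mem: "B \<zeta> f \<in> V" and N_B: "N (B \<zeta> f) \<le> N f / (cmod (\<zeta> ^ n) - \<rho> ^ n)"
    and B_right: "\<zeta> ^ n * B \<zeta> f x - R (B \<zeta> f) x = f x"
  unfolding B_def using neumann_mem[OF R R_le \<rho>n assms(1) \<Omega>D[OF assms(2)]] 
    neumann_right[OF R R_le \<rho>n assms(1) \<Omega>D[OF assms(2)]] by auto

lemma B_unique:
  assumes "f \<in> V" "g \<in> V" "\<zeta> \<in> \<Omega>" "\<And>x. \<zeta> ^ n * g x - R g x = f x"
  shows "g = B \<zeta> f"
  unfolding B_def by (rule neumann_unique[OF R R_le \<rho>n assms(1,2) \<Omega>D[OF assms(3)] assms(4)])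

lemma B_holomorphic:
  assumes "bfun \<mu>" "f \<in> V" 
  shows "(\<lambda>\<zeta>. \<mu> (B \<zeta> f)) holomorphic_on \<Omega>"
proof -
  have "(\<lambda>w. \<mu> (neumann R w f)) \<circ> (\<lambda>\<zeta>. \<zeta> ^ n) holomorphic_on \<Omega>"
    by (rule holomorphic_on_compose_gen[OF _ neumann_holomorphic[OF R R_le \<rho>n assms]])
      (use \<Omega>D in \<open>auto intro!: holomorphic_intros\<close>)
  then show ?thesis by (simp add: o_def B_def)
qed

lemma a_holomorphic: "i < m \<Longrightarrow> j < m \<Longrightarrow> a i j holomorphic_on \<Omega>"
  unfolding a_def by (intro holomorphic_intros B_holomorphic l u)

lemma Tn: "(T ^^ n) f x = R f x + (\<Sum>i<m. l i f * u i x)"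
  by (simp add: R_def)

lemma P: "bop (P \<zeta>)"
  unfolding P_def by (rule geom_bop[OF T])

lemmas pencil_P = pencil_geom[OF T, where n = n, folded P_def]

text \<open>The finite rank part is moved to the right hand side and \<open>\<zeta> ^ n - R\<close>
  is inverted. That both sides agree is again a case of uniqueness for \<open>B\<close>.\<close>

lemma fixed_eq:
  assumes "h \<in> V" "\<zeta> \<in> \<Omega>" "pencil (T ^^ n) (\<zeta> ^ n) h = f" "f \<in> V"
  shows "h = (\<lambda>x. B \<zeta> f x + (\<Sum>i<m. l i h * B \<zeta> (u i) x))"
proof -
  let ?g = "\<lambda>x. B \<zeta> f x + (\<Sum>i<m. l i h * B \<zeta> (u i) x)"
  have mem: "B \<zeta> f \<in> V" "\<And>i. i < m \<Longrightarrow> B \<zeta> (u i) \<in> V" using B_mem assms u by auto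
  have Rs: "R (\<lambda>x. \<Sum>i<m. l i h * B \<zeta> (u i) x) = (\<lambda>x. \<Sum>i<m. l i h * R (B \<zeta> (u i)) x)"
    by (rule bop_lincomb[OF R]) (use mem in auto)
  have lm: "(\<lambda>x. \<Sum>i<m. l i h * B \<zeta> (u i) x) \<in> V" by (rule lincomb_mem) (use mem in auto)
  have Rg: "R ?g = (\<lambda>x. R (B \<zeta> f) x + (\<Sum>i<m. l i h * R (B \<zeta> (u i)) x))"
    unfolding bopD(2)[OF R mem(1) lm] Rs ..
  have rhs: "(\<lambda>x. f x + (\<Sum>i<m. l i h * u i x)) \<in> V"
    by (intro add_mem assms lincomb_mem u) auto
  have "\<zeta> ^ n * h x - R h x = f x + (\<Sum>i<m. l i h * u i x)" for x
    using assms(3) Tn[of h x] by (auto simp: pencil_def fun_eq_iff algebra_simps)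
  then have "h = B \<zeta> (\<lambda>x. f x + (\<Sum>i<m. l i h * u i x))" using B_unique[OF rhs assms(1,2)] by blast
  moreover have "\<zeta> ^ n * ?g x - R ?g x = f x + (\<Sum>i<m. l i h * u i x)" for x
  proof -
    have "\<zeta> ^ n * ?g x - R ?g x = (\<zeta> ^ n * B \<zeta> f x - R (B \<zeta> f) x)
        + (\<Sum>i<m. l i h * (\<zeta> ^ n * B \<zeta> (u i) x - R (B \<zeta> (u i)) x))"
      unfolding Rg by (simp add: algebra_simps sum_distrib_left sum_subtractf)
    then show ?thesis using B_right assms u by simp
  qed
  then have "?g = B \<zeta> (\<lambda>x. f x + (\<Sum>i<m. l i h * u i x))"
    using B_unique[OF rhs add_mem[OF mem(1) lm] assms(2)] by blast
  ultimately show ?thesis by simp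
qed

text \<open>Apply \<open>l i\<close> to \<open>fixed_eq\<close>: the coefficients of any solution
  satisfy the linear system.\<close>

lemma a_l:
  assumes "h \<in> V" "\<zeta> \<in> \<Omega>" "pencil (T ^^ n) (\<zeta> ^ n) h = f" "f \<in> V" "i < m"
  shows "(\<Sum>j<m. a i j \<zeta> * l j h) = l i (B \<zeta> f)"
proof -
  have mem: "B \<zeta> f \<in> V" "\<And>i. i < m \<Longrightarrow> B \<zeta> (u i) \<in> V" using B_mem assms u by auto
  have lm: "(\<lambda>x. \<Sum>i<m. l i h * B \<zeta> (u i) x) \<in> V" by (rule lincomb_mem) (use mem in auto)
  have "l i h = l i (\<lambda>x. B \<zeta> f x + (\<Sum>i<m. l i h * B \<zeta> (u i) x))"
    using arg_cong[OF fixed_eq[OF assms(1-4)], of "l i"] .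
  also have "\<dots> = l i (B \<zeta> f) + (\<Sum>j<m. l j h * l i (B \<zeta> (u j)))"
    using bfunD(1)[OF l[OF assms(5)] mem(1) lm] bfun_lincomb[OF l[OF assms(5)], of "{..<m}" "\<lambda>i. B \<zeta> (u i)"]
      mem(2) by simp
  finally have "l i h - (\<Sum>j<m. l j h * l i (B \<zeta> (u j))) = l i (B \<zeta> f)" by simp
  moreover have "(\<Sum>j<m. a i j \<zeta> * l j h) = (\<Sum>j<m. if i = j then l j h else 0) - (\<Sum>j<m. l j h * l i (B \<zeta> (u j)))"
    unfolding sum_subtractf[symmetric] a_def by (intro sum.cong refl) (simp add: algebra_simps)
  ultimately show ?thesis using assms(5) by simp
qed

text \<open>Converse of \<open>a_l\<close>. That the coefficients of \<open>S\<close> are again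
  \<open>c\<close> makes the ansatz consistent, and it shows that a nonzero \<open>c\<close> gives a
  nonzero \<open>S\<close>.\<close>

lemma solve:
  assumes "f \<in> V" "\<zeta> \<in> \<Omega>" and c: "\<And>i. i < m \<Longrightarrow> (\<Sum>j<m. a i j \<zeta> * c j) = l i (B \<zeta> f)"
  defines "S \<equiv> \<lambda>x. B \<zeta> f x + (\<Sum>j<m. c j * B \<zeta> (u j) x)"
  shows "S \<in> V" "pencil (T ^^ n) (\<zeta> ^ n) S = f" "\<And>i. i < m \<Longrightarrow> l i S = c i"
proof -
  have mem: "B \<zeta> f \<in> V" "\<And>i. i < m \<Longrightarrow> B \<zeta> (u i) \<in> V" using B_mem assms u by auto
  have lm: "(\<lambda>x. \<Sum>j<m. c j * B \<zeta> (u j) x) \<in> V" by (rule lincomb_mem) (use mem in auto)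
  show "S \<in> V" unfolding S_def by (rule add_mem[OF mem(1) lm])
  have RS: "R S = (\<lambda>x. R (B \<zeta> f) x + (\<Sum>j<m. c j * R (B \<zeta> (u j)) x))"
    unfolding S_def bopD(2)[OF R mem(1) lm] using bop_lincomb[OF R, of "{..<m}" "\<lambda>i. B \<zeta> (u i)"] mem(2) by simp
  show lS: "l i S = c i" if i: "i < m" for i
  proof -
    have "l i S = l i (B \<zeta> f) + (\<Sum>j<m. c j * l i (B \<zeta> (u j)))"
      unfolding S_def
      using bfunD(1)[OF l[OF i] mem(1) lm] bfun_lincomb[OF l[OF i], of "{..<m}" "\<lambda>i. B \<zeta> (u i)"]
        mem(2) by simp
    also have "l i (B \<zeta> f) = (\<Sum>j<m. if i = j then c j else 0) - (\<Sum>j<m. c j * l i (B \<zeta> (u j)))"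
      unfolding c[OF i, symmetric] sum_subtractf[symmetric] a_def
      by (intro sum.cong refl) (simp add: algebra_simps)
    finally show ?thesis using i by simp
  qed
  show "pencil (T ^^ n) (\<zeta> ^ n) S = f"
  proof
    fix x
    have "pencil (T ^^ n) (\<zeta> ^ n) S x = (\<zeta> ^ n * S x - R S x) - (\<Sum>j<m. c j * u j x)"
      unfolding pencil_def Tn using lS by simp
    also have "\<zeta> ^ n * S x - R S x = (\<zeta> ^ n * B \<zeta> f x - R (B \<zeta> f) x)
        + (\<Sum>j<m. c j * (\<zeta> ^ n * B \<zeta> (u j) x - R (B \<zeta> (u j)) x))"
      unfolding RS by (simp add: S_def algebra_simps sum_distrib_left sum_subtractf)
    also have "\<dots> = f x + (\<Sum>j<m. c j * u j x)" using B_right assms(1,2) u by simp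
    finally show "pencil (T ^^ n) (\<zeta> ^ n) S x = f x" by simp
  qed
qed

end

section \<open>Approximate eigenvectors at isolated spectral values\<close>

context fun_space
begin

text \<open>If the pencil at \<open>z\<close> were bounded below by \<epsilon>, the resolvents at
  nearby regular points would be bounded by \<open>2 / \<epsilon>\<close>, and perturbing one of
  them would remove \<open>z\<close> from the spectrum. Isolation provides the nearby regular
  points.\<close>

lemma approximate_eigenvector:
  assumes T: "bop T" and z: "z \<in> spectrum V N T" and r: "0 < r"
    and iso: "\<And>w. w \<in> ball z r \<Longrightarrow> w \<noteq> z \<Longrightarrow> w \<notin> spectrum V N T" and \<epsilon>: "0 < \<epsilon>"
  shows "\<exists>f\<in>V. N f = 1 \<and> N (pencil T z f) < \<epsilon>"
proof -
  have Pb: "bop (pencil T w)" for w by (rule pencil_bop[OF T])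
  have "\<exists>f\<in>V. N (pencil T z f) < \<epsilon> * N f"
  proof (rule ccontr)
    assume "\<not> ?thesis"
    then have lower: "\<epsilon> * N f \<le> N (pencil T z f)" if "f \<in> V" for f using that by force
    \<comment> \<open>Less than \<open>r\<close>, to stay off the spectrum, and at most
      \<open>\<epsilon> / 4\<close>, so that the product with the resolvent bound
      \<open>2 / \<epsilon>\<close> is at most one half.\<close>
    define \<delta> where "\<delta> = min r \<epsilon> / 4"
    have \<delta>: "0 < \<delta>" "\<delta> < r" "\<delta> \<le> \<epsilon> / 4" using r \<epsilon> by (auto simp: \<delta>_def min_def)
    define \<zeta> where "\<zeta> = z + of_real \<delta>"
    have d: "dist z \<zeta> = \<delta>" using \<delta> by (simp add: \<zeta>_def dist_norm)
    then have \<zeta>: "\<zeta> \<notin> spectrum V N T" using \<delta> by (intro iso) auto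
    have "N (resolvent V T \<zeta> f) \<le> 2 / \<epsilon> * N f" if f: "f \<in> V" for f
    proof -
      define g where "g = resolvent V T \<zeta> f"
      have g: "g \<in> V" unfolding g_def by (rule resolvent_mem[OF \<zeta> f])
      have fg: "f = pencil T \<zeta> g" unfolding g_def by (rule pencil_resolvent[OF \<zeta> f, symmetric])
      have "pencil T z g = (\<lambda>x. f x - (\<zeta> - z) * g x)" unfolding fg by (auto simp: pencil_def algebra_simps)
      then have "N (pencil T z g) \<le> N f + \<delta> * N g"
        using N_diff[OF f scale_mem[OF g, of "\<zeta> - z"]] N_scale[OF g, of "\<zeta> - z"] d
        by (simp add: dist_norm norm_minus_commute)
      with lower[OF g] have "\<epsilon> * N g \<le> N f + \<delta> * N g" by linarith
      moreover have "\<delta> * N g \<le> \<epsilon> / 4 * N g" by (rule mult_right_mono[OF \<delta>(3) N_nonneg[OF g]])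
      moreover have "0 \<le> \<epsilon> * N g" using \<epsilon> N_nonneg[OF g] by simp
      ultimately have "\<epsilon> * N g \<le> 2 * N f" by linarith
      then show ?thesis unfolding g_def[symmetric] using \<epsilon> by (simp add: field_simps)
    qed
    then have "z \<notin> spectrum V N T"
      using \<epsilon> \<delta> d by (intro not_in_spectrum_near[OF T \<zeta>, of "2 / \<epsilon>"]) (auto simp: field_simps)
    then show False using z by simp
  qed
  then obtain f where f: "f \<in> V" "N (pencil T z f) < \<epsilon> * N f" by blast
  have "0 < \<epsilon> * N f" using f N_nonneg[OF bopD(1)[OF Pb f(1)], of z] by linarith
  then have Nf: "0 < N f" using \<epsilon> by (simp add: zero_less_mult_iff)
  let ?c = "complex_of_real (1 / N f)"
  have c: "cmod ?c = 1 / N f" using Nf by (simp only: norm_of_real) simp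
  have "N (\<lambda>x. ?c * f x) = 1" unfolding N_scale[OF f(1)] c using Nf by simp
  moreover have "N (pencil T z (\<lambda>x. ?c * f x)) < \<epsilon>"
    unfolding bopD(3)[OF Pb f(1)] N_scale[OF bopD(1)[OF Pb f(1)]] c using Nf f(2)
    by (simp add: field_simps)
  ultimately show ?thesis using scale_mem[OF f(1), of ?c] by blast
qed

end

section \<open>Cramer's rule for the resolvent, Riesz projections and eigenvalues\<close>

context quasi_compact_op
begin

context
  fixes D :: "complex \<Rightarrow> complex" and b :: "nat \<Rightarrow> nat \<Rightarrow> complex \<Rightarrow> complex"
  assumes D_hol: "D holomorphic_on \<Omega>"
    and b_hol: "\<And>i j. i < m \<Longrightarrow> j < m \<Longrightarrow> b i j holomorphic_on \<Omega>"
    and ab: "\<And>z i k. i < m \<Longrightarrow> k < m \<Longrightarrow> (\<Sum>j<m. a i j z * b j k z) = (if i = k then D z else 0)"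
    and ba: "\<And>z i k. i < m \<Longrightarrow> k < m \<Longrightarrow> (\<Sum>j<m. b i j z * a j k z) = (if i = k then D z else 0)"
    and D_0: "\<And>z. D z = 0 \<Longrightarrow> \<exists>c. (\<exists>i<m. c i \<noteq> 0) \<and> (\<forall>i<m. (\<Sum>j<m. a i j z * c j) = 0)"
begin

definition num :: "('x \<Rightarrow> complex) \<Rightarrow> nat \<Rightarrow> complex \<Rightarrow> complex" where
  "num f j \<zeta> = (\<Sum>k<m. b j k \<zeta> * l k (B \<zeta> f))"

text \<open>The inverse of \<open>\<zeta> ^ n - T ^ n\<close> where \<open>D\<close> does not
  vanish, with coefficients from Cramer's rule. All singularities in \<zeta> sit in the scalar
  factor \<open>1 / D \<zeta>\<close>.\<close>

definition S :: "complex \<Rightarrow> ('x \<Rightarrow> complex) \<Rightarrow> 'x \<Rightarrow> complex" where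
  "S \<zeta> f = (\<lambda>x. B \<zeta> f x + (\<Sum>j<m. num f j \<zeta> / D \<zeta> * B \<zeta> (u j) x))"

lemma num_hol: "f \<in> V \<Longrightarrow> j < m \<Longrightarrow> num f j holomorphic_on \<Omega>"
  unfolding num_def by (intro holomorphic_intros b_hol B_holomorphic l) auto

lemma S_solve:
  assumes "f \<in> V" "\<zeta> \<in> \<Omega>" "D \<zeta> \<noteq> 0"
  shows "S \<zeta> f \<in> V" "pencil (T ^^ n) (\<zeta> ^ n) (S \<zeta> f) = f"
proof -
  have "(\<Sum>j<m. a i j \<zeta> * (num f j \<zeta> / D \<zeta>)) = l i (B \<zeta> f)" if "i < m" for i
  proof -
    have "(\<Sum>j<m. a i j \<zeta> * (num f j \<zeta> / D \<zeta>))
        = (\<Sum>j<m. \<Sum>k<m. a i j \<zeta> * b j k \<zeta> * l k (B \<zeta> f)) / D \<zeta>"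
      unfolding num_def by (simp add: sum_divide_distrib sum_distrib_left mult.assoc)
    also have "(\<Sum>j<m. \<Sum>k<m. a i j \<zeta> * b j k \<zeta> * l k (B \<zeta> f))
        = (\<Sum>k<m. (\<Sum>j<m. a i j \<zeta> * b j k \<zeta>) * l k (B \<zeta> f))"
      by (subst sum.swap) (simp add: sum_distrib_right)
    also have "\<dots> = (\<Sum>k<m. if i = k then D \<zeta> * l k (B \<zeta> f) else 0)"
      using that by (intro sum.cong refl) (simp add: ab)
    also have "\<dots> = D \<zeta> * l i (B \<zeta> f)" using that by simp
    finally show ?thesis using assms(3) by simp
  qed
  from solve[OF assms(1,2) this] show "S \<zeta> f \<in> V" "pencil (T ^^ n) (\<zeta> ^ n) (S \<zeta> f) = f"
    unfolding S_def by auto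
qed

text \<open>Multiplying the homogeneous system by the adjugate \<open>b\<close> gives
  \<open>D \<zeta> * l i h = 0\<close>; once all \<open>l i h\<close> vanish,
  \<open>fixed_eq\<close> leaves \<open>h = 0\<close>.\<close>

lemma kernel_trivial:
  assumes "h \<in> V" "\<zeta> \<in> \<Omega>" "D \<zeta> \<noteq> 0" "pencil (T ^^ n) (\<zeta> ^ n) h = (\<lambda>x. 0)"
  shows "h = (\<lambda>x. 0)"
proof -
  have B0: "B \<zeta> (\<lambda>x. 0) = (\<lambda>x. 0)"
    using B_unique[OF zero_mem zero_mem assms(2)] bop_zero[OF R] by simp
  have al: "(\<Sum>j<m. a i j \<zeta> * l j h) = 0" if "i < m" for i
    using a_l[OF assms(1,2,4) zero_mem that] bfun_zero[OF l[OF that]] B0 by simp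
  have "l i h = 0" if "i < m" for i
  proof -
    have "D \<zeta> * l i h = (\<Sum>k<m. if i = k then D \<zeta> * l k h else 0)" using that by simp
    also have "\<dots> = (\<Sum>k<m. (\<Sum>j<m. b i j \<zeta> * a j k \<zeta>) * l k h)"
      using that by (intro sum.cong refl) (simp add: ba)
    also have "\<dots> = (\<Sum>j<m. b i j \<zeta> * (\<Sum>k<m. a j k \<zeta> * l k h))"
      unfolding sum_distrib_right sum_distrib_left by (subst sum.swap) (simp add: mult.assoc)
    also have "\<dots> = 0" using al by simp
    finally show ?thesis using assms(3) by simp
  qed
  then show ?thesis using fixed_eq[OF assms(1,2,4) zero_mem] B0 by simp
qed

text \<open>Since \<open>\<zeta> ^ n - T ^ n\<close> is the product of \<open>\<zeta> - T\<close>
  and \<open>P \<zeta>\<close>, the inverse of \<open>\<zeta> - T\<close> is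
  \<open>P \<zeta>\<close> after \<open>S \<zeta>\<close>. Boundedness of \<open>S \<zeta>\<close>
  is seen by writing it as \<open>B \<zeta>\<close> plus finitely many operators of rank
  one.\<close>

lemma resolvent_eq:
  assumes "\<zeta> \<in> \<Omega>" "D \<zeta> \<noteq> 0"
  shows "\<zeta> \<notin> spectrum V N T" "\<And>f. f \<in> V \<Longrightarrow> resolvent V T \<zeta> f = P \<zeta> (S \<zeta> f)"
proof -
  have Bb: "bop (B \<zeta>)"
    unfolding B_def by (rule bop_neumann[OF R R_le \<rho>n \<Omega>D[OF assms(1)]])
  have "bop (\<lambda>f x. (\<Sum>k<m. b j k \<zeta> / D \<zeta> * l k (B \<zeta> f)) * B \<zeta> (u j) x)" if "j < m" for j
  proof -
    have "bop (\<lambda>f x. \<Sum>k<m. b j k \<zeta> / D \<zeta> * (l k (B \<zeta> f) * B \<zeta> (u j) x))"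
      by (intro bop_sum bop_scale bop_rank_one[OF bfun_comp[OF l Bb] B_mem[OF u[OF that] assms(1)]]) auto
    then show ?thesis by (simp add: sum_distrib_right mult.assoc)
  qed
  then have "bop (\<lambda>f x. B \<zeta> f x + (\<Sum>j<m. (\<Sum>k<m. b j k \<zeta> / D \<zeta> * l k (B \<zeta> f)) * B \<zeta> (u j) x))"
    using Bb by (intro bop_add bop_sum) auto
  then have "bop (S \<zeta>)" unfolding S_def num_def by (simp add: sum_divide_distrib)
  then have PS: "bop (\<lambda>f. P \<zeta> (S \<zeta> f))" by (rule bop_comp[OF P])
  have "\<forall>f\<in>V. pencil T \<zeta> (P \<zeta> (S \<zeta> f)) = f"
    using pencil_P(1) S_solve assms by simp
  moreover have "\<forall>f\<in>V. pencil T \<zeta> f = (\<lambda>x. 0) \<longrightarrow> f = (\<lambda>x. 0)"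
  proof (intro ballI impI)
    fix f assume f: "f \<in> V" "pencil T \<zeta> f = (\<lambda>x. 0)"
    show "f = (\<lambda>x. 0)"
      by (rule kernel_trivial[OF f(1) assms]) (simp add: pencil_P(2)[OF f(1), symmetric] f(2) bop_zero[OF P])
  qed
  ultimately show "\<zeta> \<notin> spectrum V N T" "f \<in> V \<Longrightarrow> resolvent V T \<zeta> f = P \<zeta> (S \<zeta> f)" for f
    by (rule not_in_spectrumI[OF PS T])+
qed

text \<open>A zero of \<open>D\<close> gives a nonzero solution of the homogeneous system and,
  through \<open>solve\<close>, an eigenvector of \<open>T ^^ n\<close> for
  \<open>\<zeta> ^ n\<close>. This is impossible if \<open>\<zeta> ^ n\<close> exceeds a norm bound
  of \<open>T ^^ n\<close>.\<close>

lemma D_not_0: "\<exists>\<zeta>\<in>\<Omega>. D \<zeta> \<noteq> 0"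
proof -
  obtain C where C: "0 \<le> C" "\<And>f. f \<in> V \<Longrightarrow> N ((T ^^ n) f) \<le> C * N f"
    using bop_bound[OF bop_funpow[OF T, of n]] by blast
  \<comment> \<open>The modulus \<open>\<rho> + C + 1\<close> exceeds \<rho>; being at least 1, it
    is at most its own \<open>n\<close>-th power, which therefore exceeds \<open>C\<close>.\<close>
  define \<zeta> where "\<zeta> = complex_of_real (\<rho> + C + 1)"
  have cz: "cmod \<zeta> = \<rho> + C + 1" unfolding \<zeta>_def norm_of_real using C \<rho> by simp
  have \<zeta>: "\<zeta> \<in> \<Omega>" using cz C by simp
  have big: "C < cmod (\<zeta> ^ n)"
    using power_increasing[of 1 n "\<rho> + C + 1"] n C \<rho> cz by (simp add: norm_power)
  have "D \<zeta> \<noteq> 0"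
  proof
    assume "D \<zeta> = 0"
    then obtain c i where c: "i < m" "c i \<noteq> 0" "\<And>i. i < m \<Longrightarrow> (\<Sum>j<m. a i j \<zeta> * c j) = 0"
      using D_0 by blast
    have B0: "B \<zeta> (\<lambda>x. 0) = (\<lambda>x. 0)"
      using B_unique[OF zero_mem zero_mem \<zeta>] bop_zero[OF R] by simp
    define h where "h = (\<lambda>x. B \<zeta> (\<lambda>x. 0) x + (\<Sum>j<m. c j * B \<zeta> (u j) x))"
    have "(\<Sum>j<m. a i j \<zeta> * c j) = l i (B \<zeta> (\<lambda>x. 0))" if "i < m" for i
      using c(3)[OF that] bfun_zero[OF l[OF that]] B0 by simp
    from solve[OF zero_mem \<zeta> this] have h: "h \<in> V" "pencil (T ^^ n) (\<zeta> ^ n) h = (\<lambda>x. 0)" "l i h = c i"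
      unfolding h_def using c(1) by auto
    have "(T ^^ n) h = (\<lambda>x. \<zeta> ^ n * h x)" using h(2) by (auto simp: pencil_def fun_eq_iff)
    then have "cmod (\<zeta> ^ n) * N h \<le> C * N h" using C(2)[OF h(1)] N_scale[OF h(1), of "\<zeta> ^ n"] by simp
    then have "(cmod (\<zeta> ^ n) - C) * N h \<le> 0" by (simp only: left_diff_distrib)
    then have "N h \<le> 0" using big by (auto simp: mult_le_0_iff)
    then have "h = (\<lambda>x. 0)" by (rule N_eq_0D[OF h(1)])
    then show False using h(3) c(1,2) bfun_zero[OF l[OF c(1)]] by simp
  qed
  then show ?thesis using \<zeta> by blast
qed

text \<open>On the circle the resolvent is the holomorphic term \<open>H f x\<close>, with integral
  0, plus the terms \<open>num f j / D\<close> times \<open>H (u j) x\<close>. As \<open>D\<close>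
  vanishes to order \<open>k\<close>, \<open>circle_integral_pole_span\<close> separates the
  dependence on \<open>f\<close> from that on \<open>x\<close> and leaves \<open>m * k\<close>
  functions of \<open>x\<close>.\<close>

lemma riesz_finite_dimensional:
  assumes r: "ball z r \<subseteq> \<Omega>" "0 < s" "s < r"
    and g: "g holomorphic_on ball z r" "\<And>w. w \<in> ball z r \<Longrightarrow> D w = (w - z) ^ k * g w"
      "\<And>w. w \<in> ball z r \<Longrightarrow> g w \<noteq> 0"
  shows "finite_dimensional (riesz_projection V T z s ` V)"
proof -
  define H where "H f x \<zeta> = P \<zeta> (B \<zeta> f) x" for f x \<zeta>
  have H: "H f x holomorphic_on ball z r" if "f \<in> V" for f x
  proof -
    have "H f x holomorphic_on \<Omega>"
      unfolding H_def P_def geom_def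
      by (intro holomorphic_intros B_holomorphic[of "\<lambda>f. (T ^^ _) f x"] that
          bfun_comp[OF bfun_eval bop_funpow[OF T]])
    then show ?thesis using r(1) by (rule holomorphic_on_subset)
  qed
  define I where "I f j p = contour_integral (circlepath z s)
      (\<lambda>w. num f j w * (w - z) ^ p / ((w - z) ^ k * g w))" for f j p
  define is_coef where "is_coef j x c \<longleftrightarrow> (\<forall>A. A holomorphic_on ball z r \<longrightarrow>
    ((\<lambda>w. A w * H (u j) x w / ((w - z) ^ k * g w)) has_contour_integral
      (\<Sum>p<k. c p * contour_integral (circlepath z s) (\<lambda>w. A w * (w - z) ^ p / ((w - z) ^ k * g w))))
      (circlepath z s))" for j x c
  \<comment> \<open>The coefficients are fixed before \<open>f\<close> is given, so the functions
    \<open>\<lambda>x. c j x p\<close> span the images of all \<open>f\<close> in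
    \<open>V\<close>.\<close>
  define c where "c j x = (SOME c. is_coef j x c)" for j x
  have c: "is_coef j x (c j x)" if "j < m" for j x
  proof -
    have "\<exists>c. is_coef j x c"
      unfolding is_coef_def by (rule circle_integral_pole_span[OF r(2,3) g(1,3) H[OF u[OF that]]])
    then show ?thesis unfolding c_def by (rule someI_ex)
  qed
  show ?thesis
  proof (rule finite_dimensionalI[where I = "{..<m} \<times> {..<k}" and b = "\<lambda>(j, p) x. c j x p"])
    fix F assume "F \<in> riesz_projection V T z s ` V"
    then obtain f where f: "f \<in> V" and F: "F = riesz_projection V T z s f" by blast
    have "num f j holomorphic_on ball z r" if "j < m" for j
      using num_hol[OF f that] r(1) by (rule holomorphic_on_subset)
    then have 1: "((\<lambda>w. num f j w * H (u j) x w / ((w - z) ^ k * g w)) has_contour_integral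
        (\<Sum>p<k. c j x p * I f j p)) (circlepath z s)" if "j < m" for j x
      unfolding I_def using c[OF that, of x] that unfolding is_coef_def by simp
    have 2: "(H f x has_contour_integral 0) (circlepath z s)" for x
      using r(2,3) by (intro Cauchy_theorem_disc_simple[OF H[OF f]]) auto
    have "((\<lambda>w. H f x w + (\<Sum>j<m. num f j w * H (u j) x w / ((w - z) ^ k * g w))) has_contour_integral
        (0 + (\<Sum>j<m. \<Sum>p<k. c j x p * I f j p))) (circlepath z s)" for x
      by (intro has_contour_integral_add 2 has_contour_integral_sum 1) auto
    moreover have "H f x w + (\<Sum>j<m. num f j w * H (u j) x w / ((w - z) ^ k * g w)) = resolvent V T w f x"
      if "w \<in> path_image (circlepath z s)" for w x
    proof -
      have w: "w \<in> ball z r" "w \<in> \<Omega>" "w \<noteq> z" using that r by (auto simp: path_image_circlepath)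
      have D: "D w \<noteq> 0" "D w = (w - z) ^ k * g w" using g(2,3)[OF w(1)] w(3) by auto
      have lm: "(\<lambda>x. \<Sum>j<m. num f j w / D w * B w (u j) x) \<in> V"
        by (intro lincomb_mem B_mem u w) auto
      have "resolvent V T w f x = P w (S w f) x" using resolvent_eq(2)[OF w(2) D(1) f] by simp
      also have "\<dots> = P w (B w f) x + (\<Sum>j<m. num f j w / D w * P w (B w (u j)) x)"
        unfolding S_def bopD(2)[OF P B_mem[OF f w(2)] lm]
        using bop_lincomb[OF P[of w], of "{..<m}" "\<lambda>j. B w (u j)", where c = "\<lambda>j. num f j w / D w"]
          B_mem[OF u w(2)] by (auto dest: fun_cong[of _ _ x])
      finally show ?thesis unfolding H_def D(2) by simp
    qed
    ultimately have "((\<lambda>w. resolvent V T w f x) has_contour_integral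
        (0 + (\<Sum>j<m. \<Sum>p<k. c j x p * I f j p))) (circlepath z s)" for x
      by (rule has_contour_integral_eq)
    then have "contour_integral (circlepath z s) (\<lambda>w. resolvent V T w f x)
        = (\<Sum>j<m. \<Sum>p<k. c j x p * I f j p)" for x
      using contour_integral_unique by fastforce
    then have "F = (\<lambda>x. 1 / (2 * of_real pi * \<i>) * (\<Sum>j<m. \<Sum>p<k. c j x p * I f j p))"
      unfolding F riesz_projection_def by simp
    also have "\<dots> = (\<lambda>x. \<Sum>q\<in>{..<m} \<times> {..<k}. 1 / (2 * of_real pi * \<i>) * I f (fst q) (snd q) *
        (case q of (j, p) \<Rightarrow> \<lambda>x. c j x p) x)"
      by (simp add: sum.cartesian_product sum_distrib_left case_prod_beta ac_simps)
    finally show "\<exists>C. F = (\<lambda>x. \<Sum>q\<in>{..<m} \<times> {..<k}. C q * (case q of (j, p) \<Rightarrow> \<lambda>x. c j x p) x)"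
      by (rule exI[of _ "\<lambda>q. 1 / (2 * of_real pi * \<i>) * I f (fst q) (snd q)"])
  qed simp
qed

end

text \<open>Normalised approximate eigenvectors satisfy \<open>fixed_eq\<close> with right hand
  sides tending to 0, so up to a small error they lie in the span of the \<open>B z (u i)\<close>.
  Their coefficients are bounded; a subsequence converges in norm, and the limit is an
  eigenvector.\<close>

lemma isolated_eigenvalue:
  assumes z: "z \<in> spectrum V N T" "z \<in> \<Omega>" and r: "0 < r"
    and iso: "\<And>w. w \<in> ball z r \<Longrightarrow> w \<noteq> z \<Longrightarrow> w \<notin> spectrum V N T"
  shows "eigenvalue V T z"
proof -
  have Pb: "bop (pencil T z)" by (rule pencil_bop[OF T])
  have "\<forall>j. \<exists>f\<in>V. N f = 1 \<and> N (pencil T z f) < inverse (real (Suc j))"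
    using approximate_eigenvector[OF T z(1) r iso] by simp
  then obtain F where F: "\<And>j. F j \<in> V" "\<And>j. N (F j) = 1"
    "\<And>j. N (pencil T z (F j)) < inverse (real (Suc j))" by metis
  define G where "G j = P z (pencil T z (F j))" for j
  have pF: "pencil T z (F j) \<in> V" for j by (rule bopD(1)[OF Pb F(1)])
  have G: "G j \<in> V" for j unfolding G_def by (rule bopD(1)[OF P pF])
  obtain C where C: "0 \<le> C" "\<And>f. f \<in> V \<Longrightarrow> N (P z f) \<le> C * N f" using bop_bound[OF P[of z]] by blast
  obtain C' where C': "0 \<le> C'" "\<And>f. f \<in> V \<Longrightarrow> N (pencil T z f) \<le> C' * N f"
    using bop_bound[OF Pb] by blast
  let ?q = "1 / (cmod (z ^ n) - \<rho> ^ n)"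
  have q: "0 \<le> ?q" using \<Omega>D[OF z(2)] by simp
  \<comment> \<open>\<open>P z\<close> turns the pencil of \<open>T\<close> into that of
    \<open>T ^^ n\<close>. Thus \<open>G j\<close> is small, and only the finitely many numbers
    \<open>l i (F j)\<close> remain to be made convergent.\<close>
  have Feq: "F j = (\<lambda>x. B z (G j) x + (\<Sum>i<m. l i (F j) * B z (u i) x))" for j
    using pencil_P(2)[OF F(1)[of j], of z, symmetric] G by (intro fixed_eq[OF F(1) z(2)]) (auto simp: G_def)
  have "bounded (range (\<lambda>j. l i (F j)))" if i: "i < m" for i
  proof -
    obtain E where E: "\<forall>f\<in>V. cmod (l i f) \<le> E * N f"
      using l[OF i] unfolding bfun_def by (elim conjE exE)
    have "cmod (l i (F j)) \<le> E" for j using bspec[OF E F(1)[of j]] F(2) by simp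
    then show ?thesis unfolding bounded_iff by blast
  qed
  then obtain \<sigma> c where \<sigma>: "strict_mono (\<sigma> :: nat \<Rightarrow> nat)"
    and c: "\<And>i. i < m \<Longrightarrow> (\<lambda>j. l i (F (\<sigma> j))) \<longlonglongrightarrow> c i"
    using bounded_family_convergent_subsequence[of m "\<lambda>i j. l i (F j)"] by blast
  have Bu: "B z (u i) \<in> V" if "i < m" for i by (rule B_mem[OF u[OF that] z(2)])
  define f where "f = (\<lambda>x. \<Sum>i<m. c i * B z (u i) x)"
  have f: "f \<in> V" unfolding f_def by (rule lincomb_mem) (use Bu in auto)
  define e where "e j = ?q * (C * inverse (real (Suc (\<sigma> j)))) + (\<Sum>i<m. cmod (l i (F (\<sigma> j)) - c i) * N (B z (u i)))" for j
  have inv0: "(\<lambda>j. inverse (real (Suc (\<sigma> j)))) \<longlonglongrightarrow> 0"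
    using LIMSEQ_subseq_LIMSEQ[OF LIMSEQ_inverse_real_of_nat \<sigma>] by (simp add: o_def)
  have "e \<longlonglongrightarrow> ?q * (C * 0) + (\<Sum>i<m. cmod (c i - c i) * N (B z (u i)))"
    unfolding e_def by (intro tendsto_intros inv0 c) auto
  then have e0: "e \<longlonglongrightarrow> 0" by simp
  have diff: "N (\<lambda>x. F (\<sigma> j) x - f x) \<le> e j" for j
  proof -
    have "(\<lambda>x. F (\<sigma> j) x - f x) = (\<lambda>x. B z (G (\<sigma> j)) x + (\<Sum>i<m. (l i (F (\<sigma> j)) - c i) * B z (u i) x))"
      by (subst Feq) (simp add: f_def sum_subtractf left_diff_distrib add_diff_eq)
    then have 1: "N (\<lambda>x. F (\<sigma> j) x - f x)
        \<le> N (B z (G (\<sigma> j))) + N (\<lambda>x. \<Sum>i<m. (l i (F (\<sigma> j)) - c i) * B z (u i) x)"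
      by (simp only:) (intro N_add B_mem G z lincomb_mem Bu; simp)
    have "N (\<lambda>x. \<Sum>i<m. (l i (F (\<sigma> j)) - c i) * B z (u i) x)
        \<le> (\<Sum>i<m. N (\<lambda>x. (l i (F (\<sigma> j)) - c i) * B z (u i) x))"
      by (rule N_sum_le) (auto intro: scale_mem Bu)
    also have "\<dots> = (\<Sum>i<m. cmod (l i (F (\<sigma> j)) - c i) * N (B z (u i)))"
      by (intro sum.cong refl N_scale Bu) auto
    finally have 2: "N (\<lambda>x. \<Sum>i<m. (l i (F (\<sigma> j)) - c i) * B z (u i) x)
        \<le> (\<Sum>i<m. cmod (l i (F (\<sigma> j)) - c i) * N (B z (u i)))" .
    have "N (B z (G (\<sigma> j))) \<le> ?q * N (G (\<sigma> j))" using N_B[OF G z(2)] by simp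
    also have "\<dots> \<le> ?q * (C * inverse (real (Suc (\<sigma> j))))"
      unfolding G_def using C(2)[OF pF[of "\<sigma> j"]] mult_left_mono[OF less_imp_le[OF F(3)[of "\<sigma> j"]] C(1)]
      by (intro mult_left_mono[OF _ q]) linarith
    finally show ?thesis using 1 2 unfolding e_def by linarith
  qed
  have "1 \<le> N f"
  proof -
    have "1 - e j \<le> N f" for j
    proof -
      have "N (\<lambda>x. (F (\<sigma> j) x - f x) + f x) \<le> N (\<lambda>x. F (\<sigma> j) x - f x) + N f"
        by (intro N_add diff_mem F f)
      then show ?thesis using diff[of j] F(2)[of "\<sigma> j"] by simp
    qed
    moreover have "(\<lambda>j. 1 - e j) \<longlonglongrightarrow> 1 - 0" by (intro tendsto_intros e0)
    ultimately show ?thesis using LIMSEQ_le_const2 by fastforce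
  qed
  then have f0: "f \<noteq> (\<lambda>x. 0)" by auto
  have "N (pencil T z f) \<le> inverse (real (Suc (\<sigma> j))) + C' * e j" for j
  proof -
    have "pencil T z f = (\<lambda>x. pencil T z (F (\<sigma> j)) x - pencil T z (\<lambda>x. F (\<sigma> j) x - f x) x)"
      by (subst bop_diff[OF Pb F(1) f]) simp
    then have "N (pencil T z f) \<le> N (pencil T z (F (\<sigma> j))) + N (pencil T z (\<lambda>x. F (\<sigma> j) x - f x))"
      using N_diff[OF pF bopD(1)[OF Pb diff_mem[OF F(1) f]]] by simp
    also have "N (pencil T z (\<lambda>x. F (\<sigma> j) x - f x)) \<le> C' * e j"
      using C'(2)[OF diff_mem[OF F(1)[of "\<sigma> j"] f]] mult_left_mono[OF diff[of j] C'(1)] by linarith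
    finally show ?thesis using F(3)[of "\<sigma> j"] by linarith
  qed
  moreover have "(\<lambda>j. inverse (real (Suc (\<sigma> j))) + C' * e j) \<longlonglongrightarrow> 0 + C' * 0"
    by (intro tendsto_intros inv0 e0)
  ultimately have "N (pencil T z f) \<le> 0" using LIMSEQ_le_const by fastforce
  then have "pencil T z f = (\<lambda>x. 0)" by (rule N_eq_0D[OF bopD(1)[OF Pb f]])
  then have "T f = (\<lambda>x. z * f x)" by (auto simp: pencil_def fun_eq_iff)
  then show ?thesis unfolding eigenvalue_def using f f0 by blast
qed

text \<open>Spectral values in \<Omega> are zeros of \<open>D\<close>. As \<Omega> is connected and
  \<open>D\<close> is not identically 0, each zero is isolated and of finite order; the order
  controls the pole of the resolvent, and isolation yields the eigenvector.\<close>

theorem spectrum_outside: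
  assumes z: "z \<in> spectrum V N T" "\<rho> < cmod z"
  shows "z isolated_in spectrum V N T" "eigenvalue V T z" "finite_algebraic_multiplicity V N T z"
proof -
  obtain D b where Db: "D holomorphic_on \<Omega>"
    "\<And>i j. i < m \<Longrightarrow> j < m \<Longrightarrow> b i j holomorphic_on \<Omega>"
    "\<And>z i k. i < m \<Longrightarrow> k < m \<Longrightarrow> (\<Sum>j<m. a i j z * b j k z) = (if i = k then D z else 0)"
    "\<And>z i k. i < m \<Longrightarrow> k < m \<Longrightarrow> (\<Sum>j<m. b i j z * a j k z) = (if i = k then D z else 0)"
    "\<And>z. D z = 0 \<Longrightarrow> \<exists>c. (\<exists>i<m. c i \<noteq> 0) \<and> (\<forall>i<m. (\<Sum>j<m. a i j z * c j) = 0)"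
    by (rule holomorphic_cramer[where a = a and S = \<Omega> and m = m]) (erule (1) a_holomorphic, rule that)
  have z\<Omega>: "z \<in> \<Omega>" using z by simp
  have Dz: "D z = 0" using resolvent_eq(1)[OF Db z\<Omega>] z(1) by blast
  obtain \<zeta> where \<zeta>: "\<zeta> \<in> \<Omega>" "D \<zeta> \<noteq> 0" using D_not_0[OF Db] by blast
  have op: "open \<Omega>" by (intro open_Collect_less continuous_intros)
  have "\<Omega> = - cball 0 \<rho>" by auto
  then have con: "connected \<Omega>"
    using connected_complement_bounded_convex[of "cball (0::complex) \<rho>"] by simp
  have nc: "\<not> D constant_on \<Omega>"
  proof
    assume "D constant_on \<Omega>"
    then obtain y where "\<forall>x\<in>\<Omega>. D x = y" unfolding constant_on_def by (elim exE)
    then have "D z = y" "D \<zeta> = y" using z\<Omega> \<zeta>(1) by blast+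
    then show False using \<zeta>(2) Dz by simp
  qed
  obtain g r k where g: "0 < r" "ball z r \<subseteq> \<Omega>" "g holomorphic_on ball z r"
    "\<And>w. w \<in> ball z r \<Longrightarrow> D w = (w - z) ^ k * g w" "\<And>w. w \<in> ball z r \<Longrightarrow> g w \<noteq> 0"
    by (rule holomorphic_factor_zero_nonconstant[OF Db(1) op con z\<Omega> Dz nc]) (rule that)
  have iso: "w \<notin> spectrum V N T" if "w \<in> ball z r" "w \<noteq> z" for w
    using resolvent_eq(1)[OF Db, of w] g(2) g(4,5)[OF that(1)] that by auto
  have single: "ball z r \<inter> spectrum V N T = {z}" using iso z(1) g(1) by fastforce
  show "z isolated_in spectrum V N T"
    unfolding isolated_in_def using z(1) single by blast
  show "eigenvalue V T z" by (rule isolated_eigenvalue[OF z(1) z\<Omega> g(1) iso])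
  show "finite_algebraic_multiplicity V N T z"
    unfolding finite_algebraic_multiplicity_def
  \<comment> \<open>Half the radius keeps the closed disc inside the ball on which \<open>D\<close>
    is factored.\<close>
  proof (intro exI[of _ "r / 2"] conjI)
    show "spectrum V N T \<inter> cball z (r / 2) = {z}"
    proof -
      have "z \<in> cball z (r / 2)" "cball z (r / 2) \<subseteq> ball z r" using g(1) by auto
      then show ?thesis using single z(1) by blast
    qed
    show "finite_dimensional (riesz_projection V T z (r / 2) ` V)"
      using g(1) by (intro riesz_finite_dimensional[OF Db g(2) _ _ g(3-5)]) auto
  qed (use g(1) in simp)
qed

end

section \<open>Sums over words\<close>

lemma infsum_ennreal_eq_SUP:
  fixes f :: "'a \<Rightarrow> ennreal"
  shows "infsum f A = (SUP F\<in>{F. finite F \<and> F \<subseteq> A}. sum f F)"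
  by (rule nonneg_infsum_complete) simp

lemma infsum_ennreal_leI:
  fixes f :: "'a \<Rightarrow> ennreal"
  assumes "\<And>F. finite F \<Longrightarrow> F \<subseteq> A \<Longrightarrow> sum f F \<le> c"
  shows "infsum f A \<le> c"
  unfolding infsum_ennreal_eq_SUP using assms by (auto intro!: SUP_least)

lemma sum_le_infsum_ennreal:
  fixes f :: "'a \<Rightarrow> ennreal"
  assumes "finite F" "F \<subseteq> A"
  shows "sum f F \<le> infsum f A"
  unfolding infsum_ennreal_eq_SUP using assms by (auto intro!: SUP_upper)

lemma infsum_ennreal_mono:
  fixes f g :: "'a \<Rightarrow> ennreal"
  assumes "A \<subseteq> B" "\<And>x. x \<in> A \<Longrightarrow> f x \<le> g x"
  shows "infsum f A \<le> infsum g B"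
proof (rule infsum_ennreal_leI)
  fix F assume F: "finite F" "F \<subseteq> A"
  have "sum f F \<le> sum g F" using F assms by (intro sum_mono) auto
  also have "\<dots> \<le> infsum g B" using F assms by (intro sum_le_infsum_ennreal) auto
  finally show "sum f F \<le> infsum g B" .
qed

text \<open>The map \<open>q\<close> may be many-to-one: for every finite part of the image one
  preimage per element is selected.\<close>

lemma infsum_ennreal_image_le:
  fixes f :: "'a \<Rightarrow> ennreal"
  assumes "S \<subseteq> q ` P" "\<And>p. p \<in> P \<Longrightarrow> f (q p) \<le> g p"
  shows "infsum f S \<le> infsum g P"
proof (rule infsum_ennreal_leI)
  fix F assume F: "finite F" "F \<subseteq> S"
  then obtain U where U: "U \<subseteq> P" "inj_on q U" "F = q ` U"
    using subset_image_inj[of F q P] assms(1) by blast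
  have "finite U" using F(1) U finite_image_iff by blast
  have "sum f F = (\<Sum>p\<in>U. f (q p))" unfolding U(3) using U(2) by (rule sum.reindex_cong) auto
  also have "\<dots> \<le> sum g U" using U(1) assms(2) by (intro sum_mono) auto
  also have "\<dots> \<le> infsum g P" using \<open>finite U\<close> U(1) by (rule sum_le_infsum_ennreal)
  finally show "sum f F \<le> infsum g P" .
qed

lemma infsum_ennreal_Times_le:
  fixes f :: "'a \<Rightarrow> ennreal" and g :: "'b \<Rightarrow> ennreal"
  shows "infsum (\<lambda>(x, y). f x * g y) (A \<times> B) \<le> infsum f A * infsum g B"
proof (rule infsum_ennreal_leI)
  fix F assume F: "finite F" "F \<subseteq> A \<times> B"
  have "(\<Sum>(x, y)\<in>F. f x * g y) \<le> (\<Sum>(x, y)\<in>fst ` F \<times> snd ` F. f x * g y)"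
    using F by (intro sum_mono2 subset_fst_snd) auto
  also have "\<dots> = sum f (fst ` F) * sum g (snd ` F)"
    by (simp add: sum_product sum.cartesian_product)
  also have "\<dots> \<le> infsum f A * infsum g B"
    using F by (intro mult_mono sum_le_infsum_ennreal) auto
  finally show "(\<Sum>(x, y)\<in>F. f x * g y) \<le> infsum f A * infsum g B" .
qed

lemma infsum_ennreal_Un_le:
  fixes f :: "'a \<Rightarrow> ennreal"
  shows "infsum f (A \<union> B) \<le> infsum f A + infsum f B"
proof (rule infsum_ennreal_leI)
  fix F assume F: "finite F" "F \<subseteq> A \<union> B"
  have "sum f F = sum f (F \<inter> A) + sum f (F - A)"
    using F(1) by (metis sum.Int_Diff)
  also have "\<dots> \<le> infsum f A + infsum f B"
    using F by (intro add_mono sum_le_infsum_ennreal) auto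
  finally show "sum f F \<le> infsum f A + infsum f B" .
qed

lemma infsum_ennreal_cmult_le:
  fixes f :: "'a \<Rightarrow> ennreal"
  shows "infsum (\<lambda>x. c * f x) A \<le> c * infsum f A"
proof (rule infsum_ennreal_leI)
  fix F assume F: "finite F" "F \<subseteq> A"
  then show "(\<Sum>x\<in>F. c * f x) \<le> c * infsum f A"
    unfolding sum_distrib_left[symmetric] by (intro mult_left_mono sum_le_infsum_ennreal) auto
qed

lemma infsum_ennreal_real:
  assumes "\<And>x. x \<in> A \<Longrightarrow> 0 \<le> f x" "infsum (\<lambda>x. ennreal (f x)) A < \<infinity>"
  shows "f summable_on A" "infsum (\<lambda>x. ennreal (f x)) A = ennreal (infsum f A)"
proof -
  obtain c where c: "infsum (\<lambda>x. ennreal (f x)) A = ennreal c" "0 \<le> c"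
    using assms(2) by (cases "infsum (\<lambda>x. ennreal (f x)) A") auto
  have "sum f F \<le> c" if "finite F" "F \<subseteq> A" for F
    using sum_le_infsum_ennreal[OF that, of "\<lambda>x. ennreal (f x)"] that assms(1) c
    by (subst (asm) sum_ennreal) auto
  then show sm: "f summable_on A"
    using assms(1) by (intro nonneg_bdd_above_summable_on) (auto intro!: bdd_aboveI[of _ c])
  have "ennreal (infsum f A) = (SUP F\<in>{F. finite F \<and> F \<subseteq> A}. ennreal (sum f F))"
    by (rule infsum_nonneg_is_SUPREMUM_ennreal[OF sm assms(1)])
  also have "\<dots> = infsum (\<lambda>x. ennreal (f x)) A"
    unfolding infsum_ennreal_eq_SUP using assms(1) by (intro SUP_cong refl) (auto intro!: sum_ennreal[symmetric])
  finally show "infsum (\<lambda>x. ennreal (f x)) A = ennreal (infsum f A)" by simp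
qed

lemma infsum_ennreal_of_real:
  assumes "\<And>x. x \<in> A \<Longrightarrow> 0 \<le> f x" "f summable_on A"
  shows "infsum (\<lambda>x. ennreal (f x)) A = ennreal (infsum f A)"
proof -
  have "ennreal (infsum f A) = (SUP F\<in>{F. finite F \<and> F \<subseteq> A}. ennreal (sum f F))"
    by (rule infsum_nonneg_is_SUPREMUM_ennreal[OF assms(2,1)])
  also have "\<dots> = infsum (\<lambda>x. ennreal (f x)) A"
    unfolding infsum_ennreal_eq_SUP using assms(1) by (intro SUP_cong refl) (auto intro!: sum_ennreal[symmetric])
  finally show ?thesis by simp
qed

text \<open>A finite partial sum within \<epsilon> of the supremum leaves at most \<epsilon> for any
  finite set disjoint from it.\<close>

lemma infsum_ennreal_tail:
  fixes f :: "'a \<Rightarrow> ennreal"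
  assumes fin: "infsum f A < \<infinity>" and \<epsilon>: "0 < \<epsilon>"
  shows "\<exists>F. finite F \<and> F \<subseteq> A \<and> infsum f (A - F) \<le> \<epsilon>"
proof (cases "infsum f A \<le> \<epsilon>")
  case True
  then show ?thesis by (intro exI[of _ "{}"]) auto
next
  case False
  then have "infsum f A - \<epsilon> < infsum f A"
    using fin \<epsilon> by (intro ennreal_between) auto
  then obtain F where F: "finite F" "F \<subseteq> A" "infsum f A - \<epsilon> < sum f F"
    by (auto simp: infsum_ennreal_eq_SUP[of f A] less_SUP_iff)
  have "infsum f (A - F) \<le> \<epsilon>"
  proof (rule infsum_ennreal_leI)
    fix H assume H: "finite H" "H \<subseteq> A - F"
    have "sum f F + sum f H = sum f (F \<union> H)" using F H by (intro sum.union_disjoint[symmetric]) auto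
    also have "\<dots> \<le> infsum f A" using F H by (intro sum_le_infsum_ennreal) auto
    also have "\<dots> \<le> \<epsilon> + sum f F" using F(3) ennreal_minus_le_iff by (metis less_imp_le top.not_eq_extremum)
    finally have "sum f F + sum f H \<le> sum f F + \<epsilon>" by (simp add: add.commute)
    moreover have "sum f F \<noteq> \<infinity>" using sum_le_infsum_ennreal[OF F(1,2), of f] fin by (auto simp: top_unique)
    ultimately show "sum f H \<le> \<epsilon>" by (simp add: ennreal_add_left_cancel_le)
  qed
  then show ?thesis using F by blast
qed

text \<open>Abstract weights on words: \<open>G\<close> is submultiplicative, and
  \<open>Gl v l\<close> bounds the weight of \<open>l\<close> under the condition that the block
  \<open>v\<close> follows. The latter is kept separate because only weights with a look-ahead of
  \<open>k\<close> letters can be compared with single points. The number \<open>x\<close> is the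
  variable of the generating functions.\<close>

locale path_weights =
  fixes Adm :: "'s list \<Rightarrow> bool" and G :: "'s list \<Rightarrow> ennreal"
    and Gl :: "'s list \<Rightarrow> 's list \<Rightarrow> ennreal" and k :: nat and x :: ennreal
  assumes k: "0 < k" and x: "x < \<infinity>"
    and Adm_append: "\<And>u w. Adm (u @ w) \<Longrightarrow> Adm u \<and> Adm w"
    and G_append: "\<And>u w. G (u @ w) \<le> G u * G w"
    and G_loop: "\<And>v l b. length v = k \<Longrightarrow> take k b = v \<Longrightarrow> G (l @ b) \<le> Gl v l * G b"
    and G_Nil: "G [] \<le> 1"
    and letters: "infsum (\<lambda>s. G [s]) UNIV < \<infinity>"
begin

definition wt :: "'s list \<Rightarrow> ennreal" where "wt w = G w * x ^ length w"

text \<open>It is \<open>l @ v\<close> that must begin with \<open>v\<close>, not \<open>l\<close>: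
  a loop may be shorter than \<open>k\<close>, since successive occurrences of \<open>v\<close> may
  overlap.\<close>

definition loops :: "'s list \<Rightarrow> 's list set" where "loops v = {l. Adm (l @ v) \<and> take k (l @ v) = v}"

definition avoiding :: "'s list set \<Rightarrow> 's list set" where
  "avoiding E = {w. Adm w \<and> (\<forall>i. i + k \<le> length w \<longrightarrow> take k (drop i w) \<notin> E)}"

definition loop_sum :: "'s list \<Rightarrow> ennreal" where
  "loop_sum v = infsum (\<lambda>l. Gl v l * x ^ length l) (loops v)"

lemma wt_append: "wt (u @ w) \<le> wt u * wt w"
  unfolding wt_def using mult_right_mono[OF G_append[of u w], of "x ^ (length u + length w)"]
  by (simp add: power_add ac_simps)

lemma sum_length: "infsum G {w. length w = n} \<le> infsum (\<lambda>s. G [s]) UNIV ^ n"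
proof (induction n)
  case 0
  have "{w :: 's list. length w = 0} = {[]}" by auto
  then show ?case using G_Nil by simp
next
  case (Suc n)
  have "infsum G {w. length w = Suc n} \<le> infsum (\<lambda>(s, w). G [s] * G w) (UNIV \<times> {w. length w = n})"
  proof (rule infsum_ennreal_image_le[where q = "\<lambda>(s, w). s # w"])
    show "{w :: 's list. length w = Suc n} \<subseteq> (\<lambda>(s, w). s # w) ` (UNIV \<times> {w. length w = n})"
      by (auto simp: length_Suc_conv image_iff)
  qed (use G_append[of "[_]"] in auto)
  also have "\<dots> \<le> infsum (\<lambda>s. G [s]) UNIV * infsum G {w. length w = n}"
    by (rule infsum_ennreal_Times_le)
  also have "\<dots> \<le> infsum (\<lambda>s. G [s]) UNIV ^ Suc n" using Suc by (auto intro: mult_left_mono)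
  finally show ?case .
qed

lemma sum_length_finite: "infsum G {w. length w = n} < \<infinity>"
  using order.strict_trans1[OF sum_length] letters by (simp add: power_less_top_ennreal)

lemma wt_length_finite: "infsum wt {w. length w = n} < \<infinity>"
proof -
  have "infsum wt {w. length w = n} \<le> infsum (\<lambda>w. x ^ n * G w) {w. length w = n}"
    by (rule infsum_ennreal_mono) (auto simp: wt_def ac_simps)
  also have "\<dots> \<le> x ^ n * infsum G {w. length w = n}" by (rule infsum_ennreal_cmult_le)
  also have "\<dots> < \<infinity>" using sum_length_finite x by (simp add: ennreal_mult_less_top power_less_top_ennreal)
  finally show ?thesis .
qed

lemma wt_length_less_finite: "infsum wt {w. length w < n} < \<infinity>"
proof (induction n)
  case (Suc n)
  have "{w :: 's list. length w < Suc n} = {w. length w < n} \<union> {w. length w = n}" by auto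
  then have "infsum wt {w. length w < Suc n} \<le> infsum wt {w. length w < n} + infsum wt {w. length w = n}"
    using infsum_ennreal_Un_le by metis
  also have "\<dots> < \<infinity>" using Suc wt_length_finite[of n] by (simp add: ennreal_add_less_top)
  finally show ?case .
qed simp

text \<open>Splitting off the first block, which lies outside \<open>E\<close>, gives
  \<open>s \<le> c + 1 / 2 * s\<close>, hence \<open>s \<le> 2 * c\<close>. The sums are truncated
  by length and bounded inductively, because \<open>s\<close> could be infinite and may not be
  subtracted.\<close>

lemma avoiding_small:
  assumes small: "infsum wt ({u. length u = k} - E) \<le> 1 / 2"
  shows "infsum wt (avoiding E) < \<infinity>"
proof -
  define c where "c = infsum wt {w. length w < k}"
  have step: "infsum wt (avoiding E \<inter> {w. length w < n + k}) 
      \<le> c + 1 / 2 * infsum wt (avoiding E \<inter> {w. length w < n})" for n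
  proof -
    let ?A = "{u. length u = k} - E" and ?B = "avoiding E \<inter> {w. length w < n}"
    have "avoiding E \<inter> {w. length w < n + k}
        \<subseteq> {w. length w < k} \<union> (\<lambda>(u, w). u @ w) ` (?A \<times> ?B)"
    proof
      fix w assume w: "w \<in> avoiding E \<inter> {w. length w < n + k}"
      show "w \<in> {w. length w < k} \<union> (\<lambda>(u, w). u @ w) ` (?A \<times> ?B)"
      proof (cases "length w < k")
        case False
        have "take k w \<in> ?A" using w False by (auto simp: avoiding_def dest: spec[of _ 0])
        have "Adm (drop k w)" using w Adm_append[of "take k w" "drop k w"] by (auto simp: avoiding_def)
        moreover have "take k (drop i (drop k w)) \<notin> E" if "i + k \<le> length (drop k w)" for i
        proof -
          have "\<forall>i. i + k \<le> length w \<longrightarrow> take k (drop i w) \<notin> E" using w by (simp add: avoiding_def)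
          from spec[OF this, of "i + k"] show ?thesis using that False by simp
        qed
        ultimately have "drop k w \<in> avoiding E" unfolding avoiding_def by blast
        then have "(take k w, drop k w) \<in> ?A \<times> ?B" using w False \<open>take k w \<in> ?A\<close> k by (auto simp: less_diff_conv2)
        from imageI[OF this, of "\<lambda>(u, w). u @ w"]
        have "take k w @ drop k w \<in> (\<lambda>(u, w). u @ w) ` (?A \<times> ?B)" by simp
        then show ?thesis by simp
      qed simp
    qed
    then have "infsum wt (avoiding E \<inter> {w. length w < n + k})
        \<le> infsum wt ({w. length w < k} \<union> (\<lambda>(u, w). u @ w) ` (?A \<times> ?B))"
      by (rule infsum_ennreal_mono) simp
    also have "\<dots> \<le> c + infsum wt ((\<lambda>(u, w). u @ w) ` (?A \<times> ?B))"
      unfolding c_def by (rule infsum_ennreal_Un_le)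
    also have "infsum wt ((\<lambda>(u, w). u @ w) ` (?A \<times> ?B)) \<le> infsum (\<lambda>(u, w). wt u * wt w) (?A \<times> ?B)"
      by (rule infsum_ennreal_image_le[OF subset_refl]) (auto intro: wt_append)
    also have "\<dots> \<le> infsum wt ?A * infsum wt ?B" by (rule infsum_ennreal_Times_le)
    also have "\<dots> \<le> 1 / 2 * infsum wt ?B" using small by (rule mult_right_mono) simp
    finally show ?thesis by (simp add: add_left_mono)
  qed
  have "1 / 2 * 2 = 2 / (2 :: ennreal)" by (simp add: ennreal_divide_times)
  also have "\<dots> = 1" by (rule ennreal_divide_self) simp_all
  finally have half: "1 / 2 * 2 = (1 :: ennreal)" .
  have bound: "infsum wt (avoiding E \<inter> {w. length w < n}) \<le> 2 * c" for n
  proof (induction n rule: less_induct)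
    case (less n)
    show ?case
    proof (cases "n \<le> k")
      case True
      have "infsum wt (avoiding E \<inter> {w. length w < n}) \<le> c"
        unfolding c_def using True by (intro infsum_ennreal_mono) auto
      also have "\<dots> \<le> 2 * c" using mult_right_mono[of 1 2 c] by simp
      finally show ?thesis .
    next
      case False
      have "infsum wt (avoiding E \<inter> {w. length w < n}) 
          \<le> c + 1 / 2 * infsum wt (avoiding E \<inter> {w. length w < n - k})"
        using step[of "n - k"] False by simp
      also have "\<dots> \<le> c + 1 / 2 * (2 * c)"
        using less[of "n - k"] k False by (intro add_left_mono mult_left_mono) auto
      also have "\<dots> = 2 * c"
        unfolding mult.assoc[symmetric] half by (simp add: mult_2)
      finally show ?thesis .
    qed
  qed
  have "infsum wt (avoiding E) \<le> 2 * c"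
  proof (rule infsum_ennreal_leI)
    fix F assume F: "finite F" "F \<subseteq> avoiding E"
    define n where "n = Suc (Max (length ` F))"
    have "length w < n" if "w \<in> F" for w
      using that F(1) by (auto simp: n_def less_Suc_eq_le intro: Max_ge)
    then have "sum wt F \<le> infsum wt (avoiding E \<inter> {w. length w < n})"
      using F by (intro sum_le_infsum_ennreal) auto
    then show "sum wt F \<le> 2 * c" using bound order_trans by blast
  qed
  also have "\<dots> < \<infinity>"
    using wt_length_less_finite[of k] unfolding c_def by (simp add: ennreal_mult_less_top)
  finally show ?thesis .
qed

text \<open>A word that meets \<open>v\<close> is cut at the first and at the last occurrence of \<open>v\<close>.\<close>

lemma avoiding_split:
  assumes v: "length v = k" and w: "w \<in> avoiding E" "w \<notin> avoiding (insert v E)"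
  obtains a l b where "w = a @ l @ hd v # b" "a \<in> avoiding (insert v E)" "l \<in> loops v"
    "b \<in> avoiding (insert v E)" "take k (hd v # b) = v"
proof -
  define Occ where "Occ = {i. i + k \<le> length w \<and> take k (drop i w) = v}"
  have fin: "finite Occ" by (rule finite_subset[of _ "{..length w}"]) (auto simp: Occ_def)
  have ne: "Occ \<noteq> {}" using w by (auto simp: Occ_def avoiding_def)
  define i j where "i = Min Occ" and "j = Max Occ"
  have i: "i \<in> Occ" "\<And>p. p \<in> Occ \<Longrightarrow> i \<le> p" using fin ne by (auto simp: i_def)
  have j: "j \<in> Occ" "\<And>p. p \<in> Occ \<Longrightarrow> p \<le> j" using fin ne by (auto simp: j_def)
  have ij: "i \<le> j" using i(2)[OF j(1)] .
  \<comment> \<open>\<open>b\<close> starts one letter after the last occurrence begins: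
    \<open>hd v # b\<close> begins with \<open>v\<close>, while an occurrence inside
    \<open>b\<close> would be a later one. Likewise an occurrence inside \<open>a\<close> would be
    an earlier one.\<close>
  define a l b where "a = take i w" and "l = take (j - i) (drop i w)" and "b = drop (Suc j) w"
  have jl: "j + k \<le> length w" "take k (drop j w) = v" and il: "i + k \<le> length w" "take k (drop i w) = v"
    using i(1) j(1) by (auto simp: Occ_def)
  have hdv: "drop j w = hd v # b"
  proof -
    have "drop j w = w ! j # drop (Suc j) w" using jl k by (intro Cons_nth_drop_Suc[symmetric]) simp
    moreover from this have "hd v = w ! j" using jl(2) k by (cases k) auto
    ultimately show ?thesis by (simp add: b_def)
  qed
  have dl: "drop i w = l @ drop j w" unfolding l_def
    using ij by (metis append_take_drop_id drop_drop le_add_diff_inverse2)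
  have weq: "w = a @ l @ hd v # b" unfolding hdv[symmetric] dl[symmetric] a_def by simp
  have Adm: "Adm w" "\<And>p. p + k \<le> length w \<Longrightarrow> take k (drop p w) \<notin> E" using w(1) by (auto simp: avoiding_def)
  have "Adm a" "Adm (l @ hd v # b)" using Adm_append[of a "l @ hd v # b"] Adm(1) weq by auto
  have "Adm b" using Adm_append[of "a @ l @ [hd v]" b] Adm(1) weq by simp
  have vb: "take k (hd v # b) = v" using jl(2) hdv by simp
  have split: "l @ hd v # b = (l @ v) @ drop k (hd v # b)"
    using vb by (metis append.assoc append_take_drop_id)
  have "Adm (l @ v)" using Adm_append[of "l @ v"] \<open>Adm (l @ hd v # b)\<close> unfolding split by blast
  moreover have "take k (l @ v) = v"
    using il(2) v unfolding dl hdv split by simp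
  ultimately have "l \<in> loops v" by (simp add: loops_def)
  moreover have "a \<in> avoiding (insert v E)"
    unfolding avoiding_def
  proof (intro CollectI conjI allI impI)
    fix p assume p: "p + k \<le> length a"
    then have pi: "p + k \<le> i" "p + k \<le> length w" using il by (auto simp: a_def)
    have eq: "take k (drop p a) = take k (drop p w)"
      using pi by (simp add: a_def drop_take min_def)
    have "p \<notin> Occ" using i(2)[of p] pi k by auto
    then show "take k (drop p a) \<notin> insert v E" unfolding eq using Adm(2)[OF pi(2)] pi by (auto simp: Occ_def)
  qed (use \<open>Adm a\<close> in simp)
  moreover have "b \<in> avoiding (insert v E)"
    unfolding avoiding_def
  proof (intro CollectI conjI allI impI)
    fix p assume p: "p + k \<le> length b"
    then have pj: "p + Suc j + k \<le> length w" using jl k by (auto simp: b_def)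
    have eq: "take k (drop p b) = take k (drop (p + Suc j) w)" by (simp add: b_def)
    have "p + Suc j \<notin> Occ" using j(2)[of "p + Suc j"] by auto
    then show "take k (drop p b) \<notin> insert v E" unfolding eq using Adm(2)[OF pj] pj by (auto simp: Occ_def)
  qed (use \<open>Adm b\<close> in simp)
  ultimately show ?thesis using weq vb by (intro that)
qed

text \<open>Frees one block from the forbidden set: words that meet \<open>v\<close> contribute at
  most the product of the sums over \<open>a\<close>, over the loops and over \<open>b\<close>,
  times the weight of the letter \<open>hd v\<close>.\<close>

lemma avoiding_step:
  assumes v: "length v = k" and fin: "loop_sum v < \<infinity>" "infsum wt (avoiding (insert v E)) < \<infinity>"
  shows "infsum wt (avoiding E) < \<infinity>"
proof -
  let ?A = "avoiding (insert v E)"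
  define P where "P = {(a, l, b). a \<in> ?A \<and> l \<in> loops v \<and> b \<in> ?A \<and> take k (hd v # b) = v}"
  let ?q = "\<lambda>(a, l, b). a @ l @ hd v # b"
  let ?g = "\<lambda>(a, l, b). wt a * (Gl v l * x ^ length l * (wt [hd v] * wt b))"
  have "avoiding E \<subseteq> ?A \<union> ?q ` P"
  proof
    fix w assume w: "w \<in> avoiding E"
    show "w \<in> ?A \<union> ?q ` P"
    proof (cases "w \<in> ?A")
      case False
      obtain a l b where "w = a @ l @ hd v # b" "a \<in> ?A" "l \<in> loops v" "b \<in> ?A" "take k (hd v # b) = v"
        using avoiding_split[OF v w False] .
      then have "w = ?q (a, l, b)" "(a, l, b) \<in> P" by (auto simp: P_def)
      then show ?thesis by blast
    qed simp
  qed
  then have "infsum wt (avoiding E) \<le> infsum wt (?A \<union> ?q ` P)" by (rule infsum_ennreal_mono) simp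
  also have "\<dots> \<le> infsum wt ?A + infsum wt (?q ` P)" by (rule infsum_ennreal_Un_le)
  also have "infsum wt (?q ` P) \<le> infsum ?g P"
  proof (rule infsum_ennreal_image_le[OF subset_refl], clarify)
    fix a l b assume "(a, l, b) \<in> P"
    then have b: "take k (hd v # b) = v" by (simp add: P_def)
    have "wt (a @ l @ hd v # b) \<le> wt a * wt (l @ hd v # b)" by (rule wt_append)
    \<comment> \<open>The loop weight needs the whole block \<open>v\<close> after \<open>l\<close>,
      which \<open>hd v # b\<close> still contains; its first letter is detached only
      afterwards.\<close>
    also have "wt (l @ hd v # b) \<le> Gl v l * x ^ length l * wt (hd v # b)"
      unfolding wt_def using mult_right_mono[OF G_loop[OF v b, of l], of "x ^ (length l + length (hd v # b))"]
      by (simp add: power_add ac_simps)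
    also have "wt (hd v # b) \<le> wt [hd v] * wt b" using wt_append[of "[hd v]" b] by simp
    finally show "wt (a @ l @ hd v # b) \<le> wt a * (Gl v l * x ^ length l * (wt [hd v] * wt b))"
      by (simp add: mult_left_mono)
  qed
  also have "\<dots> \<le> infsum ?g (?A \<times> loops v \<times> ?A)" by (rule infsum_ennreal_mono) (auto simp: P_def)
  also have "\<dots> \<le> infsum wt ?A * infsum (\<lambda>(l, b). Gl v l * x ^ length l * (wt [hd v] * wt b)) (loops v \<times> ?A)"
    using infsum_ennreal_Times_le[of wt "\<lambda>(l, b). Gl v l * x ^ length l * (wt [hd v] * wt b)" ?A "loops v \<times> ?A"]
    by (simp add: case_prod_unfold)
  also have "\<dots> \<le> infsum wt ?A * (loop_sum v * infsum (\<lambda>b. wt [hd v] * wt b) ?A)"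
    unfolding loop_sum_def by (intro mult_left_mono infsum_ennreal_Times_le) simp
  also have "\<dots> \<le> infsum wt ?A * (loop_sum v * (wt [hd v] * infsum wt ?A))"
    by (intro mult_left_mono infsum_ennreal_cmult_le) simp_all
  finally have "infsum wt (avoiding E)
      \<le> infsum wt ?A + infsum wt ?A * (loop_sum v * (wt [hd v] * infsum wt ?A))"
    by (simp add: add_left_mono)
  moreover have "wt [hd v] < \<infinity>"
    using sum_le_infsum_ennreal[of "{[hd v]}" "{w. length w = 1}" wt] wt_length_finite[of 1] by simp
  ultimately show ?thesis
    using fin by (auto simp: ennreal_mult_less_top elim!: order.strict_trans1)
qed

text \<open>All but finitely many blocks have total weight at most one half, so words avoiding the
  exceptional set \<open>E\<close> are summable. The elements of \<open>E\<close> are then freed one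
  at a time, until no block is forbidden.\<close>

theorem sum_finite_if_loops:
  assumes loops: "\<And>v. length v = k \<Longrightarrow> loop_sum v < \<infinity>"
  shows "infsum wt {w. Adm w} < \<infinity>"
proof -
  obtain E where E: "finite E" "E \<subseteq> {u. length u = k}" "infsum wt ({u. length u = k} - E) \<le> 1 / 2"
    using infsum_ennreal_tail[OF wt_length_finite, of "1 / 2" k] by (auto simp: ennreal_zero_less_divide)
  have "E \<subseteq> {u. length u = k} \<Longrightarrow> infsum wt (avoiding E) < \<infinity> \<Longrightarrow> infsum wt (avoiding {}) < \<infinity>"
    using E(1)
  proof (induction E rule: finite_induct)
    case (insert v E)
    then show ?case using avoiding_step[of v E] loops[of v] by simp
  qed simp
  then show ?thesis using avoiding_small[OF E(3)] E(2) by (simp add: avoiding_def)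
qed

end

section \<open>Subadditivity, variations and cylinders\<close>

text \<open>The limit is the infimum of the quotients, which is why each of them bounds it from
  above. The linear lower bound keeps this infimum finite.\<close>

lemma fekete_subadditive:
  fixes a :: "nat \<Rightarrow> real"
  assumes sub: "\<And>m n. 0 < m \<Longrightarrow> 0 < n \<Longrightarrow> a (m + n) \<le> a m + a n"
    and lower: "\<And>n. 0 < n \<Longrightarrow> - c * real n \<le> a n"
  obtains L where "(\<lambda>n. a n / real n) \<longlonglongrightarrow> L" "\<And>n. 0 < n \<Longrightarrow> L \<le> a n / real n"
proof -
  define L where "L = (INF n\<in>{0<..}. a n / real n)"
  have bdd: "bdd_below ((\<lambda>n. a n / real n) ` {0<..})"
    using lower by (intro bdd_belowI2[of _ "- c"]) (auto simp: field_simps)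
  have L: "L \<le> a n / real n" if "0 < n" for n
    unfolding L_def using that by (intro cINF_lower[OF bdd]) auto
  have mult: "a (Suc q * m) \<le> real (Suc q) * a m" if "0 < m" for q m
  proof (induction q)
    case (Suc q)
    have "a (Suc (Suc q) * m) \<le> a m + a (Suc q * m)" using sub[of m "Suc q * m"] that by simp
    then show ?case using Suc by (simp add: algebra_simps)
  qed simp
  have "(\<lambda>n. a n / real n) \<longlonglongrightarrow> L"
  proof (rule LIMSEQ_I)
    fix \<epsilon> :: real assume \<epsilon>: "0 < \<epsilon>"
    have "L < L + \<epsilon> / 2" using \<epsilon> by simp
    then have "\<exists>m\<in>{0<..}. a m / real m < L + \<epsilon> / 2"
      unfolding L_def by (subst (asm) cINF_less_iff[OF _ bdd]) auto
    then obtain m where m: "0 < m" "a m / real m < L + \<epsilon> / 2" by auto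
    define K where "K = (\<Sum>r\<le>m. \<bar>a r\<bar>)"
    have K: "\<bar>a r\<bar> \<le> K" if "r \<le> m" for r
      unfolding K_def using that by (intro member_le_sum) auto
    have K0: "0 \<le> K" unfolding K_def by (intro sum_nonneg) auto
    \<comment> \<open>Division of \<open>n\<close> by \<open>m\<close> with remainder: one
      \<open>K\<close> pays for the remainder, the other for replacing \<open>q * m\<close> by
      \<open>n\<close>.\<close>
    have upper: "a n / real n \<le> a m / real m + 2 * K / real n" if n: "m < n" for n
    proof -
      define q r where "q = n div m" and "r = n mod m"
      have qr: "n = q * m + r" "r < m" "0 < q" using m n by (auto simp: q_def r_def div_greater_zero_iff)
      have qm: "a (q * m) \<le> real q * a m" using mult[OF m(1), of "q - 1"] qr(3) by simp
      have 1: "a n \<le> real q * a m + K"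
      proof (cases "r = 0")
        case True then show ?thesis using qm K0 qr(1) by simp
      next
        case False
        then have "a n \<le> a (q * m) + a r" using sub[of "q * m" r] qr m by simp
        then show ?thesis using qm K[of r] qr(2) by simp
      qed
      have 2: "real q * a m = real n * (a m / real m) - real r / real m * a m"
      proof -
        have "real n - real r = real q * real m" using qr(1) by simp
        then have "real q * a m = (real n - real r) * (a m / real m)" using m(1) by simp
        then show ?thesis by (simp add: left_diff_distrib diff_divide_distrib)
      qed
      have 3: "- (real r / real m * a m) \<le> \<bar>a m\<bar>"
      proof -
        have "real r / real m \<le> 1" "0 \<le> real r / real m" using qr(2) m(1) by auto
        then have "real r / real m * \<bar>a m\<bar> \<le> 1 * \<bar>a m\<bar>" by (intro mult_right_mono) auto
        moreover have "- (real r / real m * a m) \<le> real r / real m * \<bar>a m\<bar>"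
          using \<open>0 \<le> real r / real m\<close> by (metis abs_ge_minus_self abs_mult abs_of_nonneg)
        ultimately show ?thesis by simp
      qed
      have "a n \<le> real n * (a m / real m) + 2 * K" using 1 2 3 K[of m] by linarith
      then show ?thesis using n by (simp add: field_simps)
    qed
    have "(\<lambda>n. 2 * K / real n) \<longlonglongrightarrow> 0" by (rule lim_const_over_n)
    then have "\<forall>\<^sub>F n in sequentially. 2 * K / real n < \<epsilon> / 2" using \<epsilon> by (intro order_tendstoD) auto
    then have "\<forall>\<^sub>F n in sequentially. norm (a n / real n - L) < \<epsilon>"
      using eventually_gt_at_top[of m]
    proof eventually_elim
      case (elim n)
      then show ?case using upper[of n] m L[of n] by simp
    qed
    then show "\<exists>N. \<forall>n\<ge>N. norm (a n / real n - L) < \<epsilon>" by (simp add: eventually_sequentially)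
  qed
  then show ?thesis using L by (rule that)
qed

section \<open>Variations, Birkhoff sums and cylinders\<close>

lemma lip_seminorm_leI:
  assumes "0 < \<theta>" "0 \<le> C"
    and "\<And>n \<omega> \<upsilon>. k \<le> n \<Longrightarrow> \<omega> \<in> X \<Longrightarrow> \<upsilon> \<in> X \<Longrightarrow> \<forall>i<n. \<omega> i = \<upsilon> i \<Longrightarrow> norm (f \<omega> - f \<upsilon>) \<le> C * \<theta> ^ n"
  shows "lip_seminorm X \<theta> k f \<le> ennreal C"
  unfolding lip_seminorm_def
proof (rule SUP_least)
  fix n assume n: "n \<in> {k..}"
  have "var_n X n f \<le> ennreal (C * \<theta> ^ n)"
    unfolding var_n_def using assms n by (intro SUP_least) (auto intro!: ennreal_leI)
  then have "var_n X n f / ennreal (\<theta> ^ n) \<le> ennreal (C * \<theta> ^ n) / ennreal (\<theta> ^ n)"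
    by (rule divide_right_mono_ennreal)
  also have "\<dots> = ennreal C" using assms by (subst divide_ennreal) auto
  finally show "var_n X n f / ennreal (\<theta> ^ n) \<le> ennreal C" .
qed

lemma lip_seminormD:
  assumes "0 < \<theta>" "lip_seminorm X \<theta> k f < \<infinity>"
    and "k \<le> n" "\<omega> \<in> X" "\<upsilon> \<in> X" "\<forall>i<n. \<omega> i = \<upsilon> i"
  shows "norm (f \<omega> - f \<upsilon>) \<le> enn2real (lip_seminorm X \<theta> k f) * \<theta> ^ n"
proof -
  have "ennreal (norm (f \<omega> - f \<upsilon>)) \<le> var_n X n f"
    unfolding var_n_def using assms by (intro SUP_upper2[of "(\<omega>, \<upsilon>)"]) auto
  then have "ennreal (norm (f \<omega> - f \<upsilon>)) / ennreal (\<theta> ^ n) \<le> var_n X n f / ennreal (\<theta> ^ n)"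
    by (rule divide_right_mono_ennreal)
  also have "\<dots> \<le> lip_seminorm X \<theta> k f"
    unfolding lip_seminorm_def using assms(3) by (intro SUP_upper) auto
  also have "\<dots> = ennreal (enn2real (lip_seminorm X \<theta> k f))" using assms(2) by simp
  finally have "norm (f \<omega> - f \<upsilon>) / \<theta> ^ n \<le> enn2real (lip_seminorm X \<theta> k f)"
    using assms(1) by (subst (asm) divide_ennreal) (auto simp: ennreal_le_iff)
  then show ?thesis using assms(1) by (simp add: field_simps)
qed

lemma funpow_lshift: "(lshift ^^ n) \<omega> i = \<omega> (n + i)"
  by (induction n arbitrary: i) (auto simp: lshift_def)

lemma funpow_lshift_path: "\<omega> \<in> path_space E A \<Longrightarrow> (lshift ^^ n) \<omega> \<in> path_space E A"
  by (auto simp: path_space_def funpow_lshift)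

lemma birkhoff_sum_add:
  "birkhoff_sum \<phi> (m + n) \<omega> = birkhoff_sum \<phi> m \<omega> + birkhoff_sum \<phi> n ((lshift ^^ m) \<omega>)"
proof -
  have "birkhoff_sum \<phi> (m + n) \<omega> = birkhoff_sum \<phi> m \<omega> + (\<Sum>i<n. \<phi> ((lshift ^^ (m + i)) \<omega>))"
    unfolding birkhoff_sum_def by (induction n) (auto simp: add.assoc)
  also have "(\<Sum>i<n. \<phi> ((lshift ^^ (m + i)) \<omega>)) = (\<Sum>i<n. \<phi> ((lshift ^^ i) ((lshift ^^ m) \<omega>)))"
    by (intro sum.cong refl arg_cong[where f = \<phi>]) (simp add: fun_eq_iff funpow_lshift add.assoc)
  finally show ?thesis by (simp add: birkhoff_sum_def)
qed

lemma cylinder_append: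
  "\<omega> \<in> cylinder (path_space E A) (u @ w) \<Longrightarrow>
    \<omega> \<in> cylinder (path_space E A) u \<and> (lshift ^^ length u) \<omega> \<in> cylinder (path_space E A) w"
proof -
  assume "\<omega> \<in> cylinder (path_space E A) (u @ w)"
  then have \<omega>: "\<omega> \<in> path_space E A" "\<And>i. i < length u + length w \<Longrightarrow> \<omega> i = (u @ w) ! i"
    by (auto simp: cylinder_def)
  have "\<omega> i = u ! i" if "i < length u" for i using \<omega>(2)[of i] that by (simp add: nth_append)
  moreover have "(lshift ^^ length u) \<omega> i = w ! i" if "i < length w" for i
    using \<omega>(2)[of "length u + i"] that by (simp add: nth_append funpow_lshift)
  ultimately show ?thesis
    using \<omega>(1) funpow_lshift_path[OF \<omega>(1), of "length u"] by (simp add: cylinder_def)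
qed

lemma in_cylinder_prefix: "\<omega> \<in> X \<Longrightarrow> \<omega> \<in> cylinder X (map \<omega> [0..<n])"
  by (simp add: cylinder_def)

lemma in_cylinder_iff: "\<omega> \<in> cylinder X w \<longleftrightarrow> \<omega> \<in> X \<and> map \<omega> [0..<length w] = w"
proof
  assume "\<omega> \<in> cylinder X w"
  then show "\<omega> \<in> X \<and> map \<omega> [0..<length w] = w"
    by (auto simp: cylinder_def intro: nth_equalityI)
next
  assume "\<omega> \<in> X \<and> map \<omega> [0..<length w] = w"
  then show "\<omega> \<in> cylinder X w" using in_cylinder_prefix[of \<omega> X "length w"] by simp
qed

lemma admissible_appendD: "admissible A (u @ w) \<Longrightarrow> admissible A u \<and> admissible A w"
  unfolding admissible_def by (auto simp: successively_append_iff)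

lemma admissible_nth: "admissible A w \<longleftrightarrow> (\<forall>i. Suc i < length w \<longrightarrow> A (w ! i) (w ! Suc i) = 1)"
  unfolding admissible_def by (simp add: successively_conv_nth)

text \<open>Grouping by length compares the series with a geometric one of ratio
  \<open>\<eta> / \<eta>'\<close>.\<close>

lemma infsum_by_length_finite:
  fixes f :: "'a list \<Rightarrow> ennreal"
  assumes le: "\<And>n. infsum f {l \<in> P. length l = n} \<le> ennreal (C * \<eta> ^ n)"
    and \<eta>: "0 < \<eta>" "\<eta> < \<eta>'" and C: "0 \<le> C"
  shows "infsum (\<lambda>l. f l * ennreal (1 / \<eta>') ^ length l) P < \<infinity>"
proof -
  have q: "0 \<le> \<eta> / \<eta>'" "\<eta> / \<eta>' < 1" using \<eta> by auto
  have "infsum (\<lambda>l. f l * ennreal (1 / \<eta>') ^ length l) P \<le> ennreal (C * (1 / (1 - \<eta> / \<eta>')))"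
  proof (rule infsum_ennreal_leI)
    fix F assume F: "finite F" "F \<subseteq> P"
    have "(\<Sum>l\<in>F. f l * ennreal (1 / \<eta>') ^ length l)
        = (\<Sum>n\<in>length ` F. \<Sum>l\<in>{l\<in>F. length l = n}. f l * ennreal (1 / \<eta>') ^ length l)"
      by (rule sum.image_gen[OF F(1)])
    also have "\<dots> \<le> (\<Sum>n\<in>length ` F. ennreal (C * (\<eta> / \<eta>') ^ n))"
    proof (rule sum_mono)
      fix n
      have "(\<Sum>l\<in>{l\<in>F. length l = n}. f l * ennreal (1 / \<eta>') ^ length l)
          = (\<Sum>l\<in>{l\<in>F. length l = n}. f l) * ennreal ((1 / \<eta>') ^ n)"
        using \<eta> by (simp add: sum_distrib_right ennreal_power)
      also have "\<dots> \<le> infsum f {l \<in> P. length l = n} * ennreal ((1 / \<eta>') ^ n)"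
        using F by (intro mult_right_mono sum_le_infsum_ennreal) auto
      also have "\<dots> \<le> ennreal (C * \<eta> ^ n) * ennreal ((1 / \<eta>') ^ n)" by (intro mult_right_mono le) simp
      also have "\<dots> = ennreal (C * (\<eta> / \<eta>') ^ n)"
        using \<eta> C by (subst ennreal_mult[symmetric]) (auto simp: power_divide)
      finally show "(\<Sum>l\<in>{l\<in>F. length l = n}. f l * ennreal (1 / \<eta>') ^ length l) \<le> ennreal (C * (\<eta> / \<eta>') ^ n)" .
    qed
    also have "\<dots> = ennreal (C * (\<Sum>n\<in>length ` F. (\<eta> / \<eta>') ^ n))"
      using C q by (subst sum_ennreal) (auto simp: sum_distrib_left)
    also have "\<dots> \<le> ennreal (C * (1 / (1 - \<eta> / \<eta>')))"
    proof (intro ennreal_leI mult_left_mono C)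
      have "(\<Sum>n\<in>length ` F. (\<eta> / \<eta>') ^ n) \<le> (\<Sum>n. (\<eta> / \<eta>') ^ n)"
        using q F by (intro sum_le_suminf summable_geometric) auto
      also have "\<dots> = 1 / (1 - \<eta> / \<eta>')" using q by (intro suminf_geometric) auto
      finally show "(\<Sum>n\<in>length ` F. (\<eta> / \<eta>') ^ n) \<le> 1 / (1 - \<eta> / \<eta>')" .
    qed
    finally show "(\<Sum>l\<in>F. f l * ennreal (1 / \<eta>') ^ length l) \<le> ennreal (C * (1 / (1 - \<eta> / \<eta>')))" .
  qed
  then show ?thesis using ennreal_less_top order.strict_trans1 by (metis infinity_ennreal_def)
qed

section \<open>Potentials and pressure\<close>

locale markov_potential =
  fixes A :: "'s \<Rightarrow> 's \<Rightarrow> nat" and \<phi> :: "(nat \<Rightarrow> 's) \<Rightarrow> real" and \<theta> :: real and k :: nat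
  assumes \<theta>: "0 < \<theta>" "\<theta> < 1" and k: "0 < k"
    and summable: "summable_potential (full_path_space A) \<phi>"
    and lip: "lip_seminorm (full_path_space A) \<theta> (k + 1) \<phi> < \<infinity>"
begin

abbreviation X :: "(nat \<Rightarrow> 's) set" where "X \<equiv> full_path_space A"

abbreviation S :: "nat \<Rightarrow> (nat \<Rightarrow> 's) \<Rightarrow> real" where "S \<equiv> birkhoff_sum \<phi>"

definition C\<phi> :: real where "C\<phi> = enn2real (lip_seminorm X \<theta> (k + 1) \<phi>)"

definition D :: real where "D = C\<phi> / (1 - \<theta>)"

lemma C\<phi>: "0 \<le> C\<phi>"
  "\<lbrakk>k + 1 \<le> n; \<omega> \<in> X; \<upsilon> \<in> X; \<forall>i<n. \<omega> i = \<upsilon> i\<rbrakk> \<Longrightarrow> \<bar>\<phi> \<omega> - \<phi> \<upsilon>\<bar> \<le> C\<phi> * \<theta> ^ n"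
  unfolding C\<phi>_def using lip_seminormD[OF \<theta>(1) lip] by auto

lemma D_nonneg: "0 \<le> D" unfolding D_def using C\<phi>(1) \<theta> by simp

text \<open>The agreement of the shifted points shrinks by one letter at each step, so the
  variations form a geometric sum; this is the origin of the factor
  \<open>1 / (1 - \<theta>)\<close> in \<open>D\<close>.\<close>

lemma distortion:
  assumes "\<omega> \<in> X" "\<upsilon> \<in> X" "\<forall>i<n + m. \<omega> i = \<upsilon> i" "k \<le> m"
  shows "\<bar>S n \<omega> - S n \<upsilon>\<bar> \<le> D * \<theta> ^ m"
proof -
  have "\<bar>S n \<omega> - S n \<upsilon>\<bar> \<le> (\<Sum>i<n. \<bar>\<phi> ((lshift ^^ i) \<omega>) - \<phi> ((lshift ^^ i) \<upsilon>)\<bar>)"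
    unfolding birkhoff_sum_def sum_subtractf[symmetric] by (rule sum_abs)
  also have "\<dots> \<le> (\<Sum>i<n. C\<phi> * \<theta> ^ m * \<theta> ^ (n - Suc i))"
  proof (rule sum_mono)
    fix i assume i: "i \<in> {..<n}"
    \<comment> \<open>As \<open>i < n\<close>, the shifted points agree on at least
      \<open>m + 1 \<ge> k + 1\<close> letters, the range in which the variation of \<phi> is
      controlled.\<close>
    have "\<bar>\<phi> ((lshift ^^ i) \<omega>) - \<phi> ((lshift ^^ i) \<upsilon>)\<bar> \<le> C\<phi> * \<theta> ^ (n + m - i)"
      using assms i by (intro C\<phi>(2) funpow_lshift_path) (auto simp: funpow_lshift)
    also have "\<dots> \<le> C\<phi> * \<theta> ^ (m + (n - Suc i))"
      using i \<theta> C\<phi>(1) by (intro mult_left_mono power_decreasing) auto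
    finally show "\<bar>\<phi> ((lshift ^^ i) \<omega>) - \<phi> ((lshift ^^ i) \<upsilon>)\<bar> \<le> C\<phi> * \<theta> ^ m * \<theta> ^ (n - Suc i)"
      by (simp add: power_add mult.assoc)
  qed
  also have "\<dots> = C\<phi> * \<theta> ^ m * (\<Sum>i<n. \<theta> ^ i)"
    unfolding sum_distrib_left[symmetric] using sum.nat_diff_reindex[of "\<lambda>i. \<theta> ^ i" n] by simp
  also have "\<dots> \<le> C\<phi> * \<theta> ^ m * (1 / (1 - \<theta>))"
  proof (rule mult_left_mono)
    have "(\<Sum>i<n. \<theta> ^ i) \<le> (\<Sum>i. \<theta> ^ i)" using \<theta> by (intro sum_le_suminf summable_geometric) auto
    then show "(\<Sum>i<n. \<theta> ^ i) \<le> 1 / (1 - \<theta>)" using \<theta> by (simp add: suminf_geometric)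
  qed (use C\<phi>(1) \<theta> in auto)
  finally show ?thesis by (simp add: D_def)
qed

lemma distortion_D:
  assumes "\<omega> \<in> X" "\<upsilon> \<in> X" "\<forall>i<n + k. \<omega> i = \<upsilon> i"
  shows "S n \<omega> \<le> D + S n \<upsilon>"
proof -
  have "D * \<theta> ^ k \<le> D * 1" using D_nonneg \<theta> by (intro mult_left_mono power_le_one) auto
  then show ?thesis using distortion[OF assms order_refl] by simp
qed

text \<open>The word \<open>w\<close> may be longer than \<open>n\<close>: only if it is longer by at least \<open>k\<close> is the variation
  of \<open>S n\<close> on its cylinder bounded.\<close>

definition weight :: "nat \<Rightarrow> 's list \<Rightarrow> ennreal" where
  "weight n w = (SUP \<omega>\<in>cylinder X w. ennreal (exp (S n \<omega>)))"

abbreviation G :: "'s list \<Rightarrow> ennreal" where "G w \<equiv> weight (length w) w"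

lemma weight_upper: "\<omega> \<in> cylinder X w \<Longrightarrow> ennreal (exp (S n \<omega>)) \<le> weight n w"
  unfolding weight_def by (rule SUP_upper)

lemma weight_least: "(\<And>\<omega>. \<omega> \<in> cylinder X w \<Longrightarrow> ennreal (exp (S n \<omega>)) \<le> c) \<Longrightarrow> weight n w \<le> c"
  unfolding weight_def by (rule SUP_least)

lemma weight_mult:
  assumes "\<And>\<omega>. \<omega> \<in> cylinder X w \<Longrightarrow> \<omega> \<in> cylinder X u \<and> (lshift ^^ m) \<omega> \<in> cylinder X v"
  shows "weight (m + n) w \<le> weight m u * weight n v"
proof (rule weight_least)
  fix \<omega> assume "\<omega> \<in> cylinder X w"
  then have "ennreal (exp (S m \<omega>)) * ennreal (exp (S n ((lshift ^^ m) \<omega>))) \<le> weight m u * weight n v"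
    using assms by (intro mult_mono weight_upper) auto
  then show "ennreal (exp (S (m + n) \<omega>)) \<le> weight m u * weight n v"
    by (simp add: birkhoff_sum_add exp_add ennreal_mult)
qed

lemma weight_le_exp:
  assumes "\<omega> \<in> cylinder X w" "n + k \<le> length w"
  shows "weight n w \<le> ennreal (exp D * exp (S n \<omega>))"
proof (rule weight_least)
  fix \<upsilon> assume "\<upsilon> \<in> cylinder X w"
  then have "S n \<upsilon> \<le> D + S n \<omega>"
    using assms by (intro distortion_D) (auto simp: cylinder_def)
  then show "ennreal (exp (S n \<upsilon>)) \<le> ennreal (exp D * exp (S n \<omega>))"
    by (intro ennreal_leI) (simp add: exp_add[symmetric])
qed

lemma letters_finite: "infsum (\<lambda>s. G [s]) UNIV < \<infinity>"
proof -
  define g where "g s = exp (SUP \<omega>\<in>cylinder X [s]. \<phi> \<omega>)" for s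
  have bdd: "bdd_above (\<phi> ` cylinder X [s])" for s
    using summable unfolding summable_potential_def by auto
  have sm: "g summable_on {s. cylinder X [s] \<noteq> {}}"
    using summable unfolding summable_potential_def g_def by auto
  have "infsum (\<lambda>s. G [s]) UNIV \<le> infsum (\<lambda>s. ennreal (g s)) {s. cylinder X [s] \<noteq> {}}"
  proof (rule infsum_ennreal_leI)
    fix F :: "'s set" assume F: "finite F"
    \<comment> \<open>For an empty cylinder the weight is 0, the least extended real, whereas the
      real supremum in \<open>g\<close> has no meaning there.\<close>
    have "(\<Sum>s\<in>F. G [s]) = (\<Sum>s\<in>F \<inter> {s. cylinder X [s] \<noteq> {}}. G [s])"
      by (rule sum.mono_neutral_right[OF F]) (auto simp: weight_def bot_ennreal)
    also have "\<dots> \<le> (\<Sum>s\<in>F \<inter> {s. cylinder X [s] \<noteq> {}}. ennreal (g s))"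
    proof (intro sum_mono weight_least)
      fix s \<omega> assume "\<omega> \<in> cylinder X [s]"
      then have "\<phi> \<omega> \<le> (SUP \<omega>\<in>cylinder X [s]. \<phi> \<omega>)" by (intro cSUP_upper bdd)
      then show "ennreal (exp (S (length [s]) \<omega>)) \<le> ennreal (g s)"
        by (simp add: g_def birkhoff_sum_def ennreal_leI)
    qed
    also have "\<dots> \<le> infsum (\<lambda>s. ennreal (g s)) {s. cylinder X [s] \<noteq> {}}"
      using F by (intro sum_le_infsum_ennreal) auto
    finally show "(\<Sum>s\<in>F. G [s]) \<le> infsum (\<lambda>s. ennreal (g s)) {s. cylinder X [s] \<noteq> {}}" .
  qed
  also have "\<dots> = ennreal (infsum g {s. cylinder X [s] \<noteq> {}})"
    using sm by (rule infsum_ennreal_of_real[rotated]) (simp add: g_def)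
  finally show ?thesis by (simp add: order.strict_trans1)
qed

lemma path_weights:
  assumes "x < \<infinity>"
  shows "path_weights (admissible M) G (\<lambda>v l. weight (length l) (l @ v)) k x"
proof
  show "admissible M (u @ w) \<Longrightarrow> admissible M u \<and> admissible M w" for u w
    by (rule admissible_appendD)
  show "G (u @ w) \<le> G u * G w" for u w
    using weight_mult[of "u @ w" u "length u" w "length w"] cylinder_append[of _ UNIV A u w] by simp
  show "G (l @ b) \<le> weight (length l) (l @ v) * G b" if "length v = k" "take k b = v" for v l b
  proof -
    have "l @ b = (l @ v) @ drop k b" using that by (metis append.assoc append_take_drop_id)
    then have "weight (length l + length b) (l @ b) \<le> weight (length l) (l @ v) * weight (length b) b"
      using cylinder_append[of _ UNIV A l b] cylinder_append[of _ UNIV A "l @ v" "drop k b"]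
      by (intro weight_mult) auto
    then show ?thesis by simp
  qed
  show "G [] \<le> 1" by (rule weight_least) (simp add: birkhoff_sum_def)
qed (use k assms letters_finite in auto)

lemma sum_G_finite: "infsum G {w. length w = n} < \<infinity>"
  by (rule path_weights.sum_length_finite[OF path_weights[of 0]]) simp

lemma G_finite: "G w < \<infinity>"
  using sum_le_infsum_ennreal[of "{w}" "{u. length u = length w}" G] sum_G_finite[of "length w"]
  by (simp add: order.strict_trans1)

definition Gr :: "'s list \<Rightarrow> real" where "Gr w = enn2real (G w)"

lemma Gr: "ennreal (Gr w) = G w" "0 \<le> Gr w"
  unfolding Gr_def using G_finite[of w] by auto

lemma exp_le_Gr: "\<omega> \<in> cylinder X w \<Longrightarrow> exp (S (length w) \<omega>) \<le> Gr w"
  using weight_upper[of \<omega> w "length w"] Gr[of w] by (metis ennreal_le_iff)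

lemma Gr_summable: "W \<subseteq> {w. length w = n} \<Longrightarrow> Gr summable_on W"
  using infsum_ennreal_real(1)[of W Gr] infsum_ennreal_mono[of W "{w. length w = n}" G G] sum_G_finite[of n]
  by (simp add: Gr order.strict_trans1)

end

section \<open>Partition sums and pressure of the subsystem\<close>

locale markov_subsystem = markov_potential A \<phi> \<theta> k
  for A :: "'s \<Rightarrow> 's \<Rightarrow> nat" and \<phi> \<theta> k +
  fixes M :: "'s \<Rightarrow> 's \<Rightarrow> nat" and S0 :: "'s set"
  assumes M_A: "\<And>i j. M i j = 1 \<Longrightarrow> A i j = 1"
    and M_S0: "\<And>i j. M i j = 1 \<Longrightarrow> i \<in> S0 \<and> j \<in> S0"
    and periodic: "has_periodic_point (path_space S0 M)"
begin

abbreviation XM :: "(nat \<Rightarrow> 's) set" where "XM \<equiv> path_space S0 M"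

lemma XM_subset: "XM \<subseteq> X" using M_A by (auto simp: path_space_def)

definition Zset :: "nat \<Rightarrow> 's list set" where
  "Zset n = {w. length w = n \<and> set w \<subseteq> S0 \<and> cylinder X w \<inter> XM \<noteq> {}}"

definition v :: "nat \<Rightarrow> 's list \<Rightarrow> real" where
  "v n w = exp (SUP \<omega>\<in>cylinder X w \<inter> XM. S n \<omega>)"

definition Z :: "nat \<Rightarrow> real" where "Z n = infsum (v n) (Zset n)"

lemma v_pos: "0 < v n w" by (simp add: v_def)

lemma v_upper:
  assumes "\<omega> \<in> cylinder X w" "\<omega> \<in> XM" "length w = n"
  shows "exp (S n \<omega>) \<le> v n w"
proof -
  \<comment> \<open>The supremum in \<open>v\<close> is a real one and needs a bound, namely the
    logarithm of the finite cylinder weight.\<close>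
  have "bdd_above (S n ` (cylinder X w \<inter> XM))"
  proof (rule bdd_aboveI2)
    fix \<upsilon> assume "\<upsilon> \<in> cylinder X w \<inter> XM"
    then have le: "exp (S n \<upsilon>) \<le> Gr w" using exp_le_Gr[of \<upsilon> w] assms(3) by simp
    moreover have "0 < Gr w" using le exp_gt_zero order.strict_trans2 by blast
    ultimately show "S n \<upsilon> \<le> ln (Gr w)" by (simp add: ln_ge_iff)
  qed
  then show ?thesis unfolding v_def using assms by (auto intro!: cSUP_upper)
qed

lemma v_least:
  assumes "w \<in> Zset n" "\<And>\<omega>. \<omega> \<in> cylinder X w \<Longrightarrow> \<omega> \<in> XM \<Longrightarrow> exp (S n \<omega>) \<le> c"
  shows "v n w \<le> c"
proof -
  have ne: "cylinder X w \<inter> XM \<noteq> {}" using assms(1) by (simp add: Zset_def)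
  then have c: "0 < c" using assms(2) exp_gt_zero order.strict_trans2 by blast
  have "(SUP \<omega>\<in>cylinder X w \<inter> XM. S n \<omega>) \<le> ln c"
    using assms(2) c by (intro cSUP_least[OF ne]) (auto simp: ln_ge_iff)
  then show ?thesis unfolding v_def using c by (metis exp_le_cancel_iff exp_ln)
qed

lemma Zset_admissible: "w \<in> Zset n \<Longrightarrow> admissible M w"
proof -
  assume w: "w \<in> Zset n"
  then obtain \<omega> where \<omega>: "\<omega> \<in> XM" "\<forall>i<length w. \<omega> i = w ! i" by (auto simp: Zset_def cylinder_def)
  show ?thesis
    unfolding admissible_nth
  proof (intro allI impI)
    fix i assume "Suc i < length w"
    then have "w ! i = \<omega> i" "w ! Suc i = \<omega> (Suc i)" using \<omega>(2) by auto
    then show "M (w ! i) (w ! Suc i) = 1" using \<omega>(1) by (simp add: path_space_def)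
  qed
qed

lemma v_le_Gr: "w \<in> Zset n \<Longrightarrow> v n w \<le> Gr w"
  using exp_le_Gr by (intro v_least) (auto simp: Zset_def)

lemma sum_v_finite: "infsum (\<lambda>w. ennreal (v n w)) (Zset n) < \<infinity>"
proof -
  have "infsum (\<lambda>w. ennreal (v n w)) (Zset n) \<le> infsum G {w. length w = n}"
  proof (rule infsum_ennreal_mono)
    show "ennreal (v n w) \<le> G w" if "w \<in> Zset n" for w
      unfolding Gr(1)[symmetric] by (rule ennreal_leI[OF v_le_Gr[OF that]])
  qed (auto simp: Zset_def)
  then show ?thesis using sum_G_finite[of n] by (simp add: order.strict_trans1)
qed

lemma Z: "infsum (\<lambda>w. ennreal (v n w)) (Zset n) = ennreal (Z n)"
  unfolding Z_def by (rule infsum_ennreal_real(2)) (use v_pos sum_v_finite in \<open>auto intro: less_imp_le\<close>)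

lemma Z_nonneg: "0 \<le> Z n" unfolding Z_def by (intro infsum_nonneg less_imp_le v_pos)

lemma v_append:
  assumes "u @ w \<in> Zset (m + n)" "length u = m" "length w = n"
  shows "u \<in> Zset m" "w \<in> Zset n" "v (m + n) (u @ w) \<le> v m u * v n w"
proof -
  have sh: "\<omega> \<in> cylinder X u \<inter> XM" "(lshift ^^ m) \<omega> \<in> cylinder X w \<inter> XM"
    if "\<omega> \<in> cylinder X (u @ w)" "\<omega> \<in> XM" for \<omega>
    using cylinder_append[OF that(1)] funpow_lshift_path[OF that(2), of m] that(2) assms(2) by auto
  show "u \<in> Zset m" "w \<in> Zset n" using assms sh by (fastforce simp: Zset_def)+
  show "v (m + n) (u @ w) \<le> v m u * v n w"
  proof (rule v_least[OF assms(1)])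
    fix \<omega> assume "\<omega> \<in> cylinder X (u @ w)" "\<omega> \<in> XM"
    then have "exp (S m \<omega>) * exp (S n ((lshift ^^ m) \<omega>)) \<le> v m u * v n w"
      using sh assms by (intro mult_mono v_upper) (auto simp: v_def)
    then show "exp (S (m + n) \<omega>) \<le> v m u * v n w" by (simp add: birkhoff_sum_add exp_add)
  qed
qed

lemma Z_submult: "Z (m + n) \<le> Z m * Z n"
proof -
  have "ennreal (Z (m + n)) \<le> infsum (\<lambda>(u, w). ennreal (v m u) * ennreal (v n w)) (Zset m \<times> Zset n)"
    unfolding Z[symmetric]
  proof (rule order_trans[OF infsum_ennreal_image_le[where q = "\<lambda>(u, w). u @ w"
          and P = "{(u, w). u @ w \<in> Zset (m + n) \<and> length u = m \<and> length w = n}"]])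
    show "Zset (m + n) \<subseteq> (\<lambda>(u, w). u @ w) ` {(u, w). u @ w \<in> Zset (m + n) \<and> length u = m \<and> length w = n}"
    proof
      fix w assume w: "w \<in> Zset (m + n)"
      then have "length w = m + n" by (simp add: Zset_def)
      then have "(take m w, drop m w) \<in> {(u, w). u @ w \<in> Zset (m + n) \<and> length u = m \<and> length w = n}"
        using w by simp
      from imageI[OF this, of "\<lambda>(u, w). u @ w"]
      show "w \<in> (\<lambda>(u, w). u @ w) ` {(u, w). u @ w \<in> Zset (m + n) \<and> length u = m \<and> length w = n}" by simp
    qed
  next
    fix p assume "p \<in> {(u, w). u @ w \<in> Zset (m + n) \<and> length u = m \<and> length w = n}"
    then show "ennreal (v (m + n) (case p of (u, w) \<Rightarrow> u @ w)) \<le> (\<lambda>(u, w). ennreal (v m u) * ennreal (v n w)) p"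
    proof (cases p)
      case (Pair u w)
      then have "v (m + n) (u @ w) \<le> v m u * v n w"
        using \<open>p \<in> _\<close> by (intro v_append(3)) auto
      then have "ennreal (v (m + n) (u @ w)) \<le> ennreal (v m u) * ennreal (v n w)"
        unfolding ennreal_mult[OF less_imp_le[OF v_pos] less_imp_le[OF v_pos], symmetric] by (rule ennreal_leI)
      then show ?thesis using Pair by simp
    qed
  next
    show "infsum (\<lambda>(u, w). ennreal (v m u) * ennreal (v n w))
        {(u, w). u @ w \<in> Zset (m + n) \<and> length u = m \<and> length w = n}
      \<le> infsum (\<lambda>(u, w). ennreal (v m u) * ennreal (v n w)) (Zset m \<times> Zset n)"
    proof (rule infsum_ennreal_mono, safe)
      fix u w :: "'s list"
      assume uw: "u @ w \<in> Zset (length u + length w)"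
      show "u \<in> Zset (length u)" "w \<in> Zset (length w)" by (rule v_append[OF uw refl refl])+
    qed
  qed
  also have "\<dots> \<le> ennreal (Z m) * ennreal (Z n)"
    unfolding Z[symmetric] by (rule infsum_ennreal_Times_le)
  finally show ?thesis using Z_nonneg by (simp add: ennreal_mult[symmetric])
qed

text \<open>Along a periodic orbit \<phi> takes finitely many values, so Birkhoff sums decrease at
  most linearly. This keeps the pressure above minus infinity.\<close>

lemma Z_lower: "\<exists>c. \<forall>n. exp (- c * real n) \<le> Z n"
proof -
  obtain \<omega> p where \<omega>: "\<omega> \<in> XM" "1 \<le> p" "(lshift ^^ p) \<omega> = \<omega>"
    using periodic by (auto simp: has_periodic_point_def)
  define c where "c = (\<Sum>i<p. \<bar>\<phi> ((lshift ^^ i) \<omega>)\<bar>)"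
  have per: "(lshift ^^ i) \<omega> = (lshift ^^ (i mod p)) \<omega>" for i
    by (rule funpow_mod_eq[symmetric]) (rule \<omega>(3))
  have "\<bar>\<phi> ((lshift ^^ i) \<omega>)\<bar> \<le> c" for i
    unfolding c_def using \<omega>(2) by (subst per) (intro member_le_sum, auto)
  then have "- c \<le> \<phi> ((lshift ^^ i) \<omega>)" for i by (smt (verit))
  then have "(\<Sum>i<n. - c) \<le> S n \<omega>" for n unfolding birkhoff_sum_def by (intro sum_mono) auto
  then have low: "- c * real n \<le> S n \<omega>" for n by (simp add: mult.commute)
  have "exp (- c * real n) \<le> Z n" for n
  proof -
    define w where "w = map \<omega> [0..<n]"
    have cyl: "\<omega> \<in> cylinder X w" unfolding w_def using \<omega>(1) XM_subset by (intro in_cylinder_prefix) auto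
    have w: "w \<in> Zset n" using cyl \<omega>(1) unfolding Zset_def by (auto simp: w_def path_space_def)
    have "ennreal (v n w) \<le> ennreal (Z n)"
      unfolding Z[symmetric] using sum_le_infsum_ennreal[of "{w}" "Zset n" "\<lambda>w. ennreal (v n w)"] w by simp
    then have "v n w \<le> Z n" using Z_nonneg by simp
    moreover have "exp (S n \<omega>) \<le> v n w" using cyl \<omega>(1) by (rule v_upper) (simp add: w_def)
    ultimately show ?thesis using low[of n] by (meson exp_le_cancel_iff order_trans)
  qed
  then show ?thesis by blast
qed

definition \<Lambda> :: real where "\<Lambda> = exp (pressure X S0 XM \<phi>)"

text \<open>Fekete's lemma shows that \<open>lim\<close> denotes a genuine limit and that it is an
  infimum; the second claim is the resulting inequality for each single \<open>n\<close>.\<close>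

lemma pressure_limit:
  "(\<lambda>n. ln (Z n) / real n) \<longlonglongrightarrow> pressure X S0 XM \<phi>"
  "0 < n \<Longrightarrow> \<Lambda> ^ n \<le> Z n"
proof -
  obtain c where c: "\<And>n. exp (- c * real n) \<le> Z n" using Z_lower by blast
  have Zpos: "0 < Z n" for n using c[of n] exp_gt_zero order.strict_trans2 by blast
  obtain L where L: "(\<lambda>n. ln (Z n) / real n) \<longlonglongrightarrow> L" "\<And>n. 0 < n \<Longrightarrow> L \<le> ln (Z n) / real n"
  proof (rule fekete_subadditive[of "\<lambda>n. ln (Z n)" c])
    show "ln (Z (m + n)) \<le> ln (Z m) + ln (Z n)" for m n
      using Z_submult[of m n] Zpos by (metis ln_le_cancel_iff ln_mult_pos mult_pos_pos)
    show "- c * real n \<le> ln (Z n)" for n using c[of n] Zpos[of n] by (simp add: ln_ge_iff)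
  qed blast
  have eq: "pressure X S0 XM \<phi> = lim (\<lambda>n. ln (Z n) / real n)"
    unfolding pressure_def Z_def v_def Zset_def by simp
  then have P: "pressure X S0 XM \<phi> = L" using limI[OF L(1)] by simp
  then show "(\<lambda>n. ln (Z n) / real n) \<longlonglongrightarrow> pressure X S0 XM \<phi>" using L(1) by simp
  show "\<Lambda> ^ n \<le> Z n" if "0 < n"
  proof -
    have "real n * L \<le> ln (Z n)" using L(2)[OF that] that by (simp add: field_simps)
    then have "exp (real n * L) \<le> Z n" using Zpos[of n] by (simp add: ln_ge_iff)
    then show ?thesis unfolding \<Lambda>_def P by (simp add: exp_of_nat_mult)
  qed
qed

lemma \<Lambda>_pos: "0 < \<Lambda>" by (simp add: \<Lambda>_def)

lemma bounded_by_power: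
  fixes f :: "nat \<Rightarrow> real"
  assumes "\<forall>\<^sub>F n in sequentially. f n \<le> K * \<eta> ^ n" "0 < \<eta>" "0 \<le> K"
  shows "\<exists>C\<ge>0. \<forall>n. f n \<le> C * \<eta> ^ n"
proof -
  obtain n0 where n0: "\<And>n. n0 \<le> n \<Longrightarrow> f n \<le> K * \<eta> ^ n" using assms(1) by (auto simp: eventually_sequentially)
  define C where "C = K + (\<Sum>n<n0. \<bar>f n\<bar> / \<eta> ^ n)"
  have s0: "0 \<le> (\<Sum>n<n0. \<bar>f n\<bar> / \<eta> ^ n)" using assms(2) by (intro sum_nonneg) auto
  have "f n \<le> C * \<eta> ^ n" for n
  proof (cases "n0 \<le> n")
    case True
    have "K * \<eta> ^ n \<le> C * \<eta> ^ n" unfolding C_def using s0 assms(2) by (intro mult_right_mono) auto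
    then show ?thesis using n0[OF True] by simp
  next
    case False
    have "\<bar>f n\<bar> / \<eta> ^ n \<le> (\<Sum>n<n0. \<bar>f n\<bar> / \<eta> ^ n)"
      using False assms(2) by (intro member_le_sum) auto
    then have "\<bar>f n\<bar> / \<eta> ^ n \<le> C" unfolding C_def using assms(3) by simp
    then have "\<bar>f n\<bar> \<le> C * \<eta> ^ n" using assms(2) by (simp add: field_simps)
    then show ?thesis by simp
  qed
  moreover have "0 \<le> C" unfolding C_def using s0 assms(3) by simp
  ultimately show ?thesis by blast
qed

lemma Z_upper:
  assumes "\<Lambda> < \<eta>"
  shows "\<exists>C\<ge>0. \<forall>n. Z n \<le> C * \<eta> ^ n"
proof (rule bounded_by_power[where K = 1])
  obtain c where c: "\<And>n. exp (- c * real n) \<le> Z n" using Z_lower by blast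
  have Zpos: "0 < Z n" for n using c[of n] exp_gt_zero order.strict_trans2 by blast
  have \<eta>: "0 < \<eta>" using assms \<Lambda>_pos by simp
  have "pressure X S0 XM \<phi> < ln \<eta>" using assms \<eta> unfolding \<Lambda>_def by (metis exp_gt_zero ln_exp ln_less_cancel_iff)
  then have "\<forall>\<^sub>F n in sequentially. ln (Z n) / real n < ln \<eta>"
    using pressure_limit(1) by (intro order_tendstoD(2))
  then show "\<forall>\<^sub>F n in sequentially. Z n \<le> 1 * \<eta> ^ n"
    using eventually_gt_at_top[of 0]
  proof eventually_elim
    case (elim n)
    then have "ln (Z n) \<le> ln (\<eta> ^ n)" using \<eta> by (simp add: field_simps ln_realpow)
    then show ?case using Zpos[of n] \<eta> by simp
  qed
qed (use assms \<Lambda>_pos in auto)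

section \<open>Loops at a block and the growth of all admissible words\<close>

definition loop_set :: "'s list \<Rightarrow> 's list set" where
  "loop_set u = {l. admissible M (l @ u) \<and> take k (l @ u) = u}"

text \<open>The point is \<open>l l l \<dots>\<close>.\<close>

lemma loop_periodic_point:
  assumes l: "l \<in> loop_set u" "length u = k" "l \<noteq> []"
  shows "\<exists>\<omega>\<in>XM. \<omega> \<in> cylinder X (l @ u)"
proof -
  define \<omega> where "\<omega> i = l ! (i mod length l)" for i
  have adm: "admissible M (l @ u)" and tk: "take k (l @ u) = u" using l(1) by (auto simp: loop_set_def)
  have n: "0 < length l" using l(3) by simp
  \<comment> \<open>Beyond \<open>l\<close> the letters of \<open>u\<close> repeat those at distance
    \<open>length l\<close> before them, because \<open>l @ u\<close> begins with \<open>u\<close>.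
    The induction is strong since \<open>u\<close> may cover several periods.\<close>
  have \<omega>: "(l @ u) ! i = \<omega> i" if "i < length l + k" for i
    using that
  proof (induction i rule: less_induct)
    case (less i)
    show ?case
    proof (cases "i < length l")
      case True then show ?thesis by (simp add: nth_append \<omega>_def)
    next
      case False
      have "(l @ u) ! i = u ! (i - length l)" using False by (simp add: nth_append)
      also have "\<dots> = take k (l @ u) ! (i - length l)" unfolding tk ..
      also have "\<dots> = (l @ u) ! (i - length l)" using less.prems False by (intro nth_take) simp
      also have "\<dots> = \<omega> (i - length l)"
      proof (rule less.IH)
        show "i - length l < i" using n False by (intro diff_less) linarith+
      qed (use less.prems in simp)
      also have "\<dots> = \<omega> i" unfolding \<omega>_def using False by (simp add: le_mod_geq)
      finally show ?thesis .
    qed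
  qed
  have step: "M (\<omega> i) (\<omega> (Suc i)) = 1" for i
  proof -
    define j where "j = i mod length l"
    have j: "j < length l" using n by (simp add: j_def)
    have "M ((l @ u) ! j) ((l @ u) ! Suc j) = 1"
      using adm j l(2) k unfolding admissible_nth by simp
    moreover have "(l @ u) ! j = \<omega> j" "(l @ u) ! Suc j = \<omega> (Suc j)" using j k by (auto intro!: \<omega>)
    moreover have "\<omega> j = \<omega> i" "\<omega> (Suc j) = \<omega> (Suc i)" unfolding \<omega>_def j_def by (simp_all add: mod_Suc_eq)
    ultimately show ?thesis by simp
  qed
  then have "\<omega> \<in> XM" using M_S0 by (auto simp: path_space_def)
  moreover have "\<omega> \<in> cylinder X (l @ u)"
    using \<omega> \<open>\<omega> \<in> XM\<close> XM_subset l(2) by (auto simp: cylinder_def)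
  ultimately show ?thesis by blast
qed

text \<open>The periodic point lies in the subsystem and in the cylinder of \<open>l @ u\<close>. It
  therefore puts \<open>l\<close> into \<open>Zset n\<close> and realises the weight up to the
  factor \<open>exp D\<close>.\<close>

lemma loops_le_Z:
  assumes u: "length u = k" and n: "0 < n"
  shows "infsum (\<lambda>l. weight (length l) (l @ u)) {l \<in> loop_set u. length l = n} \<le> ennreal (exp D * Z n)"
proof -
  have "infsum (\<lambda>l. weight (length l) (l @ u)) {l \<in> loop_set u. length l = n}
      \<le> infsum (\<lambda>l. ennreal (exp D) * ennreal (v n l)) (Zset n)"
  proof (rule infsum_ennreal_mono)
    have wit: "\<exists>\<omega>\<in>XM. \<omega> \<in> cylinder X (l @ u)" if "l \<in> loop_set u" "length l = n" for l
      using loop_periodic_point[OF that(1) u] n that(2) by auto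
    show sub: "{l \<in> loop_set u. length l = n} \<subseteq> Zset n"
    proof clarify
      fix l assume l: "l \<in> loop_set u" "n = length l"
      obtain \<omega> where \<omega>: "\<omega> \<in> XM" "\<omega> \<in> cylinder X (l @ u)" using wit l by blast
      have c: "\<omega> \<in> cylinder X l" using cylinder_append[OF \<omega>(2)] by simp
      then have "set l \<subseteq> S0" using \<omega>(1) by (auto simp: cylinder_def path_space_def set_conv_nth) metis
      then show "l \<in> Zset (length l)" using c \<omega>(1) by (auto simp: Zset_def)
    qed
    fix l assume l: "l \<in> {l \<in> loop_set u. length l = n}"
    obtain \<omega> where \<omega>: "\<omega> \<in> XM" "\<omega> \<in> cylinder X (l @ u)" using wit l by blast
    have "weight (length l) (l @ u) \<le> ennreal (exp D * exp (S (length l) \<omega>))"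
      using \<omega>(2) u by (intro weight_le_exp) auto
    also have "\<dots> \<le> ennreal (exp D * v n l)"
      using \<omega> l cylinder_append[OF \<omega>(2)] by (intro ennreal_leI mult_left_mono) (auto intro!: v_upper)
    finally show "weight (length l) (l @ u) \<le> ennreal (exp D) * ennreal (v n l)"
      using v_pos by (simp add: ennreal_mult less_imp_le)
  qed
  also have "\<dots> \<le> ennreal (exp D) * infsum (\<lambda>l. ennreal (v n l)) (Zset n)" by (rule infsum_ennreal_cmult_le)
  finally show ?thesis unfolding Z by (simp add: ennreal_mult Z_nonneg)
qed

text \<open>The summand 1 covers length 0, where at most the empty loop occurs.\<close>

lemma loops_le:
  assumes u: "length u = k"
  shows "infsum (\<lambda>l. weight (length l) (l @ u)) {l \<in> loop_set u. length l = n} \<le> ennreal (1 + exp D * Z n)"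
proof (cases "n = 0")
  case True
  have "infsum (\<lambda>l. weight (length l) (l @ u)) {l \<in> loop_set u. length l = n} \<le> infsum (\<lambda>l. 1) {[] :: 's list}"
    using True by (intro infsum_ennreal_mono) (auto intro!: weight_least simp: birkhoff_sum_def)
  also have "\<dots> \<le> ennreal (1 + exp D * Z n)" using Z_nonneg by simp
  finally show ?thesis .
next
  case False
  then have "infsum (\<lambda>l. weight (length l) (l @ u)) {l \<in> loop_set u. length l = n} \<le> ennreal (exp D * Z n)"
    using loops_le_Z[OF u] by simp
  also have "\<dots> \<le> ennreal (1 + exp D * Z n)" by (intro ennreal_leI) simp
  finally show ?thesis .
qed

lemma loop_sum_eq:
  assumes "x < \<infinity>"
  shows "path_weights.loop_sum (admissible M) (\<lambda>v l. weight (length l) (l @ v)) k x u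
    = infsum (\<lambda>l. weight (length l) (l @ u) * x ^ length l) (loop_set u)"
  unfolding path_weights.loop_sum_def[OF path_weights[OF assms]]
    path_weights.loops_def[OF path_weights[OF assms]] loop_set_def ..

text \<open>The words of length \<open>n\<close> form one piece of a generating function that is
  finite at \<open>1 / \<eta>\<close>; its total value is the constant \<open>c\<close>.\<close>

lemma sum_wt_finite:
  assumes \<eta>: "0 < \<eta>"
    and "\<And>u. length u = k \<Longrightarrow>
      infsum (\<lambda>l. weight (length l) (l @ u) * ennreal (1 / \<eta>) ^ length l) (loop_set u) < \<infinity>"
  shows "\<exists>c\<ge>0. \<forall>n. infsum G {w. admissible M w \<and> length w = n} \<le> ennreal (c * \<eta> ^ n)"
proof -
  have x: "ennreal (1 / \<eta>) < \<infinity>" by simp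
  note pw = path_weights[OF x, of M]
  have "infsum (path_weights.wt G (ennreal (1 / \<eta>))) {w. admissible M w} < \<infinity>"
    by (rule path_weights.sum_finite_if_loops[OF pw], unfold loop_sum_eq[OF x], rule assms(2))
  then obtain c where c: "0 \<le> c" "infsum (path_weights.wt G (ennreal (1 / \<eta>))) {w. admissible M w} = ennreal c"
    by (cases "infsum (path_weights.wt G (ennreal (1 / \<eta>))) {w. admissible M w}") auto
  have "infsum G {w. admissible M w \<and> length w = n} \<le> ennreal (c * \<eta> ^ n)" for n
  proof (rule infsum_ennreal_leI)
    fix F assume F: "finite F" "F \<subseteq> {w. admissible M w \<and> length w = n}"
    have "sum G F = (\<Sum>w\<in>F. path_weights.wt G (ennreal (1 / \<eta>)) w * ennreal (\<eta> ^ n))"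
    proof (rule sum.cong[OF refl])
      fix w assume "w \<in> F"
      then have n: "length w = n" using F by auto
      have "ennreal ((1 / \<eta>) ^ n) * ennreal (\<eta> ^ n) = 1"
        using \<eta> by (subst ennreal_mult[symmetric]) (auto simp: power_divide)
      then show "G w = path_weights.wt G (ennreal (1 / \<eta>)) w * ennreal (\<eta> ^ n)"
        using \<eta> unfolding path_weights.wt_def[OF pw] n by (simp add: ennreal_power mult.assoc)
    qed
    also have "\<dots> = sum (path_weights.wt G (ennreal (1 / \<eta>))) F * ennreal (\<eta> ^ n)"
      by (simp add: sum_distrib_right)
    also have "\<dots> \<le> ennreal c * ennreal (\<eta> ^ n)"
      unfolding c(2)[symmetric] using F by (intro mult_right_mono sum_le_infsum_ennreal) auto
    finally show "sum G F \<le> ennreal (c * \<eta> ^ n)" using c(1) \<eta> by (simp add: ennreal_mult)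
  qed
  then show ?thesis using c(1) by blast
qed

text \<open>A rate \<open>\<eta>'\<close> strictly between \<Lambda> and \<eta> bounds the partition
  sums, and with them the loops; the gap to \<eta> makes the loop series converge at
  \<open>1 / \<eta>\<close>.\<close>

lemma words_upper:
  assumes "\<Lambda> < \<eta>"
  shows "\<exists>c\<ge>0. \<forall>n. infsum G {w. admissible M w \<and> length w = n} \<le> ennreal (c * \<eta> ^ n)"
proof (rule sum_wt_finite)
  show "0 < \<eta>" using assms \<Lambda>_pos by simp
  fix u :: "'s list" assume u: "length u = k"
  define \<eta>' where "\<eta>' = (\<Lambda> + \<eta>) / 2"
  have \<eta>': "0 < \<eta>'" "\<Lambda> < \<eta>'" "\<eta>' < \<eta>" using assms \<Lambda>_pos by (auto simp: \<eta>'_def)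
  obtain C where C: "0 \<le> C" "\<And>n. Z n \<le> C * \<eta>' ^ n" using Z_upper[OF \<eta>'(2)] by blast
  show "infsum (\<lambda>l. weight (length l) (l @ u) * ennreal (1 / \<eta>) ^ length l) (loop_set u) < \<infinity>"
  proof (rule infsum_by_length_finite[OF _ \<eta>'(1,3)])
    fix n
    show "infsum (\<lambda>l. weight (length l) (l @ u)) {l \<in> loop_set u. length l = n} \<le> ennreal ((1 + exp D * C) * \<eta>' ^ n)"
    proof (cases "n = 0")
      case True
      have "1 + exp D * Z n \<le> (1 + exp D * C) * \<eta>' ^ n" using C(2)[of n] True by simp
      then show ?thesis using loops_le[OF u, of n] ennreal_leI order_trans by blast
    next
      case False
      have "exp D * Z n \<le> exp D * (C * \<eta>' ^ n)" using C(2)[of n] by simp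
      also have "\<dots> \<le> (1 + exp D * C) * \<eta>' ^ n" using \<eta>'(1) by (simp add: algebra_simps)
      finally have "ennreal (exp D * Z n) \<le> ennreal ((1 + exp D * C) * \<eta>' ^ n)" by (rule ennreal_leI)
      then show ?thesis using loops_le_Z[OF u, of n] False order_trans by blast
    qed
  qed (use C in simp)
qed

text \<open>If the loops at every block grew at most like \<open>\<eta> ^ n\<close>, all admissible
  words would grow at most like \<open>\<eta>' ^ n\<close> for some
  \<open>\<eta>' < \<Lambda>\<close>, against \<open>\<Lambda> ^ n \<le> Z n\<close>. The block is
  chosen before \<open>K\<close> and \<open>n0\<close>, so it serves arbitrarily large
  \<open>n\<close>.\<close>

lemma many_loops:
  assumes \<eta>: "0 < \<eta>" "\<eta> < \<Lambda>"
  shows "\<exists>u. length u = k \<and> (\<forall>K n0. \<exists>n\<ge>n0. ennreal (K * \<eta> ^ n)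
    < infsum (\<lambda>l. weight (length l) (l @ u)) {l \<in> loop_set u. length l = n})"
proof (rule ccontr)
  define f where "f u n = infsum (\<lambda>l. weight (length l) (l @ u)) {l \<in> loop_set u. length l = n}" for u n
  assume neg: "\<not> ?thesis"
  define \<eta>' where "\<eta>' = (\<eta> + \<Lambda>) / 2"
  have \<eta>': "0 < \<eta>'" "\<eta> < \<eta>'" "\<eta>' < \<Lambda>" using assms by (auto simp: \<eta>'_def)
  have "\<exists>c\<ge>0. \<forall>n. infsum G {w. admissible M w \<and> length w = n} \<le> ennreal (c * \<eta>' ^ n)"
  proof (rule sum_wt_finite[OF \<eta>'(1)])
    fix u :: "'s list" assume u: "length u = k"
    have "\<not> (\<forall>K n0. \<exists>n\<ge>n0. ennreal (K * \<eta> ^ n) < f u n)"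
    proof
      assume "\<forall>K n0. \<exists>n\<ge>n0. ennreal (K * \<eta> ^ n) < f u n"
      with u have "length u = k \<and> (\<forall>K n0. \<exists>n\<ge>n0. ennreal (K * \<eta> ^ n) < f u n)" by (rule conjI)
      then show False using neg unfolding f_def by (elim notE) (rule exI)
    qed
    then obtain K n0 where K: "\<forall>n\<ge>n0. f u n \<le> ennreal (K * \<eta> ^ n)" by (auto simp: not_less)
    have fin: "f u n < \<infinity>" for n
      using loops_le[OF u, of n] unfolding f_def by (simp add: order.strict_trans1)
    have "\<exists>C\<ge>0. \<forall>n. enn2real (f u n) \<le> C * \<eta> ^ n"
    proof (rule bounded_by_power[where K = "max K 0"])
      have "enn2real (f u n) \<le> max K 0 * \<eta> ^ n" if "n0 \<le> n" for n
      proof -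
        have "f u n \<le> ennreal (max K 0 * \<eta> ^ n)"
          using K[rule_format, OF that] by (rule order_trans) (use \<eta> in \<open>auto intro!: ennreal_leI mult_right_mono\<close>)
        then show ?thesis using \<eta> by (intro enn2real_leI) auto
      qed
      then show "\<forall>\<^sub>F n in sequentially. enn2real (f u n) \<le> max K 0 * \<eta> ^ n"
        by (auto simp: eventually_sequentially)
    qed (use \<eta> in auto)
    then obtain C where C: "0 \<le> C" "\<And>n. enn2real (f u n) \<le> C * \<eta> ^ n" by blast
    show "infsum (\<lambda>l. weight (length l) (l @ u) * ennreal (1 / \<eta>') ^ length l) (loop_set u) < \<infinity>"
    proof (rule infsum_by_length_finite[OF _ \<eta>(1) \<eta>'(2) C(1)])
      fix n
      have "f u n = ennreal (enn2real (f u n))" using fin[of n] by simp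
      also have "\<dots> \<le> ennreal (C * \<eta> ^ n)" using C(2) by (rule ennreal_leI)
      finally show "infsum (\<lambda>l. weight (length l) (l @ u)) {l \<in> loop_set u. length l = n} \<le> ennreal (C * \<eta> ^ n)"
        unfolding f_def .
    qed
  qed
  then obtain c where c: "0 \<le> c" "\<And>n. infsum G {w. admissible M w \<and> length w = n} \<le> ennreal (c * \<eta>' ^ n)"
    by blast
  have le: "(\<Lambda> / \<eta>') ^ n \<le> c" if "0 < n" for n
  proof -
    have "ennreal (Z n) \<le> infsum G {w. admissible M w \<and> length w = n}"
      unfolding Z[symmetric]
    proof (rule infsum_ennreal_mono)
      show "Zset n \<subseteq> {w. admissible M w \<and> length w = n}"
        using Zset_admissible by (auto simp: Zset_def)
      show "ennreal (v n w) \<le> G w" if "w \<in> Zset n" for w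
        unfolding Gr(1)[symmetric] by (rule ennreal_leI[OF v_le_Gr[OF that]])
    qed
    also have "\<dots> \<le> ennreal (c * \<eta>' ^ n)" by (rule c(2))
    finally have "Z n \<le> c * \<eta>' ^ n" using c(1) \<eta>'(1) by (subst (asm) ennreal_le_iff) auto
    then have "\<Lambda> ^ n \<le> c * \<eta>' ^ n" using pressure_limit(2)[OF that] by linarith
    then show ?thesis using \<eta>'(1) by (simp add: power_divide field_simps)
  qed
  have "1 < \<Lambda> / \<eta>'" using \<eta>' by simp
  then obtain n where "c < (\<Lambda> / \<eta>') ^ n" using real_arch_pow by blast
  also have "\<dots> \<le> (\<Lambda> / \<eta>') ^ Suc n" using \<open>1 < \<Lambda> / \<eta>'\<close> by (intro power_increasing) auto
  finally show False using le[of "Suc n"] by simp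
qed

end

section \<open>The spaces of Lipschitz functions\<close>

definition supn :: "(nat \<Rightarrow> 's) set \<Rightarrow> ((nat \<Rightarrow> 's) \<Rightarrow> complex) \<Rightarrow> real" where
  "supn X f = (SUP \<omega>\<in>X. norm (f \<omega>))"

definition lipn :: "(nat \<Rightarrow> 's) set \<Rightarrow> real \<Rightarrow> nat \<Rightarrow> ((nat \<Rightarrow> 's) \<Rightarrow> complex) \<Rightarrow> real" where
  "lipn X \<theta> k f = enn2real (lip_seminorm X \<theta> k f)"

text \<open>The weight \<open>K\<close> in front of the supremum norm is a parameter because the lower bound for the
  spectrum is proved in an equivalent norm.\<close>

definition FbN :: "(nat \<Rightarrow> 's) set \<Rightarrow> real \<Rightarrow> nat \<Rightarrow> real \<Rightarrow> ((nat \<Rightarrow> 's) \<Rightarrow> complex) \<Rightarrow> real" where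
  "FbN X \<theta> k K f = K * supn X f + lipn X \<theta> k f"

lemma Fb_norm_eq: "Fb_norm X \<theta> k = FbN X \<theta> k 1"
  by (simp add: fun_eq_iff Fb_norm_def FbN_def supn_def lipn_def)

lemma d_theta_less_agree:
  assumes "0 < \<theta>" "\<theta> < 1" "d_theta \<theta> \<omega> \<upsilon> < \<theta> ^ m" "i < m"
  shows "\<omega> i = \<upsilon> i"
proof (rule ccontr)
  assume ne: "\<omega> i \<noteq> \<upsilon> i"
  then have "\<theta> ^ (LEAST n. \<omega> n \<noteq> \<upsilon> n) < \<theta> ^ m" using assms(3) by (auto simp: d_theta_def split: if_splits)
  then have "m < (LEAST n. \<omega> n \<noteq> \<upsilon> n)" using assms(1,2) power_strict_decreasing_iff by metis
  moreover have "(LEAST n. \<omega> n \<noteq> \<upsilon> n) \<le> i" using ne by (rule Least_le)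
  ultimately show False using assms(4) by simp
qed

text \<open>Points closer than \<open>\<theta> ^ m\<close> agree on the first \<open>m\<close>
  letters, so the estimate for large \<open>m\<close> is uniform continuity.\<close>

lemma continuous_map_if_lipschitz:
  assumes \<theta>: "0 < \<theta>" "\<theta> < 1"
    and f: "\<And>m \<omega> \<upsilon>. k \<le> m \<Longrightarrow> \<omega> \<in> X \<Longrightarrow> \<upsilon> \<in> X \<Longrightarrow> \<forall>i<m. \<omega> i = \<upsilon> i \<Longrightarrow> cmod (f \<omega> - f \<upsilon>) \<le> C * \<theta> ^ m"
  shows "continuous_map (Metric_space.mtopology X (d_theta \<theta>)) euclidean f"
proof -
  interpret ms: Metric_space X "d_theta \<theta>" by (rule Metric_space_d_theta[OF \<theta>])
  show ?thesis
    unfolding continuous_map ms.topspace_mtopology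
  proof (intro conjI allI impI)
    fix U :: "complex set" assume "openin euclidean U"
    then have U: "open U" by simp
    show "openin ms.mtopology {x \<in> X. f x \<in> U}"
      unfolding ms.openin_mtopology
    proof (intro conjI allI impI)
      fix \<omega> assume \<omega>: "\<omega> \<in> {x \<in> X. f x \<in> U}"
      then obtain e where e: "0 < e" "ball (f \<omega>) e \<subseteq> U" using U open_contains_ball by blast
      have "(\<lambda>m. C * \<theta> ^ m) \<longlonglongrightarrow> C * 0" using \<theta> by (intro tendsto_intros LIMSEQ_power_zero) auto
      then have "\<forall>\<^sub>F m in sequentially. C * \<theta> ^ m < e" using e(1) by (intro order_tendstoD) auto
      then obtain m where m: "k \<le> m" "C * \<theta> ^ m < e"
        using eventually_happens[OF eventually_conj[OF _ eventually_ge_at_top[of k]]] by auto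
      show "\<exists>r>0. ms.mball \<omega> r \<subseteq> {x \<in> X. f x \<in> U}"
      proof (intro exI[of _ "\<theta> ^ m"] conjI subsetI)
        fix \<upsilon> assume \<upsilon>: "\<upsilon> \<in> ms.mball \<omega> (\<theta> ^ m)"
        then have X: "\<omega> \<in> X" "\<upsilon> \<in> X" and d: "d_theta \<theta> \<omega> \<upsilon> < \<theta> ^ m" by auto
        have "cmod (f \<omega> - f \<upsilon>) \<le> C * \<theta> ^ m" using d_theta_less_agree[OF \<theta> d] X m(1) by (intro f) auto
        then have "f \<upsilon> \<in> ball (f \<omega>) e" using m(2) by (simp add: dist_norm)
        then show "\<upsilon> \<in> {x \<in> X. f x \<in> U}" using e(2) X by auto
      qed (use \<theta> in simp)
    qed auto
  qed auto
qed

locale lipschitz_space =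
  fixes X :: "(nat \<Rightarrow> 's) set" and \<theta> :: real and k :: nat
  assumes \<theta>01: "0 < \<theta>" "\<theta> < 1" and X_ne: "X \<noteq> {}"
begin

lemma FbI:
  assumes "\<And>\<omega>. \<omega> \<notin> X \<Longrightarrow> f \<omega> = 0" "\<And>\<omega>. \<omega> \<in> X \<Longrightarrow> cmod (f \<omega>) \<le> B" "0 \<le> C"
    "\<And>m \<omega> \<upsilon>. k \<le> m \<Longrightarrow> \<omega> \<in> X \<Longrightarrow> \<upsilon> \<in> X \<Longrightarrow> \<forall>i<m. \<omega> i = \<upsilon> i \<Longrightarrow> cmod (f \<omega> - f \<upsilon>) \<le> C * \<theta> ^ m"
  shows "f \<in> Fb X \<theta> k" "supn X f \<le> B" "lipn X \<theta> k f \<le> C"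
proof -
  have L: "lip_seminorm X \<theta> k f \<le> ennreal C"
    by (rule lip_seminorm_leI[OF \<theta>01(1) assms(3,4)])
  have "lip_seminorm X \<theta> k f < \<infinity>" using L by (simp add: order.strict_trans1)
  then show "f \<in> Fb X \<theta> k"
    unfolding Fb_def using assms(1,2) continuous_map_if_lipschitz[OF \<theta>01 assms(4)]
    by (auto simp: bounded_iff)
  show "supn X f \<le> B" unfolding supn_def using assms(2) X_ne by (intro cSUP_least) auto
  show "lipn X \<theta> k f \<le> C" unfolding lipn_def using L assms(3) by (intro enn2real_leI)
qed

lemma FbD:
  assumes "f \<in> Fb X \<theta> k"
  shows "\<omega> \<notin> X \<Longrightarrow> f \<omega> = 0" "cmod (f \<omega>) \<le> supn X f"
    "k \<le> m \<Longrightarrow> \<omega> \<in> X \<Longrightarrow> \<upsilon> \<in> X \<Longrightarrow> \<forall>i<m. \<omega> i = \<upsilon> i \<Longrightarrow> cmod (f \<omega> - f \<upsilon>) \<le> lipn X \<theta> k f * \<theta> ^ m"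
    "0 \<le> supn X f" "0 \<le> lipn X \<theta> k f"
proof -
  have f: "\<And>\<omega>. \<omega> \<notin> X \<Longrightarrow> f \<omega> = 0" "bounded (f ` X)" "lip_seminorm X \<theta> k f < \<infinity>"
    using assms by (auto simp: Fb_def)
  obtain B where B: "\<And>\<omega>. \<omega> \<in> X \<Longrightarrow> cmod (f \<omega>) \<le> B" using f(2) by (auto simp: bounded_iff)
  have up: "cmod (f \<omega>) \<le> supn X f" if "\<omega> \<in> X" for \<omega>
    unfolding supn_def using that B by (intro cSUP_upper bdd_aboveI2[of _ _ B]) auto
  show s0: "0 \<le> supn X f" using up X_ne norm_ge_zero order_trans by blast
  show "f \<omega> = 0" if "\<omega> \<notin> X" using f(1) that .
  show "cmod (f \<omega>) \<le> supn X f" using up f(1) s0 by (cases "\<omega> \<in> X") auto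
  show "cmod (f \<omega> - f \<upsilon>) \<le> lipn X \<theta> k f * \<theta> ^ m"
    if "k \<le> m" "\<omega> \<in> X" "\<upsilon> \<in> X" "\<forall>i<m. \<omega> i = \<upsilon> i"
    unfolding lipn_def using lip_seminormD[OF \<theta>01(1) f(3) that] .
  show "0 \<le> lipn X \<theta> k f" by (simp add: lipn_def)
qed

text \<open>For completeness: if the norms are summable, so are the supremum norms and the Lipschitz
  constants separately, and the pointwise sum inherits both bounds.\<close>

lemma fun_space:
  assumes K: "1 \<le> K"
  shows "fun_space (Fb X \<theta> k) (FbN X \<theta> k K)"
proof
  have N: "FbN X \<theta> k K f \<le> K * B + C" if "supn X f \<le> B" "lipn X \<theta> k f \<le> C" for f B C
    unfolding FbN_def using that K by (intro add_mono mult_left_mono) auto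
  show "(\<lambda>x. 0) \<in> Fb X \<theta> k" by (rule FbI(1)[of _ 0 0]) auto
  show "cmod (f x) \<le> FbN X \<theta> k K f" if "f \<in> Fb X \<theta> k" for f x
  proof -
    have "1 * supn X f \<le> K * supn X f" using K FbD(4)[OF that] by (intro mult_right_mono) auto
    then show ?thesis using FbD(2)[OF that, of x] FbD(5)[OF that] by (simp add: FbN_def)
  qed
  fix f assume f: "f \<in> Fb X \<theta> k"
  note fD = FbD[OF f]
  {
    fix g assume g: "g \<in> Fb X \<theta> k"
    note gD = FbD[OF g]
    have 1: "cmod (f \<omega> + g \<omega>) \<le> supn X f + supn X g" for \<omega>
      using norm_triangle_ineq[of "f \<omega>" "g \<omega>"] fD(2)[of \<omega>] gD(2)[of \<omega>] by linarith
    have 2: "cmod (f \<omega> + g \<omega> - (f \<upsilon> + g \<upsilon>)) \<le> (lipn X \<theta> k f + lipn X \<theta> k g) * \<theta> ^ m"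
      if "k \<le> m" "\<omega> \<in> X" "\<upsilon> \<in> X" "\<forall>i<m. \<omega> i = \<upsilon> i" for m \<omega> \<upsilon>
    proof -
      have e: "f \<omega> + g \<omega> - (f \<upsilon> + g \<upsilon>) = (f \<omega> - f \<upsilon>) + (g \<omega> - g \<upsilon>)" by simp
      show ?thesis
        unfolding e distrib_right
        using norm_triangle_ineq[of "f \<omega> - f \<upsilon>" "g \<omega> - g \<upsilon>"] fD(3)[OF that] gD(3)[OF that]
        by linarith
    qed
    note fg = FbI[of "\<lambda>x. f x + g x" "supn X f + supn X g" "lipn X \<theta> k f + lipn X \<theta> k g"]
    show "(\<lambda>x. f x + g x) \<in> Fb X \<theta> k"
      by (rule fg(1)) (use 1 2 fD(1,5) gD(1,5) in auto)
    have "FbN X \<theta> k K (\<lambda>x. f x + g x) \<le> K * (supn X f + supn X g) + (lipn X \<theta> k f + lipn X \<theta> k g)"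
      by (rule N; rule fg) (use 1 2 fD(1,5) gD(1,5) in auto)
    then show "FbN X \<theta> k K (\<lambda>x. f x + g x) \<le> FbN X \<theta> k K f + FbN X \<theta> k K g"
      by (simp add: FbN_def algebra_simps)
  }
  fix c :: complex
  have 1: "cmod (c * f \<omega>) \<le> cmod c * supn X f" for \<omega>
    using fD(2)[of \<omega>] by (simp add: norm_mult mult_left_mono)
  have 2: "cmod (c * f \<omega> - c * f \<upsilon>) \<le> (cmod c * lipn X \<theta> k f) * \<theta> ^ m"
    if "k \<le> m" "\<omega> \<in> X" "\<upsilon> \<in> X" "\<forall>i<m. \<omega> i = \<upsilon> i" for m \<omega> \<upsilon>
    using mult_left_mono[OF fD(3)[OF that], of "cmod c"]
    by (simp add: norm_mult mult.assoc flip: right_diff_distrib)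
  note cf = FbI[of "\<lambda>x. c * f x" "cmod c * supn X f" "cmod c * lipn X \<theta> k f"]
  show "(\<lambda>x. c * f x) \<in> Fb X \<theta> k"
    by (rule cf(1)) (use 1 2 fD(1,5) in auto)
  have "FbN X \<theta> k K (\<lambda>x. c * f x) \<le> K * (cmod c * supn X f) + cmod c * lipn X \<theta> k f"
    by (rule N; rule cf) (use 1 2 fD(1,5) in auto)
  then show "FbN X \<theta> k K (\<lambda>x. c * f x) \<le> cmod c * FbN X \<theta> k K f"
    by (simp add: FbN_def algebra_simps)
next
  fix F :: "nat \<Rightarrow> (nat \<Rightarrow> 's) \<Rightarrow> complex"
  assume F: "\<And>j. F j \<in> Fb X \<theta> k" and sm: "summable (\<lambda>j. FbN X \<theta> k K (F j))"
  have K1: "supn X (F j) \<le> K * supn X (F j)" for j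
    using mult_right_mono[OF K FbD(4)[OF F[of j]]] by simp
  have s1: "summable (\<lambda>j. supn X (F j))"
    by (rule summable_comparison_test[OF _ sm])
      (use K1 FbD(4,5)[OF F] in \<open>auto simp: FbN_def intro!: exI[of _ 0] add_increasing2\<close>)
  have s2: "summable (\<lambda>j. lipn X \<theta> k (F j))"
    by (rule summable_comparison_test[OF _ sm])
      (use K FbD(4,5)[OF F] in \<open>auto simp: FbN_def intro!: exI[of _ 0] mult_nonneg_nonneg\<close>)
  have sx: "summable (\<lambda>j. norm (F j \<omega>))" for \<omega>
    by (rule summable_comparison_test[OF _ s1]) (use FbD(2)[OF F] in auto)
  have 1: "cmod (\<Sum>j. F j \<omega>) \<le> (\<Sum>j. supn X (F j))" for \<omega>
    using summable_norm[OF sx[of \<omega>]] suminf_le[OF FbD(2)[OF F] sx[of \<omega>] s1] by linarith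
  have 2: "cmod ((\<Sum>j. F j \<omega>) - (\<Sum>j. F j \<upsilon>)) \<le> (\<Sum>j. lipn X \<theta> k (F j)) * \<theta> ^ m"
    if "k \<le> m" "\<omega> \<in> X" "\<upsilon> \<in> X" "\<forall>i<m. \<omega> i = \<upsilon> i" for m \<omega> \<upsilon>
  proof -
    have s2': "summable (\<lambda>j. lipn X \<theta> k (F j) * \<theta> ^ m)" using s2 by (rule summable_mult2)
    have le: "cmod (F j \<omega> - F j \<upsilon>) \<le> lipn X \<theta> k (F j) * \<theta> ^ m" for j by (rule FbD(3)[OF F that])
    have sd: "summable (\<lambda>j. cmod (F j \<omega> - F j \<upsilon>))"
      by (rule summable_comparison_test[OF _ s2']) (use le in auto)
    have "(\<Sum>j. F j \<omega>) - (\<Sum>j. F j \<upsilon>) = (\<Sum>j. F j \<omega> - F j \<upsilon>)"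
      by (rule suminf_diff[OF summable_norm_cancel[OF sx] summable_norm_cancel[OF sx]])
    also have "cmod \<dots> \<le> (\<Sum>j. lipn X \<theta> k (F j) * \<theta> ^ m)"
      using summable_norm[OF sd] suminf_le[OF le sd s2'] by linarith
    finally show ?thesis by (simp add: suminf_mult2[OF s2])
  qed
  have z: "(\<Sum>j. F j \<omega>) = 0" if "\<omega> \<notin> X" for \<omega> using FbD(1)[OF F that] by simp
  have p: "0 \<le> (\<Sum>j. lipn X \<theta> k (F j))" using FbD(5)[OF F] by (intro suminf_nonneg s2)
  show "(\<lambda>x. \<Sum>j. F j x) \<in> Fb X \<theta> k" by (rule FbI(1)[OF z 1 p 2])
  have "supn X (\<lambda>x. \<Sum>j. F j x) \<le> (\<Sum>j. supn X (F j))" by (rule FbI(2)[OF z 1 p 2])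
  moreover have "lipn X \<theta> k (\<lambda>x. \<Sum>j. F j x) \<le> (\<Sum>j. lipn X \<theta> k (F j))" by (rule FbI(3)[OF z 1 p 2])
  ultimately have "FbN X \<theta> k K (\<lambda>x. \<Sum>j. F j x) \<le> K * (\<Sum>j. supn X (F j)) + (\<Sum>j. lipn X \<theta> k (F j))"
    unfolding FbN_def using K by (intro add_mono mult_left_mono) auto
  also have "\<dots> = (\<Sum>j. FbN X \<theta> k K (F j))"
    unfolding FbN_def suminf_add[OF summable_mult[OF s1] s2, symmetric] suminf_mult[OF s1] ..
  finally show "FbN X \<theta> k K (\<lambda>x. \<Sum>j. F j x) \<le> (\<Sum>j. FbN X \<theta> k K (F j))" .
qed

end

section \<open>The transfer operator\<close>

definition conc :: "'s list \<Rightarrow> (nat \<Rightarrow> 's) \<Rightarrow> nat \<Rightarrow> 's" where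
  "conc w \<omega> = foldr prepend w \<omega>"

lemma conc_simps [simp]: "conc [] \<omega> = \<omega>" "conc (a # w) \<omega> = prepend a (conc w \<omega>)"
  by (simp_all add: conc_def)

lemma conc_append: "conc (u @ w) \<omega> = conc u (conc w \<omega>)"
  by (simp add: conc_def)

lemma conc_nth: "conc w \<omega> i = (if i < length w then w ! i else \<omega> (i - length w))"
proof (induction w arbitrary: i)
  case (Cons a w)
  then show ?case by (cases i) (auto simp: prepend_def)
qed simp

lemma funpow_lshift_conc: "(lshift ^^ length w) (conc w \<omega>) = \<omega>"
  by (simp add: fun_eq_iff funpow_lshift conc_nth)

lemma conc_in_cylinder:
  assumes "\<omega> \<in> path_space UNIV A" "admissible A (w @ [\<omega> 0])"
  shows "conc w \<omega> \<in> cylinder (path_space UNIV A) w"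
proof -
  have "A (conc w \<omega> i) (conc w \<omega> (Suc i)) = 1" for i
  proof (cases "i < length w")
    case True
    have "conc w \<omega> j = (w @ [\<omega> 0]) ! j" if "j \<le> length w" for j
      using that by (auto simp: conc_nth nth_append)
    moreover have "A ((w @ [\<omega> 0]) ! i) ((w @ [\<omega> 0]) ! Suc i) = 1"
      using assms(2) True unfolding admissible_nth by simp
    ultimately show ?thesis using True by simp
  next
    case False
    then have "Suc i - length w = Suc (i - length w)" by simp
    then show ?thesis using False assms(1) by (simp add: conc_nth path_space_def)
  qed
  then show ?thesis by (simp add: cylinder_def path_space_def conc_nth)
qed

text \<open>From \<open>1 + t \<le> exp t\<close>; the number \<open>g\<close> bounds the derivative
  of the exponential between \<open>a\<close> and \<open>b\<close>.\<close>

lemma exp_diff_le: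
  fixes a b g :: real
  assumes "exp a \<le> g" "exp b \<le> g"
  shows "\<bar>exp a - exp b\<bar> \<le> g * \<bar>a - b\<bar>"
proof -
  have *: "exp y - exp x \<le> exp y * (y - x)" for x y :: real
  proof -
    have "1 + (x - y) \<le> exp (x - y)" by (rule exp_ge_add_one_self)
    then have "exp y * (1 + (x - y)) \<le> exp y * exp (x - y)" by simp
    also have "exp y * exp (x - y) = exp x" by (simp flip: exp_add)
    finally show ?thesis by (simp add: algebra_simps)
  qed
  have **: "\<bar>exp x - exp y\<bar> \<le> g * \<bar>x - y\<bar>" if "x \<le> y" "exp y \<le> g" for x y
  proof -
    have "exp y * (y - x) \<le> g * (y - x)" using that by (intro mult_right_mono) auto
    then show ?thesis using *[of y x] that by simp
  qed
  show ?thesis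
  proof (cases "a \<le> b")
    case True then show ?thesis using **[of a b] assms by simp
  next
    case False
    then show ?thesis using **[of b a] assms by (simp add: abs_minus_commute)
  qed
qed

section \<open>Iterates of the transfer operator as sums over inverse branches\<close>

context markov_subsystem
begin

abbreviation L :: "((nat \<Rightarrow> 's) \<Rightarrow> complex) \<Rightarrow> (nat \<Rightarrow> 's) \<Rightarrow> complex" where
  "L \<equiv> transfer_op X M \<phi>"

definition words :: "nat \<Rightarrow> 's list set" where "words n = {w. admissible M w \<and> length w = n}"

definition words_to :: "nat \<Rightarrow> 's \<Rightarrow> 's list set" where
  "words_to n b = {w. length w = n \<and> admissible M (w @ [b])}"

text \<open>The contribution of the inverse branch \<open>w\<close> to
  \<open>(L ^^ n) f \<omega>\<close>.\<close>

definition trm :: "nat \<Rightarrow> ((nat \<Rightarrow> 's) \<Rightarrow> complex) \<Rightarrow> (nat \<Rightarrow> 's) \<Rightarrow> 's list \<Rightarrow> complex" where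
  "trm n f \<omega> w = of_real (exp (S n (conc w \<omega>))) * f (conc w \<omega>)"

lemma words_to_subset: "words_to n b \<subseteq> words n"
  using admissible_appendD by (auto simp: words_to_def words_def)

lemma words_to_0: "words_to 0 b = {[]}"
  by (auto simp: words_to_def admissible_def)

text \<open>The last letter is split off because the outer application of \<open>L\<close> prepends
  \<open>a\<close> to the point, and the remaining applications put \<open>w\<close> in front of
  that.\<close>

lemma words_to_Suc:
  "words_to (Suc n) b = (\<lambda>(a, w). w @ [a]) ` Sigma {a. M a b = 1} (words_to n)"
proof
  have snoc: "admissible M (w @ [a] @ [b]) \<longleftrightarrow> admissible M (w @ [a]) \<and> M a b = 1" for w a
    by (auto simp: admissible_def successively_append_iff)
  show "words_to (Suc n) b \<subseteq> (\<lambda>(a, w). w @ [a]) ` Sigma {a. M a b = 1} (words_to n)"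
  proof
    fix u assume u: "u \<in> words_to (Suc n) b"
    then have "u \<noteq> []" by (auto simp: words_to_def)
    then obtain w a where wa: "u = w @ [a]" by (metis append_butlast_last_id)
    then have "(a, w) \<in> Sigma {a. M a b = 1} (words_to n)"
      using u snoc[of w a] by (auto simp: words_to_def)
    from imageI[OF this, of "\<lambda>(a, w). w @ [a]"] 
    show "u \<in> (\<lambda>(a, w). w @ [a]) ` Sigma {a. M a b = 1} (words_to n)" using wa by simp
  qed
  show "(\<lambda>(a, w). w @ [a]) ` Sigma {a. M a b = 1} (words_to n) \<subseteq> words_to (Suc n) b"
    using snoc by (auto simp: words_to_def)
qed

lemma conc_cylinder:
  assumes "\<omega> \<in> X" "w \<in> words_to n (\<omega> 0)"
  shows "conc w \<omega> \<in> cylinder X w"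
proof (rule conc_in_cylinder[OF assms(1)])
  show "admissible A (w @ [\<omega> 0])"
    using assms(2) M_A by (simp add: words_to_def admissible_nth)
qed

lemma conc_X: "\<omega> \<in> X \<Longrightarrow> w \<in> words_to n (\<omega> 0) \<Longrightarrow> conc w \<omega> \<in> X"
  using conc_cylinder by (auto simp: cylinder_def)

lemma Gr_summable_words: "Gr summable_on words n" 
  by (rule Gr_summable[of _ n]) (auto simp: words_def)

lemma trm_bound:
  assumes "\<omega> \<in> X" "w \<in> words_to n (\<omega> 0)" "cmod (f (conc w \<omega>)) \<le> B"
  shows "cmod (trm n f \<omega> w) \<le> Gr w * B"
proof -
  have "exp (S n (conc w \<omega>)) \<le> Gr w"
    using exp_le_Gr[OF conc_cylinder[OF assms(1,2)]] assms(2) by (simp add: words_to_def)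
  then show ?thesis unfolding trm_def norm_mult
    using assms(3) Gr(2)[of w] by (intro mult_mono) auto
qed

lemma trm_summable:
  assumes "\<And>x. x \<in> X \<Longrightarrow> cmod (f x) \<le> B" "\<omega> \<in> X"
  shows "(\<lambda>w. norm (trm n f \<omega> w)) summable_on words_to n (\<omega> 0)" "trm n f \<omega> summable_on words_to n (\<omega> 0)"
proof -
  have "(\<lambda>w. Gr w * B) summable_on words_to n (\<omega> 0)"
    by (intro summable_on_cmult_left summable_on_subset_banach[OF Gr_summable_words words_to_subset])
  then show "(\<lambda>w. norm (trm n f \<omega> w)) summable_on words_to n (\<omega> 0)"
    by (rule Infinite_Sum.abs_summable_on_comparison_test') (intro trm_bound assms conc_X)
  then show "trm n f \<omega> summable_on words_to n (\<omega> 0)" by (rule Infinite_Sum.abs_summable_summable)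
qed

lemma trm_Suc: "trm (Suc n) f \<omega> (w @ [a]) = of_real (exp (\<phi> (prepend a \<omega>))) * trm n f (prepend a \<omega>) w"
  if "length w = n"
proof -
  have "S (n + 1) (conc w (prepend a \<omega>)) = S n (conc w (prepend a \<omega>)) + \<phi> (prepend a \<omega>)"
    unfolding birkhoff_sum_add using funpow_lshift_conc[of w "prepend a \<omega>"] that by (simp add: birkhoff_sum_def)
  then show ?thesis by (simp add: trm_def conc_append exp_add)
qed

text \<open>Induction on the outer application of \<open>L\<close>. The bound on \<open>f\<close>
  makes the branches absolutely summable, which allows the iterated sum to be merged into one over
  longer words.\<close>

lemma transfer_iterate:
  assumes "\<And>x. x \<in> X \<Longrightarrow> cmod (f x) \<le> B"
  shows "\<omega> \<in> X \<Longrightarrow> (L ^^ n) f \<omega> = infsum (trm n f \<omega>) (words_to n (\<omega> 0))"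
proof (induction n arbitrary: \<omega>)
  case 0
  then show ?case by (simp add: words_to_0 trm_def birkhoff_sum_def)
next
  case (Suc n)
  let ?P = "{a. M a (\<omega> 0) = 1}" and ?q = "\<lambda>(a, w). w @ [a]"
  have pX: "prepend a \<omega> \<in> X" if "a \<in> ?P" for a
    using conc_X[OF Suc.prems, of "[a]" 1] that by (auto simp: words_to_def admissible_def)
  have p0: "prepend a \<omega> 0 = a" for a by (simp add: prepend_def)
  have inj: "inj_on ?q (Sigma ?P (words_to n))" by (auto simp: inj_on_def)
  have "trm (Suc n) f \<omega> summable_on ?q ` Sigma ?P (words_to n)"
    using trm_summable(2)[where f = f and n = "Suc n", OF assms Suc.prems] unfolding words_to_Suc .
  then have "(trm (Suc n) f \<omega> \<circ> ?q) summable_on Sigma ?P (words_to n)"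
    unfolding summable_on_reindex[OF inj] .
  then have sm: "(\<lambda>p. trm (Suc n) f \<omega> (?q p)) summable_on Sigma ?P (words_to n)"
    by (simp only: o_def)
  have "(L ^^ Suc n) f \<omega> = (\<Sum>\<^sub>\<infinity>a\<in>?P. of_real (exp (\<phi> (prepend a \<omega>))) * (L ^^ n) f (prepend a \<omega>))"
    using Suc.prems by (simp add: transfer_op_def)
  also have "\<dots> = (\<Sum>\<^sub>\<infinity>a\<in>?P. \<Sum>\<^sub>\<infinity>w\<in>words_to n a. trm (Suc n) f \<omega> (?q (a, w)))"
  proof (rule infsum_cong)
    fix a assume a: "a \<in> ?P"
    have "of_real (exp (\<phi> (prepend a \<omega>))) * (L ^^ n) f (prepend a \<omega>)
        = (\<Sum>\<^sub>\<infinity>w\<in>words_to n a. of_real (exp (\<phi> (prepend a \<omega>))) * trm n f (prepend a \<omega>) w)"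
      using Suc.IH[OF pX[OF a]] by (simp add: p0 infsum_cmult_right')
    also have "\<dots> = (\<Sum>\<^sub>\<infinity>w\<in>words_to n a. trm (Suc n) f \<omega> (?q (a, w)))"
      by (rule infsum_cong) (simp add: trm_Suc words_to_def)
    finally show "of_real (exp (\<phi> (prepend a \<omega>))) * (L ^^ n) f (prepend a \<omega>)
        = (\<Sum>\<^sub>\<infinity>w\<in>words_to n a. trm (Suc n) f \<omega> (?q (a, w)))" .
  qed
  also have "\<dots> = infsum (\<lambda>p. trm (Suc n) f \<omega> (?q p)) (Sigma ?P (words_to n))"
    using infsum_Sigma'_banach[of "\<lambda>a w. trm (Suc n) f \<omega> (?q (a, w))" ?P "words_to n"] sm
    by (simp add: case_prod_unfold)
  also have "\<dots> = infsum (trm (Suc n) f \<omega>) (words_to (Suc n) (\<omega> 0))"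
    unfolding words_to_Suc by (subst infsum_reindex[OF inj]) (simp add: o_def)
  finally show ?case .
qed

lemma transfer_off: "\<omega> \<notin> X \<Longrightarrow> 0 < n \<Longrightarrow> (L ^^ n) f \<omega> = 0"
  by (cases n) (simp_all add: transfer_op_def)

text \<open>The Lasota--Yorke estimate, with bounds that may depend on the branch \<open>w\<close>.\<close>

lemma transfer_estimate:
  assumes bdd: "\<And>x. x \<in> X \<Longrightarrow> cmod (f x) \<le> B0"
    and B: "(\<lambda>w. Gr w * B w) summable_on words n"
    and f1: "\<And>w x. w \<in> words n \<Longrightarrow> x \<in> cylinder X w \<Longrightarrow> cmod (f x) \<le> B w"
    and f2: "\<And>w x y m. w \<in> words n \<Longrightarrow> k \<le> m \<Longrightarrow> x \<in> cylinder X w \<Longrightarrow> y \<in> cylinder X w \<Longrightarrow>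
      \<forall>i<n + m. x i = y i \<Longrightarrow> cmod (f x - f y) \<le> B w * \<theta> ^ m"
    and Bnn: "\<And>w. w \<in> words n \<Longrightarrow> 0 \<le> B w"
  shows "\<omega> \<in> X \<Longrightarrow> cmod ((L ^^ n) f \<omega>) \<le> infsum (\<lambda>w. Gr w * B w) (words n)"
    and "k \<le> m \<Longrightarrow> \<omega> \<in> X \<Longrightarrow> \<upsilon> \<in> X \<Longrightarrow> \<forall>i<m. \<omega> i = \<upsilon> i \<Longrightarrow>
      cmod ((L ^^ n) f \<omega> - (L ^^ n) f \<upsilon>) \<le> ((D + 1) * infsum (\<lambda>w. Gr w * B w) (words n)) * \<theta> ^ m"
proof -
  have it: "(L ^^ n) f x = infsum (trm n f x) (words_to n (x 0))" if "x \<in> X" for x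
    by (rule transfer_iterate[OF bdd that])
  note sub = words_to_subset[of n]
  note smB = summable_on_subset_banach[OF B sub]
  have nn: "0 \<le> Gr w * B w" if "w \<in> words n" for w using Gr(2) Bnn[OF that] by simp
  have le: "infsum (\<lambda>w. Gr w * B w) (words_to n b) \<le> infsum (\<lambda>w. Gr w * B w) (words n)" for b
    using sub nn by (intro infsum_mono_neutral smB B) auto
  show "cmod ((L ^^ n) f \<omega>) \<le> infsum (\<lambda>w. Gr w * B w) (words n)" if \<omega>: "\<omega> \<in> X"
  proof -
    have "cmod ((L ^^ n) f \<omega>) \<le> infsum (\<lambda>w. norm (trm n f \<omega> w)) (words_to n (\<omega> 0))"
      unfolding it[OF \<omega>] by (rule Infinite_Sum.norm_infsum_bound[OF trm_summable(1)[where f = f, OF bdd \<omega>]])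
    also have "\<dots> \<le> infsum (\<lambda>w. Gr w * B w) (words_to n (\<omega> 0))"
    proof (rule infsum_mono[OF trm_summable(1)[where f = f, OF bdd \<omega>] smB])
      fix w assume w: "w \<in> words_to n (\<omega> 0)"
      then have "w \<in> words n" using sub by blast
      then show "cmod (trm n f \<omega> w) \<le> Gr w * B w"
        by (intro trm_bound[OF \<omega> w] f1 conc_cylinder[OF \<omega> w])
    qed
    also have "\<dots> \<le> infsum (\<lambda>w. Gr w * B w) (words n)" by (rule le)
    finally show ?thesis .
  qed
  assume m: "k \<le> m" and \<omega>: "\<omega> \<in> X" and \<upsilon>: "\<upsilon> \<in> X" and agree: "\<forall>i<m. \<omega> i = \<upsilon> i"
  \<comment> \<open>As \<open>m \<ge> k > 0\<close>, the points share their first letter and hence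
    their inverse branches.\<close>
  have eq0: "\<upsilon> 0 = \<omega> 0" using agree m k by auto
  have ts: "trm n f \<omega> summable_on words_to n (\<omega> 0)" "trm n f \<upsilon> summable_on words_to n (\<omega> 0)"
    using trm_summable(2)[where f = f, OF bdd \<omega>] trm_summable(2)[where f = f, OF bdd \<upsilon>] eq0 by auto
  have diff: "cmod (trm n f \<omega> w - trm n f \<upsilon> w) \<le> (D + 1) * \<theta> ^ m * (Gr w * B w)"
    if w: "w \<in> words_to n (\<omega> 0)" for w
  proof -
    have w': "w \<in> words_to n (\<upsilon> 0)" "w \<in> words n" "length w = n"
      using w sub eq0 by (auto simp: words_to_def)
    let ?x = "conc w \<omega>" and ?y = "conc w \<upsilon>"
    have cx: "?x \<in> cylinder X w" "?y \<in> cylinder X w"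
      using conc_cylinder[OF \<omega> w] conc_cylinder[OF \<upsilon> w'(1)] by auto
    then have X: "?x \<in> X" "?y \<in> X" by (auto simp: cylinder_def)
    have ag: "\<forall>i<n + m. ?x i = ?y i" using agree w'(3) by (auto simp: conc_nth)
    have gx: "exp (S n ?x) \<le> Gr w" "exp (S n ?y) \<le> Gr w" using exp_le_Gr cx w'(3) by auto
    have d: "\<bar>exp (S n ?x) - exp (S n ?y)\<bar> \<le> Gr w * (D * \<theta> ^ m)"
      using exp_diff_le[OF gx] mult_left_mono[OF distortion[OF X ag m] Gr(2)[of w]] by linarith
    \<comment> \<open>The change of the weight costs \<open>D\<close> and that of \<open>f\<close>
      costs 1, whence the factor \<open>D + 1\<close>.\<close>
    have split: "trm n f \<omega> w - trm n f \<upsilon> w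
        = of_real (exp (S n ?x) - exp (S n ?y)) * f ?x + of_real (exp (S n ?y)) * (f ?x - f ?y)"
      by (simp add: trm_def algebra_simps)
    have "cmod (trm n f \<omega> w - trm n f \<upsilon> w)
        \<le> \<bar>exp (S n ?x) - exp (S n ?y)\<bar> * cmod (f ?x) + exp (S n ?y) * cmod (f ?x - f ?y)"
      unfolding split
      using norm_triangle_ineq[of "of_real (exp (S n ?x) - exp (S n ?y)) * f ?x"
          "of_real (exp (S n ?y)) * (f ?x - f ?y)"]
      unfolding norm_mult norm_of_real by simp
    also have "\<dots> \<le> Gr w * (D * \<theta> ^ m) * B w + Gr w * (B w * \<theta> ^ m)"
      using d gx Gr(2)[of w] f1[OF w'(2) cx(1)] f2[OF w'(2) m cx ag] D_nonneg \<theta>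
      by (intro add_mono mult_mono) auto
    also have "\<dots> = (D + 1) * \<theta> ^ m * (Gr w * B w)" by (simp add: algebra_simps)
    finally show ?thesis .
  qed
  have smD: "(\<lambda>w. (D + 1) * \<theta> ^ m * (Gr w * B w)) summable_on words_to n (\<omega> 0)"
    by (rule summable_on_cmult_right[OF smB])
  have abs: "(\<lambda>w. norm (trm n f \<omega> w - trm n f \<upsilon> w)) summable_on words_to n (\<omega> 0)"
    by (rule Infinite_Sum.abs_summable_on_comparison_test'[OF smD diff])
  have split: "(L ^^ n) f \<omega> - (L ^^ n) f \<upsilon> = infsum (\<lambda>w. trm n f \<omega> w - trm n f \<upsilon> w) (words_to n (\<omega> 0))"
    unfolding it[OF \<omega>] it[OF \<upsilon>] eq0
    using infsum_add[OF ts(1) iffD2[OF summable_on_uminus ts(2)]] by (simp add: infsum_uminus)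
  have "cmod ((L ^^ n) f \<omega> - (L ^^ n) f \<upsilon>) \<le> infsum (\<lambda>w. norm (trm n f \<omega> w - trm n f \<upsilon> w)) (words_to n (\<omega> 0))"
    unfolding split by (rule Infinite_Sum.norm_infsum_bound[OF abs])
  also have "\<dots> \<le> infsum (\<lambda>w. (D + 1) * \<theta> ^ m * (Gr w * B w)) (words_to n (\<omega> 0))"
    by (rule infsum_mono[OF abs smD diff])
  also have "\<dots> = (D + 1) * \<theta> ^ m * infsum (\<lambda>w. Gr w * B w) (words_to n (\<omega> 0))"
    by (rule infsum_cmult_right')
  also have "\<dots> \<le> (D + 1) * \<theta> ^ m * infsum (\<lambda>w. Gr w * B w) (words n)"
    using D_nonneg \<theta> by (intro mult_left_mono le) auto
  finally show "cmod ((L ^^ n) f \<omega> - (L ^^ n) f \<upsilon>)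
      \<le> ((D + 1) * infsum (\<lambda>w. Gr w * B w) (words n)) * \<theta> ^ m" by (simp add: ac_simps)
qed

section \<open>The transfer operator on the Lipschitz space\<close>

lemma X_nonempty: "X \<noteq> {}"
  using periodic XM_subset by (auto simp: has_periodic_point_def)

sublocale lipschitz_space X \<theta> k
  using \<theta> X_nonempty by unfold_locales auto

abbreviation V :: "((nat \<Rightarrow> 's) \<Rightarrow> complex) set" where "V \<equiv> Fb X \<theta> k"

abbreviation N :: "((nat \<Rightarrow> 's) \<Rightarrow> complex) \<Rightarrow> real" where "N \<equiv> FbN X \<theta> k 1"

lemma fun_space_1: "fun_space V N"
  by (rule fun_space) simp

lemma N_bounds: "f \<in> V \<Longrightarrow> supn X f \<le> N f" "f \<in> V \<Longrightarrow> lipn X \<theta> k f \<le> N f"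
  using FbD(4,5) by (auto simp: FbN_def)

text \<open>The constant \<open>D + 2\<close> adds 1 for the supremum norm to \<open>D + 1\<close>
  for the Lipschitz constant.\<close>

lemma transfer_N:
  assumes f: "f \<in> V" and n: "0 < n" and B: "(\<lambda>w. Gr w * B w) summable_on words n"
    and f1: "\<And>w x. w \<in> words n \<Longrightarrow> x \<in> cylinder X w \<Longrightarrow> cmod (f x) \<le> B w"
    and f2: "\<And>w x y m. w \<in> words n \<Longrightarrow> k \<le> m \<Longrightarrow> x \<in> cylinder X w \<Longrightarrow> y \<in> cylinder X w \<Longrightarrow>
      \<forall>i<n + m. x i = y i \<Longrightarrow> cmod (f x - f y) \<le> B w * \<theta> ^ m"
    and Bnn: "\<And>w. w \<in> words n \<Longrightarrow> 0 \<le> B w"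
  shows "(L ^^ n) f \<in> V" "N ((L ^^ n) f) \<le> (D + 2) * infsum (\<lambda>w. Gr w * B w) (words n)"
proof -
  let ?s = "infsum (\<lambda>w. Gr w * B w) (words n)"
  have bdd: "cmod (f x) \<le> supn X f" if "x \<in> X" for x by (rule FbD(2)[OF f])
  have s: "0 \<le> ?s" using Gr(2) Bnn by (intro infsum_nonneg mult_nonneg_nonneg) auto
  have 1: "cmod ((L ^^ n) f \<omega>) \<le> ?s" if "\<omega> \<in> X" for \<omega>
    by (rule transfer_estimate(1)[OF bdd B f1 f2 Bnn that])
  have 2: "cmod ((L ^^ n) f \<omega> - (L ^^ n) f \<upsilon>) \<le> ((D + 1) * ?s) * \<theta> ^ m"
    if "k \<le> m" "\<omega> \<in> X" "\<upsilon> \<in> X" "\<forall>i<m. \<omega> i = \<upsilon> i" for m \<omega> \<upsilon>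
    by (rule transfer_estimate(2)[OF bdd B f1 f2 Bnn that])
  have 3: "0 \<le> (D + 1) * ?s" using D_nonneg s by simp
  show "(L ^^ n) f \<in> V" by (rule FbI(1)[OF transfer_off[OF _ n] 1 3 2])
  have "supn X ((L ^^ n) f) \<le> ?s" by (rule FbI(2)[OF transfer_off[OF _ n] 1 3 2])
  moreover have "lipn X \<theta> k ((L ^^ n) f) \<le> (D + 1) * ?s" by (rule FbI(3)[OF transfer_off[OF _ n] 1 3 2])
  ultimately show "N ((L ^^ n) f) \<le> (D + 2) * ?s" by (simp add: FbN_def algebra_simps)
qed

lemma transfer_bop: "fun_space.bop V N L"
  unfolding fun_space.bop_def[OF fun_space_1]
proof (intro conjI ballI allI exI[of _ "(D + 2) * infsum Gr (words 1)"])
  have main: "(L ^^ 1) f \<in> V" "N ((L ^^ 1) f) \<le> (D + 2) * infsum (\<lambda>w. Gr w * N f) (words 1)" if f: "f \<in> V" for f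
  proof -
    have 0: "0 < (1 :: nat)" by simp
    have Nf: "0 \<le> N f" using fun_space.N_nonneg[OF fun_space_1 f] .
    have 1: "cmod (f x) \<le> N f" for x using fun_space.N_eval[OF fun_space_1 f] .
    have 2: "cmod (f x - f y) \<le> N f * \<theta> ^ m" if "k \<le> m" "x \<in> cylinder X w" "y \<in> cylinder X w" "\<forall>i<1 + m. x i = y i"
      for w x y m
    proof -
      have "cmod (f x - f y) \<le> lipn X \<theta> k f * \<theta> ^ m"
        using that by (intro FbD(3)[OF f]) (auto simp: cylinder_def)
      also have "\<dots> \<le> N f * \<theta> ^ m" using N_bounds(2)[OF f] \<theta> by (intro mult_right_mono) auto
      finally show ?thesis .
    qed
    note sm = summable_on_cmult_left[OF Gr_summable_words[of 1], of "N f"]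
    show "(L ^^ 1) f \<in> V"
      by (rule transfer_N(1)[where B = "\<lambda>_. N f" and n = 1, OF f 0 sm]) (rule 1 Nf | erule (3) 2)+
    show "N ((L ^^ 1) f) \<le> (D + 2) * infsum (\<lambda>w. Gr w * N f) (words 1)"
      by (rule transfer_N(2)[where B = "\<lambda>_. N f" and n = 1, OF f 0 sm]) (rule 1 Nf | erule (3) 2)+
  qed
  show "L f \<in> V" if "f \<in> V" for f using main(1)[OF that] by simp
  show "N (L f) \<le> (D + 2) * infsum Gr (words 1) * N f" if "f \<in> V" for f
    using main(2)[OF that] by (simp add: infsum_cmult_left')
  have it: "L f \<omega> = infsum (trm 1 f \<omega>) (words_to 1 (\<omega> 0))" if "f \<in> V" "\<omega> \<in> X" for f \<omega>
    using transfer_iterate[where f = f and n = 1, OF FbD(2)[OF that(1)] that(2)] by simp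
  fix f assume f: "f \<in> V"
  show "L (\<lambda>x. f x + g x) = (\<lambda>x. L f x + L g x)" if g: "g \<in> V" for g
  proof
    fix \<omega>
    show "L (\<lambda>x. f x + g x) \<omega> = L f \<omega> + L g \<omega>"
    proof (cases "\<omega> \<in> X")
      case True
      have "L f \<omega> + L g \<omega> = infsum (\<lambda>w. trm 1 f \<omega> w + trm 1 g \<omega> w) (words_to 1 (\<omega> 0))"
        unfolding it[OF f True] it[OF g True]
        using trm_summable(2)[where f = f, OF FbD(2)[OF f] True] trm_summable(2)[where f = g, OF FbD(2)[OF g] True]
        by (rule infsum_add[symmetric])
      also have "\<dots> = L (\<lambda>x. f x + g x) \<omega>"
        unfolding it[OF fun_space.add_mem[OF fun_space_1 f g] True]
        by (intro infsum_cong) (simp add: trm_def distrib_left)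
      finally show ?thesis by simp
    qed (simp add: transfer_op_def)
  qed
  show "L (\<lambda>x. c * f x) = (\<lambda>x. c * L f x)" for c
  proof
    fix \<omega>
    show "L (\<lambda>x. c * f x) \<omega> = c * L f \<omega>"
    proof (cases "\<omega> \<in> X")
      case True
      have "c * L f \<omega> = infsum (\<lambda>w. c * trm 1 f \<omega> w) (words_to 1 (\<omega> 0))"
        unfolding it[OF f True] by (simp add: infsum_cmult_right')
      also have "\<dots> = L (\<lambda>x. c * f x) \<omega>"
        unfolding it[OF fun_space.scale_mem[OF fun_space_1 f] True]
        by (intro infsum_cong) (simp add: trm_def ac_simps)
      finally show ?thesis by simp
    qed (simp add: transfer_op_def)
  qed
qed

section \<open>Finite rank approximation and the upper bound\<close>

definition ind :: "'s list \<Rightarrow> (nat \<Rightarrow> 's) \<Rightarrow> complex" where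
  "ind w x = (if x \<in> cylinder X w then 1 else 0)"

lemma ind_mem: "ind w \<in> V"
proof (rule FbI(1)[of _ 1 "1 / \<theta> ^ length w"])
  fix m \<omega> \<upsilon> assume X: "\<omega> \<in> X" "\<upsilon> \<in> X" and agree: "\<forall>i<m. \<omega> i = \<upsilon> i"
  show "cmod (ind w \<omega> - ind w \<upsilon>) \<le> 1 / \<theta> ^ length w * \<theta> ^ m"
  proof (cases "length w \<le> m")
    case True
    then have "\<omega> \<in> cylinder X w \<longleftrightarrow> \<upsilon> \<in> cylinder X w" using X agree by (auto simp: cylinder_def)
    then show ?thesis using \<theta> by (simp add: ind_def)
  next
    case False
    have "cmod (ind w \<omega> - ind w \<upsilon>) \<le> 1" by (simp add: ind_def)
    also have "1 \<le> 1 / \<theta> ^ length w * \<theta> ^ m"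
      using False \<theta> power_decreasing[of m "length w" \<theta>] by (simp add: field_simps)
    finally show ?thesis .
  qed
qed (use \<theta> in \<open>auto simp: ind_def cylinder_def\<close>)

lemma in_cylinder_length: "x \<in> cylinder X w \<Longrightarrow> x \<in> cylinder X u \<Longrightarrow> length w = length u \<Longrightarrow> w = u"
  using in_cylinder_iff by metis

lemma words_real_bound:
  assumes "\<Lambda> < \<eta>"
  shows "\<exists>C\<ge>0. \<forall>n. infsum Gr (words n) \<le> C * \<eta> ^ n"
proof -
  obtain C where C: "0 \<le> C" "\<And>n. infsum G {w. admissible M w \<and> length w = n} \<le> ennreal (C * \<eta> ^ n)"
    using words_upper[OF assms] by blast
  have \<eta>: "0 < \<eta>" using assms \<Lambda>_pos by simp
  have "infsum Gr (words n) \<le> C * \<eta> ^ n" for n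
  proof -
    have "ennreal (infsum Gr (words n)) = infsum (\<lambda>w. ennreal (Gr w)) (words n)"
      by (rule infsum_ennreal_of_real[OF Gr(2) Gr_summable_words, symmetric])
    also have "\<dots> \<le> ennreal (C * \<eta> ^ n)" using C(2)[of n] unfolding Gr(1) words_def .
    finally show ?thesis using C(1) \<eta> by (subst (asm) ennreal_le_iff) auto
  qed
  then show ?thesis using C(1) by blast
qed

lemma words_tail:
  assumes "0 < \<epsilon>"
  shows "\<exists>W. finite W \<and> W \<subseteq> words n \<and> infsum Gr (words n - W) \<le> \<epsilon>"
proof -
  have fin: "infsum (\<lambda>w. ennreal (Gr w)) (words n) < \<infinity>"
    unfolding infsum_ennreal_of_real[OF Gr(2) Gr_summable_words] by simp
  obtain W where W: "finite W" "W \<subseteq> words n" "infsum (\<lambda>w. ennreal (Gr w)) (words n - W) \<le> ennreal \<epsilon>"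
    using infsum_ennreal_tail[OF fin, of "ennreal \<epsilon>"] assms by auto
  have "infsum (\<lambda>w. ennreal (Gr w)) (words n - W) = ennreal (infsum Gr (words n - W))"
    by (rule infsum_ennreal_of_real[OF Gr(2) summable_on_subset_banach[OF Gr_summable_words]]) auto
  then have "infsum Gr (words n - W) \<le> \<epsilon>" using W(3) assms by (simp add: ennreal_le_iff)
  then show ?thesis using W by blast
qed

text \<open>The remainder is \<open>L ^^ n\<close> of \<open>r = f - h\<close>. On cylinders of
  \<open>W\<close>, \<open>r\<close> is \<open>f\<close> minus one of its values there, hence of
  size \<open>\<theta> ^ n\<close>; on the others it is \<open>f\<close> itself, but their total
  weight is small. If a cylinder is empty, \<open>p w\<close> is arbitrary and \<open>ind w\<close>
  vanishes.\<close>

lemma finite_rank_remainder: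
  assumes f: "f \<in> V" and W: "finite W" "W \<subseteq> words n" and n: "0 < n" "k \<le> n"
  defines "p \<equiv> \<lambda>w. SOME x. x \<in> cylinder X w"
  shows "N (\<lambda>x. (L ^^ n) f x - (\<Sum>w\<in>W. f (p w) * (L ^^ n) (ind w) x))
    \<le> (D + 2) * (\<theta> ^ n * infsum Gr (words n) + infsum Gr (words n - W)) * N f"
proof -
  interpret fs: fun_space V N by (rule fun_space_1)
  have Ln: "fs.bop (L ^^ n)" by (rule fs.bop_funpow[OF transfer_bop])
  have Nf: "0 \<le> N f" by (rule fs.N_nonneg[OF f])
  define h where "h = (\<lambda>x. \<Sum>w\<in>W. f (p w) * ind w x)"
  have h: "h \<in> V" unfolding h_def by (intro fs.lincomb_mem ind_mem)
  define r where "r = (\<lambda>x. f x - h x)"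
  have r: "r \<in> V" unfolding r_def by (rule fs.diff_mem[OF f h])
  have "(L ^^ n) h = (\<lambda>x. \<Sum>w\<in>W. f (p w) * (L ^^ n) (ind w) x)"
    unfolding h_def by (rule fs.bop_lincomb[OF Ln ind_mem])
  then have Lr: "(L ^^ n) r = (\<lambda>x. (L ^^ n) f x - (\<Sum>w\<in>W. f (p w) * (L ^^ n) (ind w) x))"
    unfolding r_def fs.bop_diff[OF Ln f h] by simp
  have hw: "h x = (if w \<in> W then f (p w) else 0)" if w: "w \<in> words n" and x: "x \<in> cylinder X w" for w x
  proof -
    have "h x = (\<Sum>u\<in>W. if u = w then f (p w) else 0)"
      unfolding h_def
    proof (rule sum.cong[OF refl])
      fix u assume "u \<in> W"
      then have "length u = length w" using W(2) w by (auto simp: words_def)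
      then have "u = w" if "x \<in> cylinder X u" using in_cylinder_length[OF x that] by simp
      then show "f (p u) * ind u x = (if u = w then f (p w) else 0)"
        using x by (cases "u = w") (auto simp: ind_def)
    qed
    then show ?thesis using W(1) by simp
  qed
  define B where "B w = (if w \<in> W then \<theta> ^ n else 1) * N f" for w
  have B1: "cmod (r x) \<le> B w" if w: "w \<in> words n" and x: "x \<in> cylinder X w" for w x
  proof (cases "w \<in> W")
    case True
    have pw: "p w \<in> cylinder X w" unfolding p_def using someI[of "\<lambda>x. x \<in> cylinder X w" x] x by simp
    have "\<forall>i<n. x i = p w i" using x pw w by (auto simp: cylinder_def words_def)
    then have "cmod (f x - f (p w)) \<le> lipn X \<theta> k f * \<theta> ^ n"
      using x pw n by (intro FbD(3)[OF f]) (auto simp: cylinder_def)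
    also have "\<dots> \<le> N f * \<theta> ^ n" using N_bounds(2)[OF f] \<theta> by (intro mult_right_mono) auto
    finally show ?thesis using True by (simp add: r_def hw[OF w x] B_def mult.commute)
  next
    case False
    then show ?thesis using fs.N_eval[OF f, of x] by (simp add: r_def hw[OF w x] B_def)
  qed
  have B2: "cmod (r x - r y) \<le> B w * \<theta> ^ m"
    if w: "w \<in> words n" and m: "k \<le> m" and x: "x \<in> cylinder X w" and y: "y \<in> cylinder X w"
      and agree: "\<forall>i<n + m. x i = y i" for w x y m
  proof -
    \<comment> \<open>\<open>h\<close> is constant on the cylinder of \<open>w\<close>, so
      \<open>r\<close> varies as \<open>f\<close> does; agreement on \<open>n + m\<close> letters
      gives the additional factor \<open>\<theta> ^ n\<close>.\<close>
    have "cmod (f x - f y) \<le> lipn X \<theta> k f * \<theta> ^ (n + m)"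
      using x y m agree by (intro FbD(3)[OF f]) (auto simp: cylinder_def)
    also have "\<dots> \<le> N f * \<theta> ^ (n + m)" using N_bounds(2)[OF f] \<theta> by (intro mult_right_mono) auto
    also have "\<dots> = (\<theta> ^ n * N f) * \<theta> ^ m" by (simp add: power_add)
    also have "\<dots> \<le> B w * \<theta> ^ m"
      unfolding B_def using \<theta> Nf power_le_one[of \<theta> n] by (intro mult_right_mono) auto
    finally show ?thesis by (simp add: r_def hw[OF w x] hw[OF w y])
  qed
  have B0: "0 \<le> B w" for w unfolding B_def using \<theta> Nf by simp
  have smW: "(\<lambda>w. Gr w * B w) summable_on W" by (rule summable_on_finite[OF W(1)])
  have smC: "(\<lambda>w. Gr w * B w) summable_on (words n - W)"
  proof -
    have "(\<lambda>w. Gr w * N f) summable_on (words n - W)"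
      by (rule summable_on_cmult_left[OF summable_on_subset_banach[OF Gr_summable_words]]) auto
    then show ?thesis by (subst summable_on_cong[where g = "\<lambda>w. Gr w * N f"]) (auto simp: B_def)
  qed
  have un: "words n = W \<union> (words n - W)" using W(2) by blast
  have sm: "(\<lambda>w. Gr w * B w) summable_on words n"
    by (subst un, rule summable_on_Un_disjoint[OF smW smC]) auto
  have "infsum (\<lambda>w. Gr w * B w) (words n)
      = infsum (\<lambda>w. Gr w * B w) W + infsum (\<lambda>w. Gr w * B w) (words n - W)"
    by (subst un, rule infsum_Un_disjoint[OF smW smC]) auto
  also have "infsum (\<lambda>w. Gr w * B w) W = (\<Sum>w\<in>W. Gr w) * (\<theta> ^ n * N f)"
    using W(1) by (simp add: B_def sum_distrib_right)
  also have "infsum (\<lambda>w. Gr w * B w) (words n - W) = infsum (\<lambda>w. Gr w * N f) (words n - W)"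
    by (rule infsum_cong) (simp add: B_def)
  also have "\<dots> = infsum Gr (words n - W) * N f" by (rule infsum_cmult_left')
  also have "(\<Sum>w\<in>W. Gr w) * (\<theta> ^ n * N f) \<le> infsum Gr (words n) * (\<theta> ^ n * N f)"
    using W Gr(2) \<theta> Nf by (intro mult_right_mono finite_sum_le_infsum Gr_summable_words) auto
  finally have le: "infsum (\<lambda>w. Gr w * B w) (words n)
      \<le> (\<theta> ^ n * infsum Gr (words n) + infsum Gr (words n - W)) * N f"
    by (simp add: algebra_simps)
  have "N ((L ^^ n) r) \<le> (D + 2) * infsum (\<lambda>w. Gr w * B w) (words n)"
    by (rule transfer_N(2)[where B = B, OF r n(1) sm B1 B2 B0])
  also have "\<dots> \<le> (D + 2) * ((\<theta> ^ n * infsum Gr (words n) + infsum Gr (words n - W)) * N f)"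
    using le D_nonneg by (intro mult_left_mono) auto
  finally show ?thesis unfolding Lr by (simp add: mult.assoc)
qed

theorem spectrum_outside_disc:
  assumes z: "z \<in> spectrum V N L" "\<Lambda> * \<theta> < cmod z"
  shows "z isolated_in spectrum V N L \<and> eigenvalue V L z \<and> finite_algebraic_multiplicity V N L z"
proof -
  interpret fs: fun_space V N by (rule fun_space_1)
  obtain \<rho> where \<rho>: "\<Lambda> * \<theta> < \<rho>" "\<rho> < cmod z" using dense[OF z(2)] by blast
  \<comment> \<open>A growth rate above \<Lambda> that still satisfies
    \<open>\<eta> * \<theta> < \<rho>\<close>.\<close>
  define \<eta> where "\<eta> = (\<Lambda> + \<rho> / \<theta>) / 2"
  have mid: "a < (a + b) / 2 \<and> (a + b) / 2 < b" if "a < b" for a b :: real using that by simp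
  have "\<Lambda> < \<rho> / \<theta>" using \<rho>(1) \<theta> by (simp add: field_simps)
  then have \<eta>: "\<Lambda> < \<eta>" "\<eta> < \<rho> / \<theta>" unfolding \<eta>_def using mid by blast+
  have \<eta>0: "0 < \<eta>" using \<eta> \<Lambda>_pos by simp
  have \<rho>0: "0 < \<rho>" using \<rho>(1) \<Lambda>_pos \<theta> by (smt (verit) mult_pos_pos)
  obtain C where C: "0 \<le> C" "\<And>n. infsum Gr (words n) \<le> C * \<eta> ^ n" using words_real_bound[OF \<eta>(1)] by blast
  \<comment> \<open>Its powers absorb the constant \<open>(D + 2) * (C + 1)\<close>, so that for
    large \<open>n\<close> the remainder is at most \<open>\<rho> ^ n\<close> without any
    factor.\<close>
  define q where "q = \<eta> * \<theta> / \<rho>"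
  have q: "0 < q" "q < 1" using \<eta> \<eta>0 \<rho>0 \<theta> by (auto simp: q_def field_simps)
  have "(\<lambda>n. (D + 2) * (C + 1) * q ^ n) \<longlonglongrightarrow> (D + 2) * (C + 1) * 0"
    using q by (intro tendsto_intros LIMSEQ_power_zero) auto
  then have "\<forall>\<^sub>F n in sequentially. (D + 2) * (C + 1) * q ^ n < 1" by (intro order_tendstoD) auto
  then obtain n where n: "k \<le> n" "(D + 2) * (C + 1) * q ^ n < 1"
    using eventually_happens[OF eventually_conj[OF _ eventually_ge_at_top[of k]]] by auto
  have n0: "0 < n" using n(1) k by simp
  have small: "(D + 2) * (C + 1) * (\<eta> * \<theta>) ^ n \<le> \<rho> ^ n"
    using n(2) \<rho>0 by (simp add: q_def power_divide field_simps)
  \<comment> \<open>The discarded words are given the same size as the discretisation error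
    \<open>(\<eta> * \<theta>) ^ n\<close>.\<close>
  obtain W where W: "finite W" "W \<subseteq> words n" "infsum Gr (words n - W) \<le> (\<eta> * \<theta>) ^ n"
    using words_tail[of "(\<eta> * \<theta>) ^ n" n] \<eta>0 \<theta> by auto
  obtain e where e: "bij_betw e {0..<card W} W" using ex_bij_betw_nat_finite[OF W(1)] by blast
  define p where "p w = (SOME x. x \<in> cylinder X w)" for w
  have Ln: "fs.bop (L ^^ n)" by (rule fs.bop_funpow[OF transfer_bop])
  have rem: "N (\<lambda>x. (L ^^ n) f x - (\<Sum>i<card W. f (p (e i)) * (L ^^ n) (ind (e i)) x)) \<le> \<rho> ^ n * N f"
    if f: "f \<in> V" for f
  proof -
    have re: "(\<Sum>i<card W. f (p (e i)) * (L ^^ n) (ind (e i)) x) = (\<Sum>w\<in>W. f (p w) * (L ^^ n) (ind w) x)" for x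
      using sum.reindex_bij_betw[OF e, of "\<lambda>w. f (p w) * (L ^^ n) (ind w) x"] by (simp add: lessThan_atLeast0)
    have "\<theta> ^ n * infsum Gr (words n) \<le> \<theta> ^ n * (C * \<eta> ^ n)" using C(2) \<theta> by (intro mult_left_mono) auto
    then have "\<theta> ^ n * infsum Gr (words n) + infsum Gr (words n - W) \<le> (C + 1) * (\<eta> * \<theta>) ^ n"
      using W(3) by (simp add: power_mult_distrib algebra_simps)
    then have "(D + 2) * (\<theta> ^ n * infsum Gr (words n) + infsum Gr (words n - W)) * N f
        \<le> (D + 2) * ((C + 1) * (\<eta> * \<theta>) ^ n) * N f"
      using D_nonneg fs.N_nonneg[OF f] by (intro mult_right_mono mult_left_mono) auto
    also have "\<dots> \<le> \<rho> ^ n * N f"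
      using small fs.N_nonneg[OF f] by (intro mult_right_mono) (auto simp: mult.assoc)
    finally have le: "(D + 2) * (\<theta> ^ n * infsum Gr (words n) + infsum Gr (words n - W)) * N f \<le> \<rho> ^ n * N f" .
    show ?thesis
      unfolding re unfolding p_def using order_trans[OF finite_rank_remainder[OF f W(1,2) n0 n(1)] le] .
  qed
  interpret qc: quasi_compact_op V N L n "card W" \<rho> "\<lambda>i f. f (p (e i))" "\<lambda>i. (L ^^ n) (ind (e i))"
  proof
    show "fs.bop L" by (rule transfer_bop)
    show "fs.bfun (\<lambda>f. f (p (e i)))" for i by (rule fs.bfun_eval)
    show "(L ^^ n) (ind (e i)) \<in> V" for i by (rule fs.bopD(1)[OF Ln ind_mem])
  qed (use n0 \<rho>0 rem in auto)
  show ?thesis using qc.spectrum_outside[OF z(1) \<rho>(2)] by blast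
qed

end

section \<open>The essential spectral radius from below\<close>

context lipschitz_space
begin

text \<open>For functions that inspect the first \<open>n0\<close> letters. If points agree on fewer
  letters, the trivial bound \<open>2 * B\<close> is at most
  \<open>2 * B / \<theta> ^ n0 * \<theta> ^ m\<close>.\<close>

lemma Fb_largeI:
  assumes "\<And>\<omega>. \<omega> \<notin> X \<Longrightarrow> f \<omega> = 0" and B: "\<And>\<omega>. \<omega> \<in> X \<Longrightarrow> cmod (f \<omega>) \<le> B" and C: "0 \<le> C"
    and large: "\<And>m \<omega> \<upsilon>. n0 \<le> m \<Longrightarrow> \<omega> \<in> X \<Longrightarrow> \<upsilon> \<in> X \<Longrightarrow> \<forall>i<m. \<omega> i = \<upsilon> i \<Longrightarrow> cmod (f \<omega> - f \<upsilon>) \<le> C * \<theta> ^ m"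
  shows "f \<in> Fb X \<theta> k" "supn X f \<le> B" "lipn X \<theta> k f \<le> C + 2 * B / \<theta> ^ n0"
proof -
  obtain \<omega> where "\<omega> \<in> X" using X_ne by blast
  then have B0: "0 \<le> B" using B[of \<omega>] norm_ge_zero[of "f \<omega>"] by linarith
  have t: "0 < \<theta> ^ m" for m using \<theta>01 by simp
  have *: "cmod (f \<omega> - f \<upsilon>) \<le> (C + 2 * B / \<theta> ^ n0) * \<theta> ^ m"
    if m: "\<omega> \<in> X" "\<upsilon> \<in> X" "\<forall>i<m. \<omega> i = \<upsilon> i" for m \<omega> \<upsilon>
  proof (cases "n0 \<le> m")
    case True
    have "0 \<le> 2 * B / \<theta> ^ n0 * \<theta> ^ m"
      using B0 t by (intro mult_nonneg_nonneg divide_nonneg_nonneg) (auto intro: less_imp_le)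
    then show ?thesis using large[OF True m] by (simp add: distrib_right)
  next
    case False
    have "cmod (f \<omega> - f \<upsilon>) \<le> 2 * B"
      using norm_triangle_ineq4[of "f \<omega>" "f \<upsilon>"] B[OF m(1)] B[OF m(2)] by linarith
    also have "\<theta> ^ n0 \<le> \<theta> ^ m" using False \<theta>01 by (intro power_decreasing) auto
    then have "2 * B * \<theta> ^ n0 \<le> 2 * B * \<theta> ^ m" using B0 by (intro mult_left_mono) auto
    then have "2 * B \<le> 2 * B / \<theta> ^ n0 * \<theta> ^ m" using t[of n0] by (simp add: field_simps)
    also have "\<dots> \<le> (C + 2 * B / \<theta> ^ n0) * \<theta> ^ m" using C t[of m] by (simp add: distrib_right)
    finally show ?thesis .
  qed
  have nn: "0 \<le> C + 2 * B / \<theta> ^ n0" using C B0 t[of n0] by simp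
  show "f \<in> Fb X \<theta> k" by (rule FbI(1)[OF assms(1) B nn *])
  show "supn X f \<le> B" by (rule FbI(2)[OF assms(1) B nn *])
  show "lipn X \<theta> k f \<le> C + 2 * B / \<theta> ^ n0" by (rule FbI(3)[OF assms(1) B nn *])
qed

end

section \<open>Branching in the Markov shift\<close>

lemma successor_deterministic:
  assumes det: "\<And>b a a'. A b a = 1 \<Longrightarrow> A b a' = 1 \<Longrightarrow> a = a'"
    and \<omega>: "\<omega> \<in> path_space UNIV A" and \<upsilon>: "\<upsilon> \<in> path_space UNIV A" and eq: "\<upsilon> 0 = \<omega> N"
  shows "\<upsilon> = (lshift ^^ N) \<omega>"
proof
  fix i show "\<upsilon> i = (lshift ^^ N) \<omega> i"
  proof (induction i)
    case (Suc i)
    have "A (\<upsilon> i) (\<upsilon> (Suc i)) = 1" using \<upsilon> by (simp add: path_space_def)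
    moreover have "A (\<upsilon> i) (\<omega> (Suc (N + i))) = 1" using Suc \<omega> by (simp add: path_space_def funpow_lshift)
    ultimately show ?case using det by (simp add: funpow_lshift)
  qed (simp add: eq funpow_lshift)
qed

text \<open>If every letter had at most one successor, a path would be determined by its first
  letter. Irreducibility leads from the periodic orbit to any letter that starts a path, so the
  whole space would be that orbit.\<close>

lemma branching_letter:
  assumes irr: "finitely_irreducible A" and per: "has_periodic_point (path_space UNIV A)"
    and not_orbit: "\<not> finite_single_orbit (path_space UNIV A)"
  obtains b a a' where "A b a = 1" "A b a' = 1" "a \<noteq> a'"
proof (rule ccontr)
  assume none: "\<not> thesis"
  note witness = that
  have det: "a = a'" if "A b a = 1" "A b a' = 1" for b a a'
    using witness[OF that] none by blast
  obtain \<omega> p where \<omega>: "\<omega> \<in> path_space UNIV A" "1 \<le> p" "(lshift ^^ p) \<omega> = \<omega>"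
    using per by (auto simp: has_periodic_point_def)
  have "path_space UNIV A = (\<lambda>i. (lshift ^^ i) \<omega>) ` {..<p}"
  proof
    show "(\<lambda>i. (lshift ^^ i) \<omega>) ` {..<p} \<subseteq> path_space UNIV A" using funpow_lshift_path[OF \<omega>(1)] by auto
    show "path_space UNIV A \<subseteq> (\<lambda>i. (lshift ^^ i) \<omega>) ` {..<p}"
    proof
      fix \<upsilon> assume \<upsilon>: "\<upsilon> \<in> path_space UNIV A"
      obtain w where w: "admissible A (\<omega> 0 # w @ [\<upsilon> 0])"
        using irr unfolding finitely_irreducible_def by blast
      let ?l = "\<omega> 0 # w @ [\<upsilon> 0]"
      \<comment> \<open>Successors being unique, the connecting word has to follow \<omega>.\<close>
      have "i < length ?l \<Longrightarrow> ?l ! i = \<omega> i" for i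
      proof (induction i)
        case (Suc i)
        then have "A (\<omega> i) (?l ! Suc i) = 1" using w unfolding admissible_nth by (metis Suc_lessD)
        moreover have "A (\<omega> i) (\<omega> (Suc i)) = 1" using \<omega>(1) by (simp add: path_space_def)
        ultimately show ?case by (rule det)
      qed simp
      from this[of "Suc (length w)"] have "\<upsilon> 0 = \<omega> (Suc (length w))" by (simp add: nth_append)
      from successor_deterministic[OF _ \<omega>(1) \<upsilon> this] det
      have "\<upsilon> = (lshift ^^ Suc (length w)) \<omega>" by blast
      also have "\<dots> = (lshift ^^ (Suc (length w) mod p)) \<omega>"
        by (rule funpow_mod_eq[symmetric]) (rule \<omega>(3))
      finally show "\<upsilon> \<in> (\<lambda>i. (lshift ^^ i) \<omega>) ` {..<p}" using \<omega>(2) by (intro image_eqI) auto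
    qed
  qed
  then show False using not_orbit \<omega>(2) unfolding finite_single_orbit_def by blast
qed

lemma admissible_glue:
  "admissible A (u @ [b]) \<Longrightarrow> admissible A (b # w) \<Longrightarrow> admissible A (u @ b # w)"
  by (auto simp: admissible_def successively_append_iff)

text \<open>Two different return words from \<open>b\<close> to \<open>b\<close>, one through
  \<open>a\<close> and one through \<open>a'\<close>, are traversed in both orders. The total length
  is the same in both cases, so the tails match even if the return words have different
  lengths.\<close>

lemma eventually_equal_paths:
  assumes irr: "finitely_irreducible A" and per: "has_periodic_point (path_space UNIV A)"
    and not_orbit: "\<not> finite_single_orbit (path_space UNIV A)"
    and u: "admissible A u" "u \<noteq> []"
  shows "\<exists>x\<in>cylinder (path_space UNIV A) u. \<exists>x'\<in>cylinder (path_space UNIV A) u.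
    x \<noteq> x' \<and> (\<exists>n0. \<forall>i\<ge>n0. x i = x' i)"
proof -
  have conn: "\<exists>w. admissible A (a # w @ [b])" for a b
    using irr unfolding finitely_irreducible_def by blast
  obtain b a a' where b: "A b a = 1" "A b a' = 1" "a \<noteq> a'"
    using branching_letter[OF irr per not_orbit] by blast
  obtain \<omega> where \<omega>: "\<omega> \<in> path_space UNIV A" using per by (auto simp: has_periodic_point_def)
  obtain wt where wt: "admissible A (b # wt @ [\<omega> 0])" using conn by blast
  \<comment> \<open>A common tail that starts with \<open>b\<close>.\<close>
  define \<tau> where "\<tau> = conc (b # wt) \<omega>"
  have \<tau>: "\<tau> \<in> path_space UNIV A"
    using conc_in_cylinder[OF \<omega>, of "b # wt"] wt unfolding \<tau>_def by (simp add: cylinder_def)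
  have \<tau>0: "\<tau> 0 = b" by (simp add: \<tau>_def prepend_def)
  obtain w where w: "admissible A (a # w @ [b])" using conn by blast
  obtain w' where w': "admissible A (a' # w' @ [b])" using conn by blast
  obtain w0 where w0: "admissible A (last u # w0 @ [b])" using conn by blast
  have P: "admissible A ((b # a # w) @ [b])" "admissible A ((b # a' # w') @ [b])"
    using w w' b by (auto simp: admissible_def successively_Cons)
  have "admissible A (butlast u @ last u # w0 @ [b])"
    by (rule admissible_glue[OF _ w0]) (use u in simp)
  moreover have "butlast u @ last u # w0 @ [b] = (u @ w0) @ [b]"
    using arg_cong[OF append_butlast_last_id[OF u(2)], of "\<lambda>v. v @ w0 @ [b]"] by simp
  ultimately have u0: "admissible A ((u @ w0) @ [b])" by simp
  have full: "admissible A (((u @ w0) @ b # p @ b # q) @ [\<tau> 0])"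
    if "admissible A ((b # p) @ [b])" "admissible A ((b # q) @ [b])" for p q
  proof -
    have "admissible A (b # q @ [b])" using that(2) by simp
    then have "admissible A ((b # p) @ b # q @ [b])" by (rule admissible_glue[OF that(1)])
    then have "admissible A (b # (p @ b # q @ [b]))" by simp
    then have "admissible A ((u @ w0) @ b # (p @ b # q @ [b]))" by (rule admissible_glue[OF u0])
    then show ?thesis by (simp add: \<tau>0)
  qed
  define x where "x = conc ((u @ w0) @ b # (a # w) @ b # (a' # w')) \<tau>"
  define x' where "x' = conc ((u @ w0) @ b # (a' # w') @ b # (a # w)) \<tau>"
  have cyl: "conc ((u @ w0) @ v) \<tau> \<in> cylinder (path_space UNIV A) u"
    if "admissible A (((u @ w0) @ v) @ [\<tau> 0])" for v
    using cylinder_append[of _ UNIV A u "w0 @ v"] conc_in_cylinder[OF \<tau> that] by simp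
  have "x \<in> cylinder (path_space UNIV A) u" unfolding x_def using P by (intro cyl full) auto
  moreover have "x' \<in> cylinder (path_space UNIV A) u" unfolding x'_def using P by (intro cyl full) auto
  moreover have "x (Suc (length (u @ w0))) = a" "x' (Suc (length (u @ w0))) = a'"
    unfolding x_def x'_def by (simp_all add: conc_nth nth_append)
  then have "x \<noteq> x'" using b(3) by auto
  \<comment> \<open>The 4 counts the letters \<open>b\<close>, \<open>a\<close>, \<open>b\<close>,
    \<open>a'\<close> beside \<open>w\<close> and \<open>w'\<close>.\<close>
  moreover have "x i = x' i" if "length (u @ w0) + length w + length w' + 4 \<le> i" for i
    using that unfolding x_def x'_def by (simp add: conc_nth add.commute add.left_commute)
  ultimately show ?thesis by blast
qed

section \<open>Functions annihilated by a power of the operator\<close>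

context markov_subsystem
begin

text \<open>\<open>branch n x\<close> is normalised so that the transfer operator turns it into an indicator function;
  hence two different \<open>x\<close> with the same tail give a function in the kernel of \<open>L ^ n\<close>.\<close>

definition branch :: "nat \<Rightarrow> (nat \<Rightarrow> 's) \<Rightarrow> (nat \<Rightarrow> 's) \<Rightarrow> complex" where
  "branch n x \<omega> = of_real (exp (- S n \<omega>)) * ind (map x [0..<n + k]) \<omega>"

lemma branch_bound:
  assumes x: "x \<in> X"
  shows "cmod (branch n x \<omega>) \<le> exp (D - S n x)"
proof (cases "\<omega> \<in> cylinder X (map x [0..<n + k])")
  case True
  then have "\<omega> \<in> X" "\<forall>i<n + k. x i = \<omega> i" by (auto simp: cylinder_def)
  then have "S n x \<le> D + S n \<omega>" using distortion_D[OF x] by blast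
  then show ?thesis using True by (simp add: branch_def ind_def)
qed (simp add: branch_def ind_def)

lemma branch_mem:
  assumes x: "x \<in> X"
  shows "branch n x \<in> V"
proof (rule Fb_largeI(1)[OF _ branch_bound[OF x]])
  let ?b = "exp (D - S n x)"
  show "branch n x \<omega> = 0" if "\<omega> \<notin> X" for \<omega> using that by (simp add: branch_def ind_def cylinder_def)
  \<comment> \<open>The factor \<open>1 / \<theta> ^ n\<close> arises because, of \<open>m\<close>
    common letters, only \<open>m - n\<close> lie beyond the range of \<open>S n\<close> and count
    for the distortion.\<close>
  show "0 \<le> ?b * (D / \<theta> ^ n)" using D_nonneg \<theta> by simp
  fix m \<omega> \<upsilon> assume m: "n + k \<le> m" and X: "\<omega> \<in> X" "\<upsilon> \<in> X" and agree: "\<forall>i<m. \<omega> i = \<upsilon> i"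
  have iff: "\<omega> \<in> cylinder X (map x [0..<n + k]) \<longleftrightarrow> \<upsilon> \<in> cylinder X (map x [0..<n + k])"
    using X agree m by (auto simp: cylinder_def)
  show "cmod (branch n x \<omega> - branch n x \<upsilon>) \<le> ?b * (D / \<theta> ^ n) * \<theta> ^ m"
  proof (cases "\<omega> \<in> cylinder X (map x [0..<n + k])")
    case True
    have e: "exp (- S n \<omega>) \<le> ?b" "exp (- S n \<upsilon>) \<le> ?b"
      using branch_bound[OF x, of n \<omega>] branch_bound[OF x, of n \<upsilon>] True iff by (auto simp: branch_def ind_def)
    have "\<bar>exp (- S n \<omega>) - exp (- S n \<upsilon>)\<bar> \<le> ?b * \<bar>- S n \<omega> - - S n \<upsilon>\<bar>" by (rule exp_diff_le[OF e])
    also have "\<dots> \<le> ?b * (D * \<theta> ^ (m - n))"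
      using distortion[OF X, of n "m - n"] agree m by (intro mult_left_mono) (auto simp: abs_minus_commute)
    also have "D * \<theta> ^ (m - n) = D / \<theta> ^ n * \<theta> ^ m" using m \<theta> by (simp add: power_diff)
    finally have "\<bar>exp (- S n \<omega>) - exp (- S n \<upsilon>)\<bar> \<le> ?b * (D / \<theta> ^ n) * \<theta> ^ m" by (simp add: mult.assoc)
    moreover have "branch n x \<omega> - branch n x \<upsilon> = of_real (exp (- S n \<omega>) - exp (- S n \<upsilon>))"
      using True iff by (simp add: branch_def ind_def)
    ultimately show ?thesis by (simp only: norm_of_real)
  next
    case False
    then have "branch n x \<omega> - branch n x \<upsilon> = 0" using iff by (simp add: branch_def ind_def)
    then show ?thesis using D_nonneg \<theta> by simp
  qed
qed

text \<open>The single branch that can contribute is the word of the first \<open>n\<close> letters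
  of \<open>x\<close>, and the normalisation cancels its weight. Admissibility includes the letter
  \<open>x n\<close>, the transition into \<upsilon>.\<close>

lemma transfer_branch:
  assumes x: "x \<in> X" and n: "0 < n" and \<upsilon>: "\<upsilon> \<in> X"
  shows "(L ^^ n) (branch n x) \<upsilon>
    = (if admissible M (map x [0..<Suc n]) then ind (map x [n..<n + k]) \<upsilon> else 0)"
proof -
  let ?a = "map x [0..<n]" and ?t = "map x [n..<n + k]"
  have iff: "conc w \<upsilon> \<in> cylinder X (map x [0..<n + k]) \<longleftrightarrow> w = ?a \<and> \<upsilon> \<in> cylinder X ?t"
    if w: "w \<in> words_to n (\<upsilon> 0)" for w
  proof -
    have X: "conc w \<upsilon> \<in> X" by (rule conc_X[OF \<upsilon> w])
    have len: "length w = n" using w by (simp add: words_to_def)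
    have "conc w \<upsilon> \<in> cylinder X (map x [0..<n + k]) \<longleftrightarrow> (\<forall>i<n + k. conc w \<upsilon> i = x i)"
      using X by (auto simp: cylinder_def)
    also have "\<dots> \<longleftrightarrow> (\<forall>i<n. w ! i = x i) \<and> (\<forall>i<k. \<upsilon> i = x (n + i))"
    proof (intro iffI conjI allI impI)
      assume *: "\<forall>i<n + k. conc w \<upsilon> i = x i"
      show "w ! i = x i" if "i < n" for i using *[rule_format, of i] that len by (simp add: conc_nth)
      show "\<upsilon> i = x (n + i)" if "i < k" for i using *[rule_format, of "n + i"] that len by (simp add: conc_nth)
    next
      fix i assume *: "(\<forall>i<n. w ! i = x i) \<and> (\<forall>i<k. \<upsilon> i = x (n + i))" and i: "i < n + k"
      show "conc w \<upsilon> i = x i"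
      proof (cases "i < n")
        case False
        then have "\<upsilon> (i - n) = x (n + (i - n))" using * i by simp
        then show ?thesis using False len by (simp add: conc_nth)
      qed (use * len in \<open>simp add: conc_nth\<close>)
    qed
    also have "(\<forall>i<n. w ! i = x i) \<longleftrightarrow> w = ?a"
      using len by (metis diff_zero length_map length_upt nth_equalityI nth_map_upt add.left_neutral)
    also have "(\<forall>i<k. \<upsilon> i = x (n + i)) \<longleftrightarrow> \<upsilon> \<in> cylinder X ?t" using \<upsilon> by (auto simp: cylinder_def)
    finally show ?thesis .
  qed
  have t: "trm n (branch n x) \<upsilon> w = (if w = ?a then ind ?t \<upsilon> else 0)" if "w \<in> words_to n (\<upsilon> 0)" for w
  proof -
    have "trm n (branch n x) \<upsilon> w = ind (map x [0..<n + k]) (conc w \<upsilon>)"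
      unfolding trm_def branch_def by (simp add: exp_minus)
    then show ?thesis using iff[OF that] by (simp add: ind_def)
  qed
  have "(L ^^ n) (branch n x) \<upsilon> = infsum (trm n (branch n x) \<upsilon>) (words_to n (\<upsilon> 0))"
    by (rule transfer_iterate[OF branch_bound[OF x] \<upsilon>])
  also have "\<dots> = infsum (\<lambda>w. if w = ?a then ind ?t \<upsilon> else 0) (words_to n (\<upsilon> 0))"
    by (rule infsum_cong) (rule t)
  also have "\<dots> = infsum (\<lambda>w. ind ?t \<upsilon>) (words_to n (\<upsilon> 0) \<inter> {?a})"
    by (rule infsum_cong_neutral) auto
  also have "\<dots> = (if ?a \<in> words_to n (\<upsilon> 0) then ind ?t \<upsilon> else 0)" by simp
  also have "\<dots> = (if admissible M (map x [0..<Suc n]) then ind ?t \<upsilon> else 0)"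
  proof (cases "\<upsilon> \<in> cylinder X ?t")
    case True
    then have "\<upsilon> 0 = x n" using k by (auto simp: cylinder_def)
    then show ?thesis by (simp add: words_to_def)
  qed (simp add: ind_def)
  finally show ?thesis .
qed

text \<open>If one of the two paths is not admissible for \<open>M\<close> up to position
  \<open>n\<close>, its branch alone is annihilated. Otherwise both branches are mapped to the
  indicator of the same tail, and their difference is annihilated.\<close>

lemma kernel_function:
  assumes x: "x \<in> cylinder X u" "x' \<in> cylinder X u" "x \<noteq> x'" "\<forall>i\<ge>n. x i = x' i"
    and n: "0 < n" "length u \<le> n"
  shows "\<exists>g\<in>V. g \<noteq> (\<lambda>x. 0) \<and> (L ^^ n) g = (\<lambda>x. 0) \<and> (\<forall>\<omega>. \<omega> \<notin> cylinder X u \<longrightarrow> g \<omega> = 0)"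
proof -
  interpret fs: fun_space V N by (rule fun_space_1)
  have X: "x \<in> X" "x' \<in> X" using x by (auto simp: cylinder_def)
  have supp: "branch n y \<omega> = 0" if "y \<in> cylinder X u" "\<omega> \<notin> cylinder X u" for y \<omega>
  proof -
    have "\<omega> \<notin> cylinder X (map y [0..<n + k])"
    proof
      assume c: "\<omega> \<in> cylinder X (map y [0..<n + k])"
      have "\<omega> i = u ! i" if "i < length u" for i
        using c \<open>y \<in> cylinder X u\<close> that n(2) by (auto simp: cylinder_def)
      then show False using c \<open>\<omega> \<notin> cylinder X u\<close> by (auto simp: cylinder_def)
    qed
    then show ?thesis by (simp add: branch_def ind_def)
  qed
  have self: "branch n y y \<noteq> 0" if "y \<in> X" for y
    using in_cylinder_prefix[OF that, of "n + k"] by (simp add: branch_def ind_def)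
  have off: "(L ^^ n) f \<omega> = 0" if "\<omega> \<notin> X" for f \<omega> by (rule transfer_off[OF that n(1)])
  have inadm: "\<exists>g\<in>V. g \<noteq> (\<lambda>x. 0) \<and> (L ^^ n) g = (\<lambda>x. 0) \<and> (\<forall>\<omega>. \<omega> \<notin> cylinder X u \<longrightarrow> g \<omega> = 0)"
    if y: "y \<in> cylinder X u" "\<not> admissible M (map y [0..<Suc n])" for y
  proof (intro bexI[of _ "branch n y"] conjI)
    have yX: "y \<in> X" using y(1) by (simp add: cylinder_def)
    show "branch n y \<in> V" by (rule branch_mem[OF yX])
    show "branch n y \<noteq> (\<lambda>x. 0)" using self[OF yX] by auto
    show "(L ^^ n) (branch n y) = (\<lambda>x. 0)"
    proof
      fix \<omega> show "(L ^^ n) (branch n y) \<omega> = 0"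
        using transfer_branch[OF yX n(1), of \<omega>] y(2) off[of \<omega>] by (cases "\<omega> \<in> X") auto
    qed
    show "\<forall>\<omega>. \<omega> \<notin> cylinder X u \<longrightarrow> branch n y \<omega> = 0" using supp[OF y(1)] by blast
  qed
  show ?thesis
  proof (cases "admissible M (map x [0..<Suc n]) \<and> admissible M (map x' [0..<Suc n])")
    case False
    then show ?thesis using inadm x(1,2) by blast
  next
    case True
    have Ln: "fs.bop (L ^^ n)" by (rule fs.bop_funpow[OF transfer_bop])
    have tails: "map x [n..<n + k] = map x' [n..<n + k]" using x(4) by simp
    obtain i where i: "x i \<noteq> x' i" using x(3) by auto
    then have "i < n" using x(4) by (meson not_le)
    then have "x \<notin> cylinder X (map x' [0..<n + k])" using i by (auto simp: cylinder_def intro!: exI[of _ i])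
    then have ne: "branch n x x - branch n x' x \<noteq> 0"
      using self[OF X(1)] by (simp add: branch_def ind_def)
    show ?thesis
    proof (intro bexI[of _ "\<lambda>\<omega>. branch n x \<omega> - branch n x' \<omega>"] conjI)
      show "(\<lambda>\<omega>. branch n x \<omega> - branch n x' \<omega>) \<in> V" by (intro fs.diff_mem branch_mem X)
      show "(\<lambda>\<omega>. branch n x \<omega> - branch n x' \<omega>) \<noteq> (\<lambda>x. 0)" using ne by (metis (mono_tags))
      show "(L ^^ n) (\<lambda>\<omega>. branch n x \<omega> - branch n x' \<omega>) = (\<lambda>x. 0)"
      proof
        fix \<omega>
        show "(L ^^ n) (\<lambda>\<omega>. branch n x \<omega> - branch n x' \<omega>) \<omega> = 0"
        proof (cases "\<omega> \<in> X")
          case w: True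
          then show ?thesis
            unfolding fs.bop_diff[OF Ln branch_mem[OF X(1)] branch_mem[OF X(2)]]
              transfer_branch[OF X(1) n(1) w] transfer_branch[OF X(2) n(1) w] tails
            using True by (simp only: if_True) simp
        qed (rule off)
      qed
      show "\<forall>\<omega>. \<omega> \<notin> cylinder X u \<longrightarrow> branch n x \<omega> - branch n x' \<omega> = 0" using supp x by simp
    qed
  qed
qed

end

text \<open>The operator \<open>U\<close> is a right inverse of \<open>L ^ n\<close> on the functions supported in the cylinder of \<open>u\<close>,
  and its norm is at most \<open>1 / (\<eta> \<theta>) ^ n\<close>.\<close>

locale loop_system = markov_subsystem A \<phi> \<theta> k M S0
  for A :: "'s \<Rightarrow> 's \<Rightarrow> nat" and \<phi> \<theta> k M S0 +
  fixes u :: "'s list" and W :: "'s list set" and n :: nat and \<eta> :: real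
  assumes u: "length u = k" and W: "finite W" "W \<subseteq> loop_set u" "\<And>l. l \<in> W \<Longrightarrow> length l = n"
    and n: "0 < n" "k \<le> n" and \<eta>: "0 < \<eta>"
    and heavy: "ennreal (exp D * \<eta> ^ n) < (\<Sum>l\<in>W. weight n (l @ u))"
begin

text \<open>For \<omega> in the cylinder of \<open>u\<close> this is the value at \<omega> of
  \<open>L ^^ n\<close> applied to the indicator of \<open>base\<close>. Dividing by it is what
  makes \<open>U\<close> a right inverse.\<close>

definition c :: "(nat \<Rightarrow> 's) \<Rightarrow> real" where "c \<omega> = (\<Sum>l\<in>W. exp (S n (conc l \<omega>)))"

definition base :: "(nat \<Rightarrow> 's) set" where "base = (\<Union>l\<in>W. cylinder X (l @ u))"

definition U :: "((nat \<Rightarrow> 's) \<Rightarrow> complex) \<Rightarrow> (nat \<Rightarrow> 's) \<Rightarrow> complex" where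
  "U g \<omega> = (if \<omega> \<in> base then g ((lshift ^^ n) \<omega>) / of_real (c ((lshift ^^ n) \<omega>)) else 0)"

lemma W_words_to:
  assumes "l \<in> W" "\<omega> \<in> cylinder X u"
  shows "l \<in> words_to n (\<omega> 0)"
proof -
  have adm: "admissible M (l @ u)" using W(2) assms(1) by (auto simp: loop_set_def)
  obtain a u' where u': "u = a # u'" using u k by (cases u) auto
  have "\<omega> 0 = a" using assms(2) u' by (auto simp: cylinder_def)
  then have "admissible M (l @ [\<omega> 0])" using adm admissible_appendD[of M "l @ [a]" u'] u' by simp
  then show ?thesis using W(3)[OF assms(1)] by (simp add: words_to_def)
qed

lemma conc_loop_cylinder:
  assumes "l \<in> W" "\<omega> \<in> cylinder X u"
  shows "conc l \<omega> \<in> cylinder X (l @ u)"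
proof -
  have \<omega>: "\<omega> \<in> X" using assms(2) by (simp add: cylinder_def)
  have "conc l \<omega> \<in> cylinder X l" by (rule conc_cylinder[OF \<omega> W_words_to[OF assms]])
  moreover have "conc l \<omega> i = (l @ u) ! i" if "i < length (l @ u)" for i
    using that assms(2) by (auto simp: conc_nth nth_append cylinder_def)
  ultimately show ?thesis by (simp add: cylinder_def)
qed

text \<open>The factor \<open>exp D\<close> in \<open>heavy\<close> pays for passing from the
  supremum over the cylinder of \<open>l @ u\<close> to the value at the one point
  \<open>conc l \<omega>\<close>.\<close>

lemma c_lower:
  assumes \<omega>: "\<omega> \<in> cylinder X u"
  shows "\<eta> ^ n \<le> c \<omega>"
proof -
  have "(\<Sum>l\<in>W. weight n (l @ u)) \<le> (\<Sum>l\<in>W. ennreal (exp D * exp (S n (conc l \<omega>))))"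
    using W(3) u by (intro sum_mono weight_le_exp conc_loop_cylinder \<omega>) auto
  also have "\<dots> = ennreal (exp D * c \<omega>)"
    unfolding c_def sum_distrib_left by (rule sum_ennreal) simp
  finally have "ennreal (exp D * \<eta> ^ n) < ennreal (exp D * c \<omega>)" using heavy by (rule order.strict_trans2[rotated])
  then have "exp D * \<eta> ^ n < exp D * c \<omega>" using \<eta> by (subst (asm) ennreal_less_iff) auto
  then show ?thesis by simp
qed

lemma c_pos: "\<omega> \<in> cylinder X u \<Longrightarrow> 0 < c \<omega>"
  using c_lower[of \<omega>] \<eta> by (meson order.strict_trans2 zero_less_power)

text \<open>The estimate is made term by term and stays relative to \<open>c \<upsilon>\<close>, so
  that \<open>c \<upsilon>\<close> cancels in the difference of the reciprocals and only the lower
  bound of \<open>c\<close> enters.\<close>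

lemma c_diff:
  assumes \<omega>: "\<omega> \<in> cylinder X u" "\<upsilon> \<in> cylinder X u" and m: "k \<le> m" "\<forall>i<m. \<omega> i = \<upsilon> i"
  shows "\<bar>c \<omega> - c \<upsilon>\<bar> \<le> exp D * D * \<theta> ^ m * c \<upsilon>"
proof -
  have "\<bar>c \<omega> - c \<upsilon>\<bar> \<le> (\<Sum>l\<in>W. \<bar>exp (S n (conc l \<omega>)) - exp (S n (conc l \<upsilon>))\<bar>)"
    unfolding c_def sum_subtractf[symmetric] by (rule sum_abs)
  also have "\<dots> \<le> (\<Sum>l\<in>W. exp D * D * \<theta> ^ m * exp (S n (conc l \<upsilon>)))"
  proof (rule sum_mono)
    fix l assume l: "l \<in> W"
    have X: "conc l \<omega> \<in> X" "conc l \<upsilon> \<in> X"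
      using conc_loop_cylinder[OF l \<omega>(1)] conc_loop_cylinder[OF l \<omega>(2)] by (auto simp: cylinder_def)
    have agree: "\<forall>i<n + m. conc l \<omega> i = conc l \<upsilon> i" using m(2) W(3)[OF l] by (auto simp: conc_nth)
    have "S n (conc l \<omega>) \<le> D + S n (conc l \<upsilon>)" using agree m(1) by (intro distortion_D X) auto
    then have le: "exp (S n (conc l \<omega>)) \<le> exp D * exp (S n (conc l \<upsilon>))" by (simp flip: exp_add)
    have le': "exp (S n (conc l \<upsilon>)) \<le> exp D * exp (S n (conc l \<upsilon>))" using D_nonneg by simp
    have "\<bar>exp (S n (conc l \<omega>)) - exp (S n (conc l \<upsilon>))\<bar>
        \<le> exp D * exp (S n (conc l \<upsilon>)) * \<bar>S n (conc l \<omega>) - S n (conc l \<upsilon>)\<bar>"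
      by (rule exp_diff_le[OF le le'])
    also have "\<dots> \<le> exp D * exp (S n (conc l \<upsilon>)) * (D * \<theta> ^ m)"
      by (intro mult_left_mono distortion X agree m(1)) auto
    finally show "\<bar>exp (S n (conc l \<omega>)) - exp (S n (conc l \<upsilon>))\<bar> \<le> exp D * D * \<theta> ^ m * exp (S n (conc l \<upsilon>))"
      by (simp add: ac_simps)
  qed
  finally show ?thesis by (simp add: c_def sum_distrib_left)
qed

lemma base_shift: "\<omega> \<in> base \<Longrightarrow> (lshift ^^ n) \<omega> \<in> cylinder X u"
  using cylinder_append[of \<omega> UNIV A _ u] W(3) by (auto simp: base_def)

text \<open>Since \<open>l @ u\<close> begins with \<open>u\<close>, the image of \<open>U\<close>
  consists of functions supported in the cylinder of \<open>u\<close>, the domain on which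
  \<open>U\<close> inverts \<open>L ^^ n\<close>.\<close>

lemma base_subset: "base \<subseteq> cylinder X u"
proof
  fix \<omega> assume "\<omega> \<in> base"
  then obtain l where l: "l \<in> W" "\<omega> \<in> cylinder X (l @ u)" by (auto simp: base_def)
  have tk: "take k (l @ u) = u" using W(2) l(1) by (auto simp: loop_set_def)
  have "\<omega> \<in> cylinder X (take k (l @ u))"
    using cylinder_append[of \<omega> UNIV A "take k (l @ u)" "drop k (l @ u)"] l(2)
    unfolding append_take_drop_id by blast
  then show "\<omega> \<in> cylinder X u" unfolding tk .
qed

lemma base_agree:
  assumes "\<omega> \<in> X" "\<upsilon> \<in> X" "\<forall>i<m. \<omega> i = \<upsilon> i" "n + k \<le> m"
  shows "\<omega> \<in> base \<longleftrightarrow> \<upsilon> \<in> base"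
proof -
  have "\<omega> \<in> cylinder X (l @ u) \<longleftrightarrow> \<upsilon> \<in> cylinder X (l @ u)" if "l \<in> W" for l
  proof -
    have len: "length (l @ u) \<le> m" using W(3)[OF that] u assms(4) by simp
    have "(\<forall>i<length (l @ u). \<omega> i = (l @ u) ! i) \<longleftrightarrow> (\<forall>i<length (l @ u). \<upsilon> i = (l @ u) ! i)"
      using assms(3) len by (metis order.strict_trans2)
    then show ?thesis using assms(1,2) by (simp add: cylinder_def)
  qed
  then show ?thesis by (auto simp: base_def)
qed

lemma U_sup:
  assumes g: "g \<in> V"
  shows "cmod (U g \<omega>) \<le> supn X g / \<eta> ^ n"
proof (cases "\<omega> \<in> base")
  case True
  let ?y = "(lshift ^^ n) \<omega>"
  have y: "\<eta> ^ n \<le> c ?y" "0 < c ?y" using c_lower[OF base_shift[OF True]] c_pos[OF base_shift[OF True]] by auto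
  have "cmod (U g \<omega>) = cmod (g ?y) / c ?y" using True y(2) by (simp add: U_def norm_divide)
  also have "\<dots> \<le> supn X g / \<eta> ^ n" using y(1) \<eta> FbD(2,4)[OF g] by (intro frac_le) auto
  finally show ?thesis .
next
  case False
  then show ?thesis using FbD(4)[OF g] \<eta> by (simp add: U_def)
qed

text \<open>Composition with the \<open>n\<close>-fold shift loses \<open>n\<close> letters of
  agreement, which gives \<open>1 / \<theta> ^ n\<close>; division by \<open>c\<close> gives
  \<open>1 / \<eta> ^ n\<close>.\<close>

lemma U_lip:
  assumes g: "g \<in> V" and m: "n + k \<le> m" and X: "\<omega> \<in> X" "\<upsilon> \<in> X" and agree: "\<forall>i<m. \<omega> i = \<upsilon> i"
  shows "cmod (U g \<omega> - U g \<upsilon>) \<le> (lipn X \<theta> k g + exp D * D * supn X g) / (\<eta> * \<theta>) ^ n * \<theta> ^ m"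
proof (cases "\<omega> \<in> base")
  case True
  then have True': "\<upsilon> \<in> base" using base_agree[OF X agree m] by simp
  let ?x = "(lshift ^^ n) \<omega>" and ?y = "(lshift ^^ n) \<upsilon>"
  have xy: "?x \<in> cylinder X u" "?y \<in> cylinder X u" using base_shift True True' by auto
  then have xyX: "?x \<in> X" "?y \<in> X" by (auto simp: cylinder_def)
  have mn: "k \<le> m - n" using m by simp
  have ag: "\<forall>i<m - n. ?x i = ?y i" using agree by (simp add: funpow_lshift)
  have cx: "0 < c ?x" "\<eta> ^ n \<le> c ?x" and cy: "0 < c ?y" using c_pos c_lower xy by auto
  let ?t = "\<theta> ^ (m - n)"
  have t: "0 \<le> ?t" using \<theta> by simp
  have g1: "cmod (g ?x - g ?y) \<le> lipn X \<theta> k g * ?t" by (rule FbD(3)[OF g mn xyX ag])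
  have split: "U g \<omega> - U g \<upsilon> = (g ?x - g ?y) / of_real (c ?x) + g ?y * of_real ((c ?y - c ?x) / (c ?x * c ?y))"
    using True True' cx cy by (simp add: U_def field_simps)
  have 1: "cmod ((g ?x - g ?y) / of_real (c ?x)) \<le> lipn X \<theta> k g * ?t / \<eta> ^ n"
  proof -
    have "cmod ((g ?x - g ?y) / of_real (c ?x)) = cmod (g ?x - g ?y) / c ?x" using cx by (simp add: norm_divide)
    also have "\<dots> \<le> lipn X \<theta> k g * ?t / \<eta> ^ n" using g1 cx \<eta> FbD(5)[OF g] t by (intro frac_le) auto
    finally show ?thesis .
  qed
  have 2: "cmod (g ?y * of_real ((c ?y - c ?x) / (c ?x * c ?y))) \<le> supn X g * (exp D * D * ?t / \<eta> ^ n)"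
  proof -
    have "\<bar>c ?y - c ?x\<bar> / (c ?x * c ?y) \<le> exp D * D * ?t * c ?y / (\<eta> ^ n * c ?y)"
      using c_diff[OF xy mn ag] cx cy \<eta> D_nonneg t
      by (intro frac_le mult_right_mono) (auto simp: abs_minus_commute)
    also have "\<dots> = exp D * D * ?t / \<eta> ^ n" using cy by simp
    finally have "\<bar>(c ?y - c ?x) / (c ?x * c ?y)\<bar> \<le> exp D * D * ?t / \<eta> ^ n"
      using cx cy by (simp add: abs_mult)
    then show ?thesis unfolding norm_mult norm_of_real
      using FbD(2,4)[OF g] by (intro mult_mono) auto
  qed
  have "cmod (U g \<omega> - U g \<upsilon>) \<le> lipn X \<theta> k g * ?t / \<eta> ^ n + supn X g * (exp D * D * ?t / \<eta> ^ n)"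
    unfolding split using norm_triangle_le[OF add_mono[OF 1 2]] .
  also have "\<dots> = (lipn X \<theta> k g + exp D * D * supn X g) / \<eta> ^ n * ?t"
    by (simp add: add_divide_distrib algebra_simps)
  also have "?t = \<theta> ^ m / \<theta> ^ n" using m \<theta> by (simp add: power_diff)
  finally show ?thesis by (simp add: power_mult_distrib)
next
  case False
  then have "U g \<omega> - U g \<upsilon> = 0" using base_agree[OF X agree m] by (simp add: U_def)
  then show ?thesis using FbD(4,5)[OF g] D_nonneg \<theta> \<eta> by simp
qed

text \<open>The coefficient of \<open>supn X g\<close> in the bound for the Lipschitz constant of
  \<open>U g\<close>, apart from the factor \<open>1 / (\<eta> * \<theta>) ^ n\<close>:
  \<open>exp D * D\<close> stems from the variation of \<open>c\<close>, and
  \<open>2 / \<theta> ^ k\<close> from points that agree on fewer than \<open>n + k\<close>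
  letters.\<close>

definition C2 :: real where "C2 = exp D * D + 2 / \<theta> ^ k"

text \<open>Chosen so that \<open>K * \<theta> ^ n + C2 \<le> K\<close>. The supremum norm of
  \<open>U g\<close> is smaller than the rate \<open>1 / (\<eta> * \<theta>) ^ n\<close> by a factor
  \<open>\<theta> ^ n\<close>, and this surplus, weighted by \<open>K\<close>, absorbs
  \<open>C2\<close>.\<close>

definition K :: real where "K = 1 + C2 / (1 - \<theta>)"

lemma K: "1 \<le> K" "K * \<theta> ^ n + C2 \<le> K"
proof -
  have C2: "0 \<le> C2" unfolding C2_def using D_nonneg \<theta> by simp
  have t: "\<theta> ^ n \<le> \<theta>" using power_decreasing[of 1 n \<theta>] n \<theta> by simp
  show K1: "1 \<le> K" unfolding K_def using C2 \<theta> by simp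
  have "K * (1 - \<theta>) = (1 - \<theta>) + C2" unfolding K_def using \<theta> by (simp add: field_simps)
  then have "C2 \<le> K * (1 - \<theta>)" using \<theta> by simp
  also have "\<dots> \<le> K * (1 - \<theta> ^ n)" using K1 t by (intro mult_left_mono) auto
  finally show "K * \<theta> ^ n + C2 \<le> K" by (simp add: algebra_simps)
qed

lemma U_FbN:
  assumes g: "g \<in> V"
  shows "U g \<in> V" "FbN X \<theta> k K (U g) \<le> 1 / (\<eta> * \<theta>) ^ n * FbN X \<theta> k K g"
proof -
  note gD = FbD[OF g]
  let ?B = "supn X g / \<eta> ^ n" and ?C = "(lipn X \<theta> k g + exp D * D * supn X g) / (\<eta> * \<theta>) ^ n"
  have off: "U g \<omega> = 0" if "\<omega> \<notin> X" for \<omega>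
    using that base_subset by (auto simp: U_def cylinder_def)
  have C: "0 \<le> ?C" using gD(4,5) D_nonneg \<theta> \<eta> by simp
  show "U g \<in> V" by (rule Fb_largeI(1)[OF off U_sup[OF g] C U_lip[OF g]])
  have s: "supn X (U g) \<le> ?B" by (rule Fb_largeI(2)[OF off U_sup[OF g] C U_lip[OF g]])
  have l: "lipn X \<theta> k (U g) \<le> ?C + 2 * ?B / \<theta> ^ (n + k)"
    by (rule Fb_largeI(3)[OF off U_sup[OF g] C U_lip[OF g]])
  have "FbN X \<theta> k K (U g) \<le> K * ?B + (?C + 2 * ?B / \<theta> ^ (n + k))"
    unfolding FbN_def using s l K(1) by (intro add_mono mult_left_mono) auto
  also have "\<dots> = 1 / (\<eta> * \<theta>) ^ n * ((K * \<theta> ^ n + C2) * supn X g + lipn X \<theta> k g)"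
  proof -
    have "\<theta> \<noteq> 0" "\<eta> \<noteq> 0" using \<theta> \<eta> by auto
    then show ?thesis unfolding C2_def by (simp add: power_mult_distrib power_add field_simps)
  qed
  also have "\<dots> \<le> 1 / (\<eta> * \<theta>) ^ n * (K * supn X g + lipn X \<theta> k g)"
    using K(2) gD(4) \<eta> \<theta> by (intro mult_left_mono add_right_mono mult_right_mono) auto
  finally show "FbN X \<theta> k K (U g) \<le> 1 / (\<eta> * \<theta>) ^ n * FbN X \<theta> k K g" by (simp add: FbN_def)
qed

lemma U_bop: "fun_space.bop V (FbN X \<theta> k K) U"
  unfolding fun_space.bop_def[OF fun_space[OF K(1)]]
  using U_FbN by (intro conjI ballI allI exI[of _ "1 / (\<eta> * \<theta>) ^ n"])
    (auto simp: U_def fun_eq_iff add_divide_distrib)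

text \<open>Over a point of the cylinder of \<open>u\<close> exactly the branches \<open>l\<close>
  in \<open>W\<close> end in \<open>base\<close>, and their weights add up to the normalising
  \<open>c\<close>. Over other points no branch does, and \<open>f\<close> vanishes there.\<close>

lemma transfer_U:
  assumes f: "f \<in> V" and supp: "\<And>\<omega>. \<omega> \<notin> cylinder X u \<Longrightarrow> f \<omega> = 0"
  shows "(L ^^ n) (U f) = f"
proof
  fix \<upsilon>
  show "(L ^^ n) (U f) \<upsilon> = f \<upsilon>"
  proof (cases "\<upsilon> \<in> X")
    case False
    then have "f \<upsilon> = 0" using supp[of \<upsilon>] by (simp add: cylinder_def)
    then show ?thesis using transfer_off[OF False n(1)] by simp
  next
    case \<upsilon>: True
    have sh: "(lshift ^^ n) (conc w \<upsilon>) = \<upsilon>" if "w \<in> words_to n (\<upsilon> 0)" for w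
      using that funpow_lshift_conc[of w \<upsilon>] by (simp add: words_to_def)
    have it: "(L ^^ n) (U f) \<upsilon> = infsum (trm n (U f) \<upsilon>) (words_to n (\<upsilon> 0))"
      by (rule transfer_iterate[OF U_sup[OF f] \<upsilon>])
    show ?thesis
    proof (cases "\<upsilon> \<in> cylinder X u")
      case False
      have "conc w \<upsilon> \<notin> base" if "w \<in> words_to n (\<upsilon> 0)" for w
        using base_shift[of "conc w \<upsilon>"] sh[OF that] False by auto
      then have "infsum (trm n (U f) \<upsilon>) (words_to n (\<upsilon> 0)) = infsum (\<lambda>_. 0) (words_to n (\<upsilon> 0))"
        by (intro infsum_cong) (simp add: trm_def U_def)
      then show ?thesis using it supp[OF False] by simp
    next
      case cyl: True
      have sub: "W \<subseteq> words_to n (\<upsilon> 0)" using W_words_to cyl by blast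
      have out: "conc w \<upsilon> \<notin> base" if "w \<in> words_to n (\<upsilon> 0)" "w \<notin> W" for w
      proof
        assume "conc w \<upsilon> \<in> base"
        then obtain l where l: "l \<in> W" "conc w \<upsilon> \<in> cylinder X (l @ u)" by (auto simp: base_def)
        have "conc w \<upsilon> \<in> cylinder X l" using cylinder_append[OF l(2)] by simp
        moreover have "conc w \<upsilon> \<in> cylinder X w" by (rule conc_cylinder[OF \<upsilon> that(1)])
        ultimately have "l = w" using W(3)[OF l(1)] that(1) by (intro in_cylinder_length) (auto simp: words_to_def)
        then show False using l(1) that(2) by simp
      qed
      have c0: "c \<upsilon> \<noteq> 0" using c_pos[OF cyl] by simp
      have tW: "trm n (U f) \<upsilon> l = of_real (exp (S n (conc l \<upsilon>))) * (f \<upsilon> / of_real (c \<upsilon>))" if l: "l \<in> W" for l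
      proof -
        have "conc l \<upsilon> \<in> base" using conc_loop_cylinder[OF l cyl] l by (auto simp: base_def)
        then show ?thesis using sh[of l] sub l by (auto simp: trm_def U_def)
      qed
      have "infsum (trm n (U f) \<upsilon>) (words_to n (\<upsilon> 0)) = infsum (trm n (U f) \<upsilon>) W"
        by (rule infsum_cong_neutral) (use sub out in \<open>auto simp: trm_def U_def\<close>)
      also have "\<dots> = (\<Sum>l\<in>W. of_real (exp (S n (conc l \<upsilon>))) * (f \<upsilon> / of_real (c \<upsilon>)))"
        using W(1) tW by simp
      also have "\<dots> = of_real (c \<upsilon>) * (f \<upsilon> / of_real (c \<upsilon>))"
      proof -
        have "(\<Sum>l\<in>W. of_real (exp (S n (conc l \<upsilon>))) * q) = of_real (c \<upsilon>) * q" for q :: complex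
          unfolding c_def of_real_sum sum_distrib_right ..
        then show ?thesis .
      qed
      also have "\<dots> = f \<upsilon>" using c0 by simp
      finally show ?thesis using it by simp
    qed
  qed
qed

text \<open>The function \<open>f\<close> is the Neumann series of \<open>U\<close> at
  \<open>1 / z ^ n\<close>, whose modulus exceeds the norm bound of \<open>U\<close> because
  \<open>cmod z < \<eta> * \<theta>\<close>. The weighted norm serves to sum this series; applying
  \<open>L ^^ n\<close> afterwards is pure algebra.\<close>

lemma eigenfunction:
  assumes g: "g \<in> V" "g \<noteq> (\<lambda>x. 0)" "(L ^^ n) g = (\<lambda>x. 0)" "\<And>\<omega>. \<omega> \<notin> cylinder X u \<Longrightarrow> g \<omega> = 0"
    and z: "z \<noteq> 0" "cmod z < \<eta> * \<theta>"
  shows "\<exists>f\<in>V. f \<noteq> (\<lambda>x. 0) \<and> (L ^^ n) f = (\<lambda>x. z ^ n * f x)"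
proof -
  interpret K: fun_space V "FbN X \<theta> k K" by (rule fun_space[OF K(1)])
  interpret fs: fun_space V N by (rule fun_space_1)
  let ?\<rho> = "1 / (\<eta> * \<theta>) ^ n" and ?w = "1 / z ^ n"
  have \<rho>: "0 < ?\<rho>" using \<eta> \<theta> by simp
  have w: "?\<rho> < cmod ?w"
    using z n \<eta> \<theta> power_strict_mono[of "cmod z" "\<eta> * \<theta>" n]
    by (simp add: norm_divide norm_power frac_less2)
  define f where "f = K.neumann U ?w g"
  have f: "f \<in> V" unfolding f_def by (rule K.neumann_mem(1)[OF U_bop U_FbN(2) \<rho> g(1) w])
  have eq: "?w * f x - U f x = g x" for x
    unfolding f_def by (rule K.neumann_right[OF U_bop U_FbN(2) \<rho> g(1) w])
  have feq: "f = (\<lambda>x. z ^ n * (g x + U f x))"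
  proof
    fix x
    have "?w * f x = g x + U f x" using eq[of x] by (metis diff_add_cancel)
    then have "z ^ n * (?w * f x) = z ^ n * (g x + U f x)" by (rule arg_cong)
    then show "f x = z ^ n * (g x + U f x)" using z(1) by simp
  qed
  have supp: "f \<omega> = 0" if "\<omega> \<notin> cylinder X u" for \<omega>
    using fun_cong[OF feq, of \<omega>] g(4)[OF that] base_subset that by (auto simp: U_def)
  have Uf: "U f \<in> V" by (rule U_FbN(1)[OF f])
  have Ln: "fs.bop (L ^^ n)" by (rule fs.bop_funpow[OF transfer_bop])
  have "(L ^^ n) f = (L ^^ n) (\<lambda>x. z ^ n * (g x + U f x))" by (rule arg_cong[OF feq])
  also have "\<dots> = (\<lambda>x. z ^ n * ((L ^^ n) g x + (L ^^ n) (U f) x))"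
    unfolding fs.bopD(3)[OF Ln fs.add_mem[OF g(1) Uf]] fs.bopD(2)[OF Ln g(1) Uf] ..
  also have "(L ^^ n) (U f) = f" by (rule transfer_U[OF f supp])
  also have "(\<lambda>x. z ^ n * ((L ^^ n) g x + f x)) = (\<lambda>x. z ^ n * f x)" unfolding g(3) by simp
  finally have eig: "(L ^^ n) f = (\<lambda>x. z ^ n * f x)" .
  \<comment> \<open>If \<open>f\<close> vanished, the equation defining it would force
    \<open>g = 0\<close>.\<close>
  have "f \<noteq> (\<lambda>x. 0)"
  proof
    assume f0: "f = (\<lambda>x. 0)"
    have "g x = 0" for x using eq[of x] unfolding f0 by (simp add: U_def split: if_splits)
    then show False using g(2) by blast
  qed
  then show ?thesis using f eig by blast
qed

end

section \<open>Spectral values on every smaller circle, and the conclusion\<close>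

context markov_subsystem
begin

text \<open>The block belongs to \<eta>, and \<open>n\<close> is chosen for the block;
  \<open>r ^ n\<close> becomes an eigenvalue of \<open>L ^^ n\<close>, and passing to
  \<open>L\<close> preserves the modulus.\<close>

lemma spectrum_of_each_modulus:
  assumes irr: "finitely_irreducible A" and not_orbit: "\<not> finite_single_orbit X"
    and \<eta>: "0 < \<eta>" "\<eta> < \<Lambda>" and r: "0 < r" "r < \<eta> * \<theta>"
  shows "\<exists>\<zeta>\<in>spectrum V N L. cmod \<zeta> = r"
proof -
  obtain u where u: "length u = k" and many: "\<And>K n0. \<exists>n\<ge>n0. ennreal (K * \<eta> ^ n)
      < infsum (\<lambda>l. weight (length l) (l @ u)) {l \<in> loop_set u. length l = n}"
    using many_loops[OF \<eta>] by blast
  have "loop_set u \<noteq> {}"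
  proof
    assume "loop_set u = {}"
    then show False using many[of 0 0] by simp
  qed
  then obtain l where "admissible M (l @ u)" by (auto simp: loop_set_def)
  then have "admissible M u" using admissible_appendD by blast
  then have "admissible A u" using M_A by (simp add: admissible_nth)
  moreover have "u \<noteq> []" using u k by auto
  moreover have "has_periodic_point X" using periodic XM_subset by (auto simp: has_periodic_point_def)
  ultimately have "\<exists>x\<in>cylinder X u. \<exists>x'\<in>cylinder X u. x \<noteq> x' \<and> (\<exists>n0. \<forall>i\<ge>n0. x i = x' i)"
    by (intro eventually_equal_paths[OF irr _ not_orbit])
  then obtain x x' n0 where x: "x \<in> cylinder X u" "x' \<in> cylinder X u" "x \<noteq> x'" "\<forall>i\<ge>n0. x i = x' i"
    by (elim bexE conjE exE)
  \<comment> \<open>One \<open>n\<close> serves three purposes: the loops are heavy enough to pay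
    for \<open>exp D\<close>, the two paths agree from \<open>n\<close> on, and
    \<open>n \<ge> k\<close>.\<close>
  obtain n where n: "n0 + k \<le> n" "ennreal (exp D * \<eta> ^ n)
      < infsum (\<lambda>l. weight (length l) (l @ u)) {l \<in> loop_set u. length l = n}"
    using many by blast
  have n': "0 < n" "k \<le> n" "n0 \<le> n" using n(1) k by auto
  \<comment> \<open>The total weight is a supremum of finite sums, and the inequality is strict, so
    finitely many loops suffice.\<close>
  obtain W where W: "finite W" "W \<subseteq> {l \<in> loop_set u. length l = n}"
      "ennreal (exp D * \<eta> ^ n) < (\<Sum>l\<in>W. weight (length l) (l @ u))"
    using n(2) unfolding infsum_ennreal_eq_SUP less_SUP_iff by blast
  have sW: "(\<Sum>l\<in>W. weight (length l) (l @ u)) = (\<Sum>l\<in>W. weight n (l @ u))"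
    using W(2) by (intro sum.cong refl) auto
  interpret ls: loop_system A \<phi> \<theta> k M S0 u W n \<eta>
    by unfold_locales (use W sW u n' \<eta> in auto)
  obtain g where g: "g \<in> V" "g \<noteq> (\<lambda>x. 0)" "(L ^^ n) g = (\<lambda>x. 0)" "\<And>\<omega>. \<omega> \<notin> cylinder X u \<Longrightarrow> g \<omega> = 0"
  proof -
    have "\<forall>i\<ge>n. x i = x' i" "length u \<le> n" using x(4) n' u by auto
    from kernel_function[OF x(1-3) this(1) n'(1) this(2)] show ?thesis using that by (elim bexE conjE) simp
  qed
  have zr: "complex_of_real r \<noteq> 0" "cmod (complex_of_real r) < \<eta> * \<theta>" using r by auto
  obtain f where f: "f \<in> V" "f \<noteq> (\<lambda>x. 0)" "(L ^^ n) f = (\<lambda>x. complex_of_real r ^ n * f x)"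
    using ls.eigenfunction[OF g zr] by blast
  have "\<exists>\<zeta>\<in>spectrum V N L. cmod \<zeta> = cmod (complex_of_real r)"
    by (rule fun_space.spectrum_root[OF fun_space_1 transfer_bop f(1,2) n'(1) zr(1) f(3)])
  then show ?thesis using r(1) by simp
qed

text \<open>One spectral value for each modulus in an interval gives infinitely many in a compact
  annulus. They accumulate there, and by closedness the limit point belongs to the spectrum.\<close>

lemma non_isolated_spectral_value:
  assumes irr: "finitely_irreducible A" and not_orbit: "\<not> finite_single_orbit X"
    and r: "0 \<le> r" "r < \<Lambda> * \<theta>"
  shows "\<exists>z\<in>spectrum V N L. r < cmod z \<and> \<not> z isolated_in spectrum V N L"
proof -
  have "r / \<theta> < \<Lambda>" using r(2) \<theta> by (simp add: field_simps)
  then obtain \<eta> where \<eta>: "r / \<theta> < \<eta>" "\<eta> < \<Lambda>" using dense by blast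
  have \<eta>0: "0 < \<eta>" using \<eta>(1) r(1) \<theta> by (smt (verit) divide_nonneg_pos)
  have "r < \<eta> * \<theta>" using \<eta>(1) \<theta> by (simp add: field_simps)
  then obtain b where b: "r < b" "b < \<eta> * \<theta>" using dense by blast
  \<comment> \<open>The lower modulus is kept strictly above \<open>r\<close>, so that the limit
    point still has modulus greater than \<open>r\<close>.\<close>
  obtain a where a: "r < a" "a < b" using dense[OF b(1)] by blast
  have "\<exists>\<zeta>\<in>spectrum V N L. cmod \<zeta> = t" if "t \<in> {a..b}" for t
    using that a b r(1) by (intro spectrum_of_each_modulus[OF irr not_orbit \<eta>0 \<eta>(2)]) auto
  then obtain \<zeta> where \<zeta>: "\<And>t. t \<in> {a..b} \<Longrightarrow> \<zeta> t \<in> spectrum V N L \<and> cmod (\<zeta> t) = t" by metis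
  have "inj_on \<zeta> {a..b}" using \<zeta> by (metis inj_onI)
  then have inf: "infinite (\<zeta> ` {a..b})" using a(2) by (simp add: finite_image_iff)
  have comp: "compact (cball 0 b \<inter> {z :: complex. a \<le> cmod z})"
    by (intro compact_Int_closed compact_cball closed_Collect_le continuous_intros)
  have "\<zeta> ` {a..b} \<subseteq> cball 0 b \<inter> {z. a \<le> cmod z}" using \<zeta> by auto
  then obtain z where z: "z \<in> cball 0 b \<inter> {z. a \<le> cmod z}" "z islimpt \<zeta> ` {a..b}"
    using comp inf unfolding compact_eq_Bolzano_Weierstrass by blast
  have lim: "z islimpt spectrum V N L" using z(2) by (rule islimpt_subset) (use \<zeta> in auto)
  have "closed (spectrum V N L)" by (rule fun_space.closed_spectrum[OF fun_space_1 transfer_bop])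
  then have "z \<in> spectrum V N L" using lim closed_limpt by blast
  moreover have "r < cmod z" using z(1) a(1) by auto
  moreover have "\<not> z isolated_in spectrum V N L" using lim by (simp add: isolated_in_islimpt_iff)
  ultimately show ?thesis by blast
qed

theorem essential_spectral_radius_eq:
  assumes "finitely_irreducible A" "\<not> finite_single_orbit X"
  shows "essential_spectral_radius V N L = \<Lambda> * \<theta>"
  unfolding essential_spectral_radius_def
proof (rule cInf_eq_minimum)
  show "\<Lambda> * \<theta> \<in> {r. 0 \<le> r \<and> (\<forall>z\<in>spectrum V N L. r < cmod z \<longrightarrow>
      z isolated_in spectrum V N L \<and> eigenvalue V L z \<and> finite_algebraic_multiplicity V N L z)}"
    using spectrum_outside_disc \<Lambda>_pos \<theta> by auto
  show "\<Lambda> * \<theta> \<le> r" if "r \<in> {r. 0 \<le> r \<and> (\<forall>z\<in>spectrum V N L. r < cmod z \<longrightarrow>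
      z isolated_in spectrum V N L \<and> eigenvalue V L z \<and> finite_algebraic_multiplicity V N L z)}" for r
    using that non_isolated_spectral_value[OF assms, of r] by force
qed

end

theorem corollary3p2:
  fixes A M :: "'s::countable \<Rightarrow> 's \<Rightarrow> nat"
    and S0 :: "'s set"
    and \<phi> :: "(nat \<Rightarrow> 's) \<Rightarrow> real"
    and \<theta> :: real
    and k :: nat
  assumes theta: "0 < \<theta>" "\<theta> < 1"
    and A01: "zero_one_matrix A"
    and S0: "S0 \<noteq> {}"
    and M01: "zero_one_matrix M"
    and M_le: "\<And>i j. M i j \<le> A i j"
    and M_off: "\<And>i j. i \<notin> S0 \<or> j \<notin> S0 \<Longrightarrow> M i j = 0"
    and A1: "finitely_irreducible A"
    and A2: "has_periodic_point (path_space S0 M)"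
    and k: "k \<ge> 1"
    and A3: "summable_potential (full_path_space A) \<phi>" "lip_seminorm (full_path_space A) \<theta> (k + 1) \<phi> < \<infinity>"
    and not_orbit: "\<not> finite_single_orbit (full_path_space A)"
  shows "essential_spectral_radius (Fb (full_path_space A) \<theta> k)
           (Fb_norm (full_path_space A) \<theta> k)
           (transfer_op (full_path_space A) M \<phi>)
           = exp (pressure (full_path_space A) S0 (path_space S0 M) \<phi>) * \<theta>"
proof -
  interpret markov_subsystem A \<phi> \<theta> k M S0
  proof
    show "A i j = 1" if "M i j = 1" for i j
      using M_le[of i j] A01 that unfolding zero_one_matrix_def by (metis not_one_le_zero)
    show "i \<in> S0 \<and> j \<in> S0" if "M i j = 1" for i j
      using M_off[of i j] that by auto
  qed (use theta k A2 A3 in auto)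
  show ?thesis
    using essential_spectral_radius_eq[OF A1 not_orbit] unfolding Fb_norm_eq \<Lambda>_def .
qed

end
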